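(* Let $Q$ be the homogeneous dimension of the Carnot group and let $Q>p_i>1$ for $i=1,2$. For $i=1,2$ let $\mathscr A_{p_i}:\mathbb R^N\times\mathbb R\times\mathbb R^l\to\mathbb R^l$ be a Carathéodory function that is weakly-$p_i$-coercive, and assume that the weak Harnack inequality (WH) holds for $\mathscr A_{p_1}$ and $\mathscr A_{p_2}$ (see context). Let $f,g:(0,+\infty)\to[0,+\infty)$ be continuous functions such that, for some $a>0$ and $b>0$, $$\liminf_{t\to0}\frac{f(t)}{t^{a}}>0\ \ (\text{possibly }+\infty),\qquad \liminf_{t\to0}\frac{g(t)}{t^{b}}>0\ \ (\text{possibly }+\infty),$$ and assume that $$\min\left\{Q-p_1-(p_1-1)\frac{p_2}{b},\ Q-p_2-(p_2-1)\frac{p_1}{a}\right\}\le Q\,\frac{(p_1-1)(p_2-1)}{ab}.$$ Then the system $$\begin{cases}-\mathrm{div}_L(\mathscr A_{p_1}(x,u,\nabla_L u))\ge f(v)&\text{on }\mathbb R^N,\\ -\mathrm{div}_L(\mathscr A_{p_2}(x,v,\nabla_L v))\ge g(u)&\text{on }\mathbb R^N,\\ u>0,\ v>0\end{cases}$$ has no weak solution $(u,v)$ such that $\operatorname{ess\,inf}_{\mathbb R^N}u=\operatorname{ess\,inf}_{\mathbb R^N}v=0$.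
   Context: Setting: $\mathbb R^N$ carries the structure of a homogeneous Carnot group $(\mathbb R^N,\circ,\delta_R)$: $\mathbb R^N=\mathbb R^{n_1}\times\dots\times\mathbb R^{n_r}$, $\circ$ is a Lie group law, and for every $R>0$ the dilation $\delta_R(\xi^{(1)},\dots,\xi^{(r)})=(R\xi^{(1)},R^2\xi^{(2)},\dots,R^r\xi^{(r)})$ is a group automorphism. With $l=n_1$, for $i=1,\dots,l$ let $X_i$ be the left-invariant vector field that coincides with $\partial/\partial\xi^{(1)}_i$ at the origin; it is assumed that $X_1,\dots,X_l$ generate the whole Lie algebra of left-invariant vector fields. $\nabla_L=(X_1,\dots,X_l)^T$ is the horizontal gradient and $\mathrm{div}_L(h)=-\sum_{i=1}^lX_i^*h_i$, where $X_i^*$ is the formal adjoint of $X_i$. $Q=\sum_{i=1}^r i\,n_i$ is the homogeneous dimension. (The Euclidean case is $r=1$, $\nabla_L=\nabla$, $Q=N$.) A homogeneous norm $S:\mathbb R^N\to[0,\infty)$ is fixed: $S$ is continuous, $S(\xi^{-1})=S(\xi)$, $S(\xi)=0$ iff $\xi=0$, and $S(\delta_R\xi)=RS(\xi)$. For $R>0$, $B_R=\{x:S(x)<R\}$. $W^{1,p}_{L,loc}(\mathbb R^N)=\{u\in L^p_{loc}:|\nabla_Lu|\in L^p_{loc}\}$. A Carathéodory function is measurable in $x$ and continuous in the remaining variables. Write $p_i'=p_i/(p_i-1)$. Weakly-$p_i$-coercive: there is a constant $k>0$ such that $\mathscr A_{p_i}(x,t,\xi)\cdot\xi\ge k|\mathscr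 A_{p_i}(x,t,\xi)|^{p_i'}$ for all $(x,t,\xi)\in\mathbb R^N\times\mathbb R\times\mathbb R^l$. Weak solution of the system: a pair $(u,v)\in W^{1,p_1}_{L,loc}(\mathbb R^N)\times W^{1,p_2}_{L,loc}(\mathbb R^N)$ with $u,v>0$ a.e., $f(v),\ g(u),\ |\mathscr A_{p_1}(\cdot,u,\nabla_Lu)|^{p_1'},\ |\mathscr A_{p_2}(\cdot,v,\nabla_Lv)|^{p_2'}\in L^1_{loc}(\mathbb R^N)$, and $$\int\mathscr A_{p_1}(x,u,\nabla_Lu)\cdot\nabla_L\phi_1\ge\int f(v)\phi_1,\qquad\int\mathscr A_{p_2}(x,v,\nabla_Lv)\cdot\nabla_L\phi_2\ge\int g(u)\phi_2$$ for all nonnegative compactly supported $\phi_1,\phi_2\in C^1(\mathbb R^N)$. Weak solutions of the single inequality $-\mathrm{div}_L(\mathscr A_{p_i}(x,w,\nabla_Lw))\ge0$ are defined in the same way. (WH) assumption: for $i=1,2$ there exist $\sigma_i>p_i-1$ and $c_H>0$ such that, whenever $w$ is a weak solution of $-\mathrm{div}_L(\mathscr A_{p_i}(x,w,\nabla_Lw))\ge0$, $w\ge0$ on $\mathbb R^N$, then for every $R>0$ $$\left(\frac1{|B_R|}\int_{B_R}w^{\sigma_i}\right)^{1/\sigma_i}\le c_H\operatorname{ess\,inf}_{B_{R/2}}w.$$ *)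

theory Defs
  imports "HOL-Analysis.Analysis"
begin

section \<open>Smooth functions and vector fields on Euclidean space\<close>

text \<open>Functions of class $C^k$ on the whole space: all iterated directional derivatives up to
  order $k$ exist and are continuous.\<close>

primrec Ck :: "nat \<Rightarrow> ('a::euclidean_space \<Rightarrow> 'b::real_normed_vector) \<Rightarrow> bool" where
  "Ck 0 f \<longleftrightarrow> continuous_on UNIV f"
| "Ck (Suc k) f \<longleftrightarrow> (\<forall>x. f differentiable (at x)) \<and>
     (\<forall>v. Ck k (\<lambda>x. frechet_derivative f (at x) v))"

definition smooth :: "('a::euclidean_space \<Rightarrow> 'b::real_normed_vector) \<Rightarrow> bool" where
  "smooth f \<longleftrightarrow> (\<forall>k. Ck k f)"

definition compactly_supported :: "('a::topological_space \<Rightarrow> real) \<Rightarrow> bool" where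
  "compactly_supported \<phi> \<longleftrightarrow> compact (closure {x. \<phi> x \<noteq> 0})"

text \<open>A vector field $\sum_k Z_k\,\partial_k$ is represented by its coefficient map
  $Z = (Z_k)_k$.\<close>

type_synonym 'n vfield = "real ^ 'n \<Rightarrow> real ^ 'n"

definition lie_bracket :: "'n::finite vfield \<Rightarrow> 'n vfield \<Rightarrow> 'n vfield" where
  "lie_bracket Y Z = (\<lambda>x. frechet_derivative Z (at x) (Y x) - frechet_derivative Y (at x) (Z x))"

inductive_set lie_algebra_generated :: "'n::finite vfield set \<Rightarrow> 'n vfield set"
  for F :: "'n vfield set" where
  base: "Z \<in> F \<Longrightarrow> Z \<in> lie_algebra_generated F"
| zero: "(\<lambda>x. 0) \<in> lie_algebra_generated F"
| add: "Y \<in> lie_algebra_generated F \<Longrightarrow> Z \<in> lie_algebra_generated F \<Longrightarrow>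
    (\<lambda>x. Y x + Z x) \<in> lie_algebra_generated F"
| scale: "Z \<in> lie_algebra_generated F \<Longrightarrow> (\<lambda>x. c *\<^sub>R Z x) \<in> lie_algebra_generated F"
| bracket: "Y \<in> lie_algebra_generated F \<Longrightarrow> Z \<in> lie_algebra_generated F \<Longrightarrow>
    lie_bracket Y Z \<in> lie_algebra_generated F"

definition left_invariant :: "(real ^ 'n \<Rightarrow> real ^ 'n \<Rightarrow> real ^ 'n) \<Rightarrow> 'n::finite vfield \<Rightarrow> bool" where
  "left_invariant gmult Z \<longleftrightarrow> smooth Z \<and>
     (\<forall>y x. Z (gmult y x) = frechet_derivative (gmult y) (at x) (Z x))"

text \<open>The formal adjoint of $Z = \sum_k Z_k\,\partial_k$ with respect to Lebesgue measure:
  $Z^*\phi = -\sum_k \partial_k (Z_k\,\phi)$.\<close>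

definition formal_adjoint :: "'n::finite vfield \<Rightarrow> (real ^ 'n \<Rightarrow> real) \<Rightarrow> real ^ 'n \<Rightarrow> real" where
  "formal_adjoint Z \<phi> x =
     - (\<Sum>k\<in>UNIV. frechet_derivative (\<lambda>y. Z y $ k * \<phi> y) (at x) (axis k 1))"


section \<open>Homogeneous Carnot groups\<close>

text \<open>The decomposition $\mathbb R^N = \mathbb R^{n_1}\times\dots\times\mathbb R^{n_r}$ is encoded
  by \<open>wt\<close>, which sends a coordinate to the number of its layer; so $n_j$ is the number of
  coordinates of weight $j$.\<close>

definition dilation :: "('n \<Rightarrow> nat) \<Rightarrow> real \<Rightarrow> real ^ 'n \<Rightarrow> real ^ 'n" where
  "dilation wt R x = (\<chi> k. R ^ wt k * x $ k)"

definition homogeneous_dim :: "('n::finite \<Rightarrow> nat) \<Rightarrow> nat \<Rightarrow> nat" where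
  "homogeneous_dim wt r = (\<Sum>j = 1..r. j * card {k. wt k = j})"

text \<open>The type \<open>'l\<close> indexes $\mathbb R^l$, $l = n_1$, and \<open>\<iota>\<close> identifies it with the set of
  coordinates of the first layer. The neutral element is the origin (this is forced by the
  dilations being automorphisms).\<close>

locale homogeneous_carnot_group = group gmult 0 ginv
  for gmult :: "real ^ 'n::finite \<Rightarrow> real ^ 'n \<Rightarrow> real ^ 'n"
  and ginv :: "real ^ 'n \<Rightarrow> real ^ 'n" +
  fixes wt :: "'n \<Rightarrow> nat"
    and r :: nat
    and \<iota> :: "'l::finite \<Rightarrow> 'n"
    and X :: "'l \<Rightarrow> 'n vfield"
  assumes layers: "range wt = {1..r}"
    and first_layer: "bij_betw \<iota> UNIV {k. wt k = 1}"
    and smooth_mult: "smooth (\<lambda>(x, y). gmult x y)"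
    and smooth_inv: "smooth ginv"
    and dilation_automorphism:
      "\<And>R x y. R > 0 \<Longrightarrow> dilation wt R (gmult x y) = gmult (dilation wt R x) (dilation wt R y)"
    and X_left_invariant: "\<And>i. left_invariant gmult (X i)"
    and X_origin: "\<And>i. X i 0 = axis (\<iota> i) 1"
    and X_generate: "lie_algebra_generated (range X) = {Z. left_invariant gmult Z}"

definition homogeneous_norm ::
    "(real ^ 'n \<Rightarrow> real ^ 'n) \<Rightarrow> ('n::finite \<Rightarrow> nat) \<Rightarrow> (real ^ 'n \<Rightarrow> real) \<Rightarrow> bool" where
  "homogeneous_norm ginv wt S \<longleftrightarrow>
     continuous_on UNIV S \<and> (\<forall>x. S x \<ge> 0) \<and> (\<forall>x. S (ginv x) = S x) \<and>
     (\<forall>x. S x = 0 \<longleftrightarrow> x = 0) \<and> (\<forall>R>0. \<forall>x. S (dilation wt R x) = R * S x)"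

definition hball :: "(real ^ 'n \<Rightarrow> real) \<Rightarrow> real \<Rightarrow> (real ^ 'n) set" where
  "hball S R = {x. S x < R}"


section \<open>Local Lebesgue and horizontal Sobolev spaces\<close>

definition Lp_loc :: "real \<Rightarrow> (real ^ 'n::finite \<Rightarrow> 'b::euclidean_space) \<Rightarrow> bool" where
  "Lp_loc p h \<longleftrightarrow> h \<in> borel_measurable lebesgue \<and>
     (\<forall>K. compact K \<longrightarrow> set_integrable lebesgue K (\<lambda>x. norm (h x) powr p))"

text \<open>The (classical) horizontal gradient of a $C^1$ function.\<close>

definition grad_L :: "('l \<Rightarrow> 'n vfield) \<Rightarrow> (real ^ 'n::finite \<Rightarrow> real) \<Rightarrow> real ^ 'n \<Rightarrow> real ^ 'l::finite" where
  "grad_L X \<phi> x = (\<chi> i. frechet_derivative \<phi> (at x) (X i x))"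

text \<open>\<open>G\<close> is the horizontal gradient of \<open>u\<close> in the sense of distributions.\<close>

definition is_weak_grad_L ::
    "('l \<Rightarrow> 'n vfield) \<Rightarrow> (real ^ 'n::finite \<Rightarrow> real) \<Rightarrow> (real ^ 'n \<Rightarrow> real ^ 'l::finite) \<Rightarrow> bool" where
  "is_weak_grad_L X u G \<longleftrightarrow> Lp_loc 1 G \<and>
     (\<forall>i \<phi>. smooth \<phi> \<and> compactly_supported \<phi> \<longrightarrow>
        (LINT x|lebesgue. G x $ i * \<phi> x) = (LINT x|lebesgue. u x * formal_adjoint (X i) \<phi> x))"

text \<open>A representative of the weak gradient, which is determined only almost everywhere; all
  notions below are insensitive to changes on null sets.\<close>

definition weak_grad_L ::
    "('l \<Rightarrow> 'n vfield) \<Rightarrow> (real ^ 'n::finite \<Rightarrow> real) \<Rightarrow> real ^ 'n \<Rightarrow> real ^ 'l::finite" where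
  "weak_grad_L X u = (SOME G. is_weak_grad_L X u G)"

definition W1p_loc :: "('l::finite \<Rightarrow> 'n vfield) \<Rightarrow> real \<Rightarrow> (real ^ 'n::finite \<Rightarrow> real) \<Rightarrow> bool" where
  "W1p_loc X p u \<longleftrightarrow> Lp_loc p u \<and> (\<exists>G. is_weak_grad_L X u G) \<and> Lp_loc p (weak_grad_L X u)"

text \<open>The essential infimum over \<open>E\<close>, the counterpart of the essential supremum
  \<open>Limsup (ae_filter M)\<close>.\<close>

definition ess_inf :: "(real ^ 'n::finite) set \<Rightarrow> (real ^ 'n \<Rightarrow> real) \<Rightarrow> ereal" where
  "ess_inf E w = Liminf (ae_filter (restrict_space lebesgue E)) (\<lambda>x. ereal (w x))"


section \<open>Quasilinear operators and weak solutions\<close>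

type_synonym ('n, 'l) operator = "real ^ 'n \<Rightarrow> real \<Rightarrow> real ^ 'l \<Rightarrow> real ^ 'l"

definition caratheodory :: "('n::finite, 'l::finite) operator \<Rightarrow> bool" where
  "caratheodory A \<longleftrightarrow> (\<forall>t \<xi>. (\<lambda>x. A x t \<xi>) \<in> borel_measurable lebesgue) \<and>
     (\<forall>x. continuous_on UNIV (\<lambda>(t, \<xi>). A x t \<xi>))"

definition conj_exponent :: "real \<Rightarrow> real" where
  "conj_exponent p = p / (p - 1)"

definition weakly_coercive :: "real \<Rightarrow> ('n::finite, 'l::finite) operator \<Rightarrow> bool" where
  "weakly_coercive p A \<longleftrightarrow>
     (\<exists>k>0. \<forall>x t \<xi>. A x t \<xi> \<bullet> \<xi> \<ge> k * norm (A x t \<xi>) powr conj_exponent p)"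

text \<open>\<open>w\<close> is a weak solution of $-\mathrm{div}_L(A(x,w,\nabla_L w)) \ge h$; no sign
  of \<open>w\<close> is included.\<close>

definition weak_supersolution ::
    "('l \<Rightarrow> 'n vfield) \<Rightarrow> real \<Rightarrow> ('n::finite, 'l::finite) operator \<Rightarrow>
     (real ^ 'n \<Rightarrow> real) \<Rightarrow> (real ^ 'n \<Rightarrow> real) \<Rightarrow> bool" where
  "weak_supersolution X p A h w \<longleftrightarrow>
     W1p_loc X p w \<and> Lp_loc 1 h \<and>
     Lp_loc 1 (\<lambda>x. norm (A x (w x) (weak_grad_L X w x)) powr conj_exponent p) \<and>
     (\<forall>\<phi>. Ck 1 \<phi> \<and> compactly_supported \<phi> \<and> (\<forall>x. \<phi> x \<ge> 0) \<longrightarrow>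
        (LINT x|lebesgue. A x (w x) (weak_grad_L X w x) \<bullet> grad_L X \<phi> x)
          \<ge> (LINT x|lebesgue. h x * \<phi> x))"

definition system_weak_solution ::
    "('l \<Rightarrow> 'n vfield) \<Rightarrow> real \<Rightarrow> real \<Rightarrow> ('n::finite, 'l::finite) operator \<Rightarrow> ('n, 'l) operator \<Rightarrow>
     (real \<Rightarrow> real) \<Rightarrow> (real \<Rightarrow> real) \<Rightarrow> (real ^ 'n \<Rightarrow> real) \<Rightarrow> (real ^ 'n \<Rightarrow> real) \<Rightarrow> bool" where
  "system_weak_solution X p\<^sub>1 p\<^sub>2 A\<^sub>1 A\<^sub>2 f g u v \<longleftrightarrow>
     (AE x in lebesgue. u x > 0) \<and> (AE x in lebesgue. v x > 0) \<and>
     weak_supersolution X p\<^sub>1 A\<^sub>1 (\<lambda>x. f (v x)) u \<and>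
     weak_supersolution X p\<^sub>2 A\<^sub>2 (\<lambda>x. g (u x)) v"

text \<open>The weak Harnack inequality. As an inequality in $[0,\infty]$ it includes the finiteness of
  the left-hand side, whence the integrability conjunct: the Bochner integral of a
  non-integrable function would be $0$.\<close>

definition weak_harnack ::
    "('l \<Rightarrow> 'n vfield) \<Rightarrow> (real ^ 'n \<Rightarrow> real) \<Rightarrow> real \<Rightarrow> ('n::finite, 'l::finite) operator \<Rightarrow> bool" where
  "weak_harnack X S p A \<longleftrightarrow>
     (\<exists>\<sigma> > p - 1. \<exists>c\<^sub>H > 0. \<forall>w.
        weak_supersolution X p A (\<lambda>x. 0) w \<and> (AE x in lebesgue. w x \<ge> 0) \<longrightarrow>
        (\<forall>R>0. set_integrable lebesgue (hball S R) (\<lambda>x. w x powr \<sigma>) \<and>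
           ereal ((1 / measure lebesgue (hball S R) * (LINT x:hball S R|lebesgue. w x powr \<sigma>)) powr (1 / \<sigma>))
             \<le> ereal c\<^sub>H * ess_inf (hball S (R / 2)) w))"

end

theory Submission
  imports Defs
begin

text \<open>
  Write \<open>m\<^sub>u(R)\<close> for the essential infimum of \<open>u\<close> over a ball of radius comparable to \<open>R\<close>. Testing the first
  inequality with \<open>(u + m\<^sub>u)\<^sup>-\<^sup>\<alpha> \<eta>\<close> and with \<open>\<eta>\<close>, for a cutoff \<open>\<eta>\<close>, the weak coercivity and the weak Harnack
  inequality give \<open>\<integral>\<^bsub>B\<^esub> f(v) \<le> C R\<^bsup>Q - p\<^esup> m\<^sub>u(R)\<^bsup>p - 1\<^esup>\<close> with \<open>p = p\<^sub>1\<close>, and likewise for the second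
  inequality. Since \<open>m\<^sub>u\<close> and \<open>m\<^sub>v\<close> tend to zero, the Harnack inequality also shows that \<open>v\<close> is small on most of a
  large ball, so that \<open>f(v) \<ge> c m\<^sub>v\<^sup>a\<close> there. Hence \<open>R\<^sup>p m\<^sub>v\<^sup>a \<le> C m\<^sub>u\<^bsup>p - 1\<^esup>\<close>, and combining both inequalities
  bounds the mass \<open>I(R) = \<integral>\<^bsub>B\<^esub> g(u)\<close> from below: \<open>I(R) - I(R\<^sub>0) \<ge> c I(R)\<^sup>\<theta>\<close> for all large \<open>R\<close>, where
  \<open>\<theta> = ab/((p\<^sub>1 - 1)(p\<^sub>2 - 1))\<close>; the hypothesis on the exponents says that the power of \<open>R\<close> that should appear here is
  nonnegative. For \<open>\<theta> > 1\<close> the inequality makes \<open>I\<close> both unbounded and bounded, and for \<open>\<theta> \<le> 1\<close> the two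
  estimates contradict each other directly.

  That \<open>F(u) \<eta>\<close> is an admissible test function is shown by mollifying \<open>u\<close> with the group
  convolution, which commutes with the left-invariant fields and preserves Lebesgue measure.
\<close>

section \<open>Calculus of \<open>C\<^sup>k\<close> functions\<close>

text \<open>Weak coercivity gives A . xi no lower bound in terms of |xi|, since A may vanish. The
  gradient of u is therefore never estimated quantitatively: the only energy is a weighted integral
  of |A|^{p'}, and the cutoff must satisfy |grad eta| <= (c/R) eta^{1/p'} so that Young's inequality
  returns eta itself. The exponents come from eliminating the profiles. From m_u^b >= c R^{p1
  b/(p1-1)} m_v^{ab/(p1-1)} and I(R) <= C R^{Q-p2} m_v^{p2-1}, the factor left beside I(R)^theta is
  R^e with e = Q + p1 b/(p1-1) - (Q-p2) theta. The inequality e >= 0 is one of the two alternatives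
  contained in the minimum; the other arises by interchanging the equations. In the borderline case
  e = 0 a lower bound for I(R) alone yields no contradiction, which is why increments over arbitrary
  R0 are bounded below. The facts on the group come from homogeneity: all weights are at least one,
  so dilations contract to the origin and a continuous dilation-invariant quantity equals its value
  there.\<close>

lemma Ck_SucI:
  assumes "\<And>x. (f has_derivative f' x) (at x)" "\<And>v. Ck k (\<lambda>x. f' x v)"
  shows "Ck (Suc k) f"
proof -
  have "frechet_derivative f (at x) = f' x" for x
    using frechet_derivative_at[OF assms(1)] by simp
  then show ?thesis
    using assms by (auto simp: differentiable_def)
qed

lemma Ck_Suc_has_derivative:
  "Ck (Suc k) f \<Longrightarrow> (f has_derivative frechet_derivative f (at x)) (at x)"
  by (simp add: frechet_derivative_works[symmetric])

lemma Ck_SucD: "Ck (Suc k) f \<Longrightarrow> Ck k f"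
proof (induction k arbitrary: f)
  case 0
  then have "f differentiable_on UNIV"
    by (simp add: differentiable_on_def)
  then show ?case
    by (simp add: differentiable_imp_continuous_on)
next
  case (Suc k)
  then have d: "\<forall>x. f differentiable (at x)"
    and c: "\<And>v. Ck (Suc k) (\<lambda>x. frechet_derivative f (at x) v)"
    unfolding Ck.simps(2)[of "Suc k"] by blast+
  show ?case
    unfolding Ck.simps(2) using d Suc.IH[OF c] by blast
qed

lemma Ck_continuous: "Ck k f \<Longrightarrow> continuous_on UNIV f"
  by (induction k) (auto dest: Ck_SucD simp del: Ck.simps(2))

lemma Ck_const: "Ck k (\<lambda>x. c)"
  by (induction k arbitrary: c) (auto intro: continuous_intros)

lemma Ck_bounded_linear:
  assumes "bounded_linear f"
  shows "Ck k f"
proof (cases k)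
  case 0
  then show ?thesis using linear_continuous_on[OF assms] by simp
next
  case (Suc j)
  then show ?thesis
    using Ck_SucI[OF bounded_linear_imp_has_derivative[OF assms] Ck_const] by simp
qed

lemma Ck_add:
  "Ck k f \<Longrightarrow> Ck k g \<Longrightarrow> Ck k (\<lambda>x. f x + g x)"
proof (induction k arbitrary: f g)
  case 0
  then show ?case by (auto intro: continuous_intros)
next
  case (Suc k)
  show ?case
    using Suc.prems Suc.IH
    by (intro Ck_SucI[OF has_derivative_add[OF Suc.prems(1)[THEN Ck_Suc_has_derivative]
          Suc.prems(2)[THEN Ck_Suc_has_derivative]]]) auto
qed

text \<open>The product rule writes each directional derivative through the same bilinear map, so
  one induction serves \<open>Ck_mult\<close>, \<open>Ck_inner\<close> and the scalar multiplication
  in the chain rule.\<close>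

lemma Ck_bilinear:
  assumes bl: "bounded_bilinear pr"
  shows "Ck k f \<Longrightarrow> Ck k g \<Longrightarrow> Ck k (\<lambda>x. pr (f x) (g x))"
proof (induction k arbitrary: f g)
  case 0
  then show ?case
    using bounded_bilinear.continuous_on[OF bl] by auto
next
  case (Suc k)
  have "Ck k f" "Ck k g" using Suc.prems Ck_SucD by blast+
  then show ?case
    using Suc.prems Suc.IH
    by (intro Ck_SucI[OF bounded_bilinear.FDERIV[OF bl Suc.prems(1)[THEN Ck_Suc_has_derivative]
          Suc.prems(2)[THEN Ck_Suc_has_derivative]]] Ck_add) auto
qed

lemma Ck_bounded_linear_compose:
  assumes bl: "bounded_linear l"
  shows "Ck k f \<Longrightarrow> Ck k (\<lambda>x. l (f x))"
proof (induction k arbitrary: f)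
  case 0
  then show ?case using bounded_linear.continuous_on[OF bl] by auto
next
  case (Suc k)
  show ?case
    using Suc by (intro Ck_SucI[OF bounded_linear.has_derivative[OF bl Ck_Suc_has_derivative[OF Suc.prems]]]) auto
qed

lemma Ck_sum: "(\<And>i. i \<in> I \<Longrightarrow> Ck k (f i)) \<Longrightarrow> Ck k (\<lambda>x. \<Sum>i\<in>I. f i x)"
  by (induction I rule: infinite_finite_induct) (auto intro: Ck_const Ck_add)

lemmas Ck_mult = Ck_bilinear[OF bounded_bilinear_mult]
lemmas Ck_inner = Ck_bilinear[OF bounded_bilinear_inner]

lemma Ck_power:
  fixes f :: "'a::euclidean_space \<Rightarrow> real"
  shows "Ck k f \<Longrightarrow> Ck k (\<lambda>x. f x ^ n)"
  by (induction n) (auto intro: Ck_const Ck_mult)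

lemma Ck_Pair: "Ck k f \<Longrightarrow> Ck k g \<Longrightarrow> Ck k (\<lambda>x. (f x, g x))"
proof -
  assume "Ck k f" "Ck k g"
  then have "Ck k (\<lambda>x. (f x, 0) + (0, g x))"
    by (intro Ck_add Ck_bounded_linear_compose[of "\<lambda>y. (y, 0)"]
        Ck_bounded_linear_compose[of "\<lambda>y. (0, y)"]
        bounded_linear_Pair bounded_linear_ident bounded_linear_zero)
  then show ?thesis by simp
qed

text \<open>\<open>Ck\<close> only speaks of derivatives in constant directions, whereas the chain
  rule produces \<open>?Df (g x)\<close> in the moving direction \<open>?Dg x v\<close>. Expanding
  that direction in the basis leaves finitely many products, to whose factors the induction
  hypothesis applies.\<close>

lemma Ck_compose:
  fixes f :: "'b::euclidean_space \<Rightarrow> 'c::real_normed_vector"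
    and g :: "'a::euclidean_space \<Rightarrow> 'b"
  shows "Ck k f \<Longrightarrow> Ck k g \<Longrightarrow> Ck k (\<lambda>x. f (g x))"
proof (induction k arbitrary: f g)
  case 0
  then show ?case by (auto intro: continuous_on_compose2)
next
  case (Suc k)
  let ?Df = "\<lambda>x. frechet_derivative f (at x)"
  let ?Dg = "\<lambda>x. frechet_derivative g (at x)"
  have lin: "linear (?Df y)" for y
    using Ck_Suc_has_derivative[OF Suc.prems(1), of y] by (rule has_derivative_linear)
  have der: "((\<lambda>x. f (g x)) has_derivative (\<lambda>v. ?Df (g x) (?Dg x v))) (at x)" for x
    using has_derivative_compose[OF Ck_Suc_has_derivative[OF Suc.prems(2)]
        Ck_Suc_has_derivative[OF Suc.prems(1)]] by simp
  have eq: "?Df y w = (\<Sum>b\<in>Basis. (w \<bullet> b) *\<^sub>R ?Df y b)" for y w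
  proof -
    have "?Df y (\<Sum>b\<in>Basis. (w \<bullet> b) *\<^sub>R b) = (\<Sum>b\<in>Basis. (w \<bullet> b) *\<^sub>R ?Df y b)"
      by (simp only: linear_sum[OF lin] linear_cmul[OF lin])
    then show ?thesis by (simp only: euclidean_representation)
  qed
  have *: "Ck k (\<lambda>x. \<Sum>b\<in>Basis. (?Dg x v \<bullet> b) *\<^sub>R ?Df (g x) b)" for v
  proof (rule Ck_sum, rule Ck_bilinear[OF bounded_bilinear_scaleR])
    fix b :: 'b
    show "Ck k (\<lambda>x. ?Dg x v \<bullet> b)"
      using Suc.prems by (intro Ck_bounded_linear_compose[OF bounded_linear_inner_left]) auto
    show "Ck k (\<lambda>x. ?Df (g x) b)"
      using Suc.prems Ck_SucD[OF Suc.prems(2)]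
      by (intro Suc.IH[where f = "\<lambda>y. ?Df y b" and g = g]) auto
  qed
  have "Ck k (\<lambda>x. ?Df (g x) (?Dg x v))" for v
    by (rule iffD2[OF arg_cong[where f = "Ck k", OF ext[OF eq]] *])
  then show ?case
    by (rule Ck_SucI[where f' = "\<lambda>x v. ?Df (g x) (?Dg x v)", OF der])
qed

lemma smooth_compose: "smooth f \<Longrightarrow> smooth g \<Longrightarrow> smooth (\<lambda>x. f (g x))"
  for f :: "'b::euclidean_space \<Rightarrow> 'c::real_normed_vector" and g :: "'a::euclidean_space \<Rightarrow> 'b"
  unfolding smooth_def by (intro allI) (rule Ck_compose[of _ f g]; blast)

lemma smooth_Pair: "smooth f \<Longrightarrow> smooth g \<Longrightarrow> smooth (\<lambda>x. (f x, g x))"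
  by (auto simp: smooth_def intro: Ck_Pair)

lemma smooth_const: "smooth (\<lambda>x. c)"
  by (auto simp: smooth_def intro: Ck_const)

lemma smooth_bounded_linear: "bounded_linear f \<Longrightarrow> smooth f"
  by (auto simp: smooth_def intro: Ck_bounded_linear)

lemma smooth_power: "smooth f \<Longrightarrow> smooth (\<lambda>x. f x ^ n)" for f :: "'a::euclidean_space \<Rightarrow> real"
  by (auto simp: smooth_def intro: Ck_power)

lemma smooth_continuous: "smooth f \<Longrightarrow> continuous_on UNIV f"
  by (auto simp: smooth_def intro: Ck_continuous)

lemma smooth_has_derivative: "smooth f \<Longrightarrow> (f has_derivative frechet_derivative f (at x)) (at x)"
  by (rule Ck_Suc_has_derivative[of 0]) (simp add: smooth_def del: Ck.simps)

lemma smooth_frechet_derivative: "smooth f \<Longrightarrow> smooth (\<lambda>x. frechet_derivative f (at x) v)"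
  unfolding smooth_def using Ck.simps(2) by blast

subsection \<open>Bump functions\<close>

text \<open>The index makes the family closed under differentiation up to linear combinations, so
  smoothness is one induction for all \<open>k\<close> at once.\<close>

definition flat_exp :: "nat \<Rightarrow> real \<Rightarrow> real" where
  "flat_exp k t = (if t > 0 then exp (- 1 / t) / t ^ k else 0)"

lemma flat_exp_has_derivative:
  "(flat_exp k has_real_derivative (- real k * flat_exp (Suc k) t + flat_exp (k + 2) t)) (at t)"
proof -
  consider "t > 0" | "t < 0" | "t = 0" by linarith
  then show ?thesis
  proof cases
    case 1
    have pow: "t ^ n = t * t ^ (n - Suc 0)" if "n \<noteq> 0" for n
      using that by (cases n) auto
    have "((\<lambda>t. exp (- 1 / t) / t ^ k) has_real_derivative
        (- real k * flat_exp (Suc k) t + flat_exp (k + 2) t)) (at t)"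
      using 1 unfolding flat_exp_def
      by (cases k) (auto intro!: derivative_eq_intros pow simp: field_simps power2_eq_square)
    then show ?thesis
      by (rule DERIV_cong_ev[THEN iffD1, rotated 3])
        (use 1 in \<open>auto simp: flat_exp_def intro: eventually_mono[OF eventually_nhds_in_open[of "{0<..}"]]\<close>)
  next
    case 2
    have "((\<lambda>t. 0) has_real_derivative (- real k * flat_exp (Suc k) t + flat_exp (k + 2) t)) (at t)"
      using 2 unfolding flat_exp_def by simp
    then show ?thesis
      by (rule DERIV_cong_ev[THEN iffD1, rotated 3])
        (use 2 in \<open>auto simp: flat_exp_def intro: eventually_mono[OF eventually_nhds_in_open[of "{..<0}"]]\<close>)
  next
    case 3
    have "((\<lambda>h. flat_exp k h / h) \<longlongrightarrow> 0) (at_right 0)"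
    proof (rule Lim_transform_eventually)
      \<comment> \<open>With s = 1/h the right difference quotient at 0 is s^(k+1) / exp s.\<close>
      show "((\<lambda>h. inverse h ^ Suc k / exp (inverse h)) \<longlongrightarrow> 0) (at_right (0::real))"
        by (rule filterlim_compose[OF tendsto_power_div_exp_0 filterlim_inverse_at_top_right])
    qed (auto simp: flat_exp_def divide_simps exp_minus intro!: eventually_at_rightI[of 0 1])
    moreover have "((\<lambda>h. flat_exp k h / h) \<longlongrightarrow> 0) (at_left 0)"
      by (rule tendsto_eventually) (auto simp: flat_exp_def eventually_at_left_field intro: exI[of _ "-1"])
    ultimately have "((\<lambda>h. flat_exp k h / h) \<longlongrightarrow> 0) (at 0)"
      by (simp add: filterlim_at_split)
    then show ?thesis
      using 3 by (simp add: has_field_derivative_iff flat_exp_def)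
  qed
qed

lemma smooth_flat_exp: "smooth (flat_exp k)"
proof -
  have "Ck n (flat_exp k)" for n
  proof (induction n arbitrary: k)
    case 0
    show ?case
      using flat_exp_has_derivative by (auto intro!: continuous_at_imp_continuous_on DERIV_isCont)
  next
    case (Suc n)
    show ?case
      by (intro Ck_SucI[OF flat_exp_has_derivative[unfolded has_field_derivative_def]] Ck_mult
          Ck_add Ck_const Suc)
  qed
  then show ?thesis by (simp add: smooth_def)
qed

text \<open>The squared norm is written as the polynomial \<open>x \<bullet> x\<close>, so that
  smoothness at the origin is immediate from composition.\<close>

definition bump :: "real \<Rightarrow> 'a::euclidean_space \<Rightarrow> real" where
  "bump r x = flat_exp 0 (r\<^sup>2 - x \<bullet> x)"

lemma smooth_bump: "smooth (bump r :: 'a::euclidean_space \<Rightarrow> real)"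
proof -
  have "smooth (\<lambda>x::'a. r\<^sup>2 + - 1 * (x \<bullet> x))"
    unfolding smooth_def
    by (intro allI Ck_add Ck_const Ck_mult Ck_inner Ck_bounded_linear bounded_linear_ident)
  then show ?thesis
    using smooth_compose[OF smooth_flat_exp[of 0]] by (simp add: bump_def[abs_def])
qed

lemma bump_nonneg: "bump r x \<ge> 0"
  by (simp add: bump_def flat_exp_def)

lemma bump_pos_iff: "r > 0 \<Longrightarrow> bump r x > 0 \<longleftrightarrow> norm x < r"
  by (simp add: bump_def flat_exp_def power2_norm_eq_inner[symmetric] abs_square_less_1)
     (smt (verit) norm_ge_zero power2_less_imp_less power_mono power_strict_mono pos2)

lemma bump_eq_0: "r > 0 \<Longrightarrow> norm x \<ge> r \<Longrightarrow> bump r x = 0"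
  using bump_pos_iff[of r x] bump_nonneg[of r x] by force

section \<open>Volume-preserving diffeomorphisms\<close>

text \<open>The library's change-of-variables theorem requires a well-ordered index type, which the
  coordinates of the group do not carry; \<open>'n wo\<close> is a well-ordered copy of a finite type.\<close>

typedef 'a wo = "UNIV :: 'a set" morphisms of_wo to_wo ..

lemma bij_of_wo: "bij of_wo"
  by (metis (no_types) bijI' UNIV_I of_wo_inject to_wo_inverse)

instance wo :: (finite) finite
proof
  have "inj (of_wo :: 'a wo \<Rightarrow> 'a)"
    using bij_of_wo by (rule bij_is_inj)
  then show "finite (UNIV :: 'a wo set)"
    by (rule finite_imageD[rotated]) simp
qed

text \<open>Any injection into the natural numbers will do; the order of the copy is pulled back
  along it.\<close>

definition wo_rank :: "'a::finite wo \<Rightarrow> nat" where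
  "wo_rank = (SOME f. inj f)"

lemma inj_wo_rank: "inj (wo_rank :: 'a::finite wo \<Rightarrow> nat)"
proof -
  from finite_imp_inj_to_nat_seg[OF finite[of "UNIV :: 'a wo set"]]
  obtain f :: "'a wo \<Rightarrow> nat" and n where "inj f"
    by (elim exE conjE)
  then show ?thesis
    unfolding wo_rank_def by (rule someI[of inj])
qed

instantiation wo :: (finite) wellorder
begin

definition less_eq_wo :: "'a wo \<Rightarrow> 'a wo \<Rightarrow> bool" where
  "less_eq_wo x y \<longleftrightarrow> wo_rank x \<le> wo_rank y"

definition less_wo :: "'a wo \<Rightarrow> 'a wo \<Rightarrow> bool" where
  "less_wo x y \<longleftrightarrow> wo_rank x < wo_rank y"

instance
proof
  fix x y z :: "'a wo"
  show "x < y \<longleftrightarrow> x \<le> y \<and> \<not> y \<le> x" "x \<le> x" "x \<le> y \<or> y \<le> x"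
    unfolding less_eq_wo_def less_wo_def by linarith+
  show "x \<le> z" if "x \<le> y" "y \<le> z"
    using that unfolding less_eq_wo_def by linarith
  show "x = y" if "x \<le> y" "y \<le> x"
    using that unfolding less_eq_wo_def by (intro injD[OF inj_wo_rank]) linarith
next
  fix P :: "'a wo \<Rightarrow> bool" and a
  assume *: "\<And>x. (\<And>y. y < x \<Longrightarrow> P y) \<Longrightarrow> P x"
  show "P a"
  proof (induction a rule: measure_induct_rule[of wo_rank])
    case (less x)
    show ?case
      by (rule *) (rule less.IH, simp add: less_wo_def)
  qed
qed

end

text \<open>Conjugation by \<open>\<sigma>\<close> is a bijection between the permutations of the
  two index types that preserves the sign, so the two Leibniz sums agree term by term.\<close>

lemma det_reindex:
  fixes A :: "real ^ 'n ^ 'n" and \<sigma> :: "'m::finite \<Rightarrow> 'n::finite"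
  assumes \<sigma>: "bij \<sigma>"
  shows "det (\<chi> i j. A $ \<sigma> i $ \<sigma> j) = det A"
proof -
  let ?M = "map_permutation UNIV \<sigma>"
  have inj: "inj \<sigma>" and M: "?M p (\<sigma> i) = \<sigma> (p i)" for p i
    using \<sigma> by (auto simp: bij_def map_permutation_apply)
  have bij: "bij_betw ?M {p. p permutes UNIV} {p. p permutes UNIV}"
  proof -
    have "?M = (\<lambda>\<pi> x. if x \<in> UNIV then \<sigma> (\<pi> (inv_into UNIV \<sigma> x)) else x)"
      using \<sigma> by (auto simp: fun_eq_iff map_permutation_def restrict_id_def bij_is_surj)
    then show ?thesis
      using bij_betw_permutations[OF \<sigma>] by simp
  qed
  have "det A = (\<Sum>p | p permutes UNIV. of_int (sign (?M p)) * (\<Prod>i\<in>UNIV. A $ i $ ?M p i))"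
    unfolding det_def by (rule sum.reindex_bij_betw[OF bij, symmetric])
  also have "\<dots> = (\<Sum>p | p permutes UNIV. of_int (sign p) * (\<Prod>i\<in>UNIV. A $ \<sigma> i $ \<sigma> (p i)))"
  proof (rule sum.cong)
    fix p :: "'m \<Rightarrow> 'm"
    assume "p \<in> {p. p permutes UNIV}"
    then have "sign (?M p) = sign p"
      using inj by (simp add: sign_map_permutation)
    moreover have "(\<Prod>i\<in>UNIV. A $ i $ ?M p i) = (\<Prod>i\<in>UNIV. A $ \<sigma> i $ \<sigma> (p i))"
      using prod.reindex_bij_betw[OF \<sigma>, of "\<lambda>i. A $ i $ ?M p i"] by (simp add: M)
    ultimately show "of_int (sign (?M p)) * (\<Prod>i\<in>UNIV. A $ i $ ?M p i) =
        of_int (sign p) * (\<Prod>i\<in>UNIV. A $ \<sigma> i $ \<sigma> (p i))"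
      by simp
  qed simp
  finally show ?thesis
    by (simp add: det_def)
qed

lemma prod_Basis_cart: "(\<Prod>b\<in>Basis. x \<bullet> b) = (\<Prod>i\<in>UNIV. x $ i)" for x :: "real ^ 'n"
proof -
  have "Basis = range (\<lambda>i::'n. axis i (1::real))"
    by (auto simp: Basis_vec_def)
  moreover have "inj (\<lambda>i::'n. axis i (1::real))"
    by (auto simp: inj_def axis_eq_axis)
  ultimately have "(\<Prod>b\<in>Basis. x \<bullet> b) = (\<Prod>i\<in>UNIV. x \<bullet> axis i 1)"
    using prod.reindex[of "\<lambda>i::'n. axis i (1::real)" UNIV "\<lambda>b. x \<bullet> b"] by (simp add: comp_def)
  then show ?thesis
    by (simp add: inner_axis)
qed

text \<open>Lebesgue measure is determined by its values on boxes, and the preimage of a box under a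
  relabelling of coordinates is the box with the same side lengths in another order.\<close>

lemma distr_lborel_reindex:
  fixes \<sigma> :: "'m::finite \<Rightarrow> 'n::finite"
  assumes \<sigma>: "bij \<sigma>"
  shows "distr lborel borel (\<lambda>x :: real ^ 'n. (\<chi> i. x $ \<sigma> i) :: real ^ 'm) = lborel"
proof (rule lborel_eqI[symmetric])
  let ?\<phi> = "\<lambda>x :: real ^ 'n. (\<chi> i. x $ \<sigma> i) :: real ^ 'm"
  have cont: "continuous_on UNIV ?\<phi>"
    by (intro continuous_intros)
  fix l u :: "real ^ 'm"
  assume le: "\<And>b. b \<in> Basis \<Longrightarrow> l \<bullet> b \<le> u \<bullet> b"
  let ?l = "\<chi> k. l $ inv \<sigma> k" and ?u = "\<chi> k. u $ inv \<sigma> k"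
  have surj: "\<sigma> (inv \<sigma> k) = k" and inj: "inv \<sigma> (\<sigma> i) = i" for k i
    using \<sigma> by (auto simp: bij_def surj_f_inv_f)
  have le': "l $ i \<le> u $ i" for i
    using le[of "axis i 1"] by (simp add: inner_axis)
  have "(\<forall>i. l $ i < x $ \<sigma> i \<and> x $ \<sigma> i < u $ i) \<longleftrightarrow>
      (\<forall>k. l $ inv \<sigma> k < x $ k \<and> x $ k < u $ inv \<sigma> k)" for x
    by (metis surj inj)
  then have box: "?\<phi> -` box l u = box ?l ?u"
    by (auto simp: mem_box_cart)
  have "emeasure (distr lborel borel ?\<phi>) (box l u) = emeasure lborel (box ?l ?u)"
    using box cont by (subst emeasure_distr) (auto simp: borel_measurable_continuous_onI)
  also have "\<dots> = (\<Prod>b\<in>Basis. (?u - ?l) \<bullet> b)"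
    using le' by (intro emeasure_lborel_box) (auto simp: Basis_vec_def inner_axis)
  also have "(\<Prod>b\<in>Basis. (?u - ?l) \<bullet> b) = (\<Prod>k\<in>UNIV. u $ inv \<sigma> k - l $ inv \<sigma> k)"
    by (simp add: prod_Basis_cart)
  also have "\<dots> = (\<Prod>i\<in>UNIV. u $ i - l $ i)"
    using prod.reindex_bij_betw[OF \<sigma>, of "\<lambda>k. u $ inv \<sigma> k - l $ inv \<sigma> k"] by (simp add: inj)
  also have "\<dots> = (\<Prod>b\<in>Basis. (u - l) \<bullet> b)"
    by (simp add: prod_Basis_cart)
  finally show "emeasure (distr lborel borel ?\<phi>) (box l u) = (\<Prod>b\<in>Basis. (u - l) \<bullet> b)" .
qed simp

text \<open>\<open>T\<close> maps the preimage of a box bijectively onto the box, and the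
  change-of-variables formula with Jacobian of modulus one equates their volumes. \<open>T'\<close>
  witnesses the bijectivity.\<close>

lemma distr_lborel_unimodular_wo:
  fixes T T' :: "real ^ 'n::{finite,wellorder} \<Rightarrow> real ^ 'n::_"
  assumes der: "\<And>x. (T has_derivative D x) (at x)"
    and det: "\<And>x. \<bar>det (matrix (D x))\<bar> = 1"
    and inv: "\<And>x. T' (T x) = x" "\<And>x. T (T' x) = x"
  shows "distr lborel borel T = lborel"
proof (rule lborel_eqI[symmetric])
  fix l u :: "real ^ 'n::_"
  assume le: "\<And>b. b \<in> Basis \<Longrightarrow> l \<bullet> b \<le> u \<bullet> b"
  have cont: "continuous_on UNIV T"
    by (meson der has_derivative_continuous continuous_at_imp_continuous_on)
  let ?S = "T -` box l u"
  have S: "?S \<in> sets borel"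
    using measurable_sets[OF borel_measurable_continuous_onI[OF cont], of "box l u"] by simp
  have img: "T ` ?S = box l u"
    using inv(2) by (auto simp: image_iff) (metis)
  have "box l u \<in> lmeasurable \<and> measure lebesgue (box l u) = measure lborel (box l u)"
    by (auto simp: measure_completion)
  then have "((\<lambda>x. 1) has_integral measure lborel (box l u)) ?S"
    using has_measure_differentiable_image[of ?S T D "measure lborel (box l u)"] S der inv(1) img det
    by (metis (no_types, lifting) has_derivative_at_withinI inj_on_def sets_completionI_sets
        sets_lborel has_integral_cong)
  then have "emeasure lborel ?S = ennreal (measure lborel (box l u))"
    using S has_integral_iff_emeasure_lborel[of ?S "measure lborel (box l u)"] by simp
  moreover have "emeasure (distr lborel borel T) (box l u) = emeasure lborel ?S"
    using cont by (subst emeasure_distr) (auto simp: borel_measurable_continuous_onI)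
  ultimately show "emeasure (distr lborel borel T) (box l u) = (\<Prod>b\<in>Basis. (u - l) \<bullet> b)"
    using le by (simp add: measure_lborel_box_eq)
qed simp

text \<open>\<open>T\<close> is conjugated with the relabellings \<open>\<phi>\<close> and
  \<open>\<psi>\<close>; these preserve Lebesgue measure, and by \<open>det_reindex\<close> the
  conjugation does not change the Jacobian.\<close>

lemma distr_lborel_unimodular:
  fixes T T' :: "real ^ 'n::finite \<Rightarrow> real ^ 'n"
  assumes der: "\<And>x. (T has_derivative D x) (at x)"
    and det: "\<And>x. \<bar>det (matrix (D x))\<bar> = 1"
    and inv: "\<And>x. T' (T x) = x" "\<And>x. T (T' x) = x"
  shows "distr lborel borel T = lborel"
proof -
  define \<phi> :: "real ^ 'n \<Rightarrow> real ^ 'n wo" where "\<phi> x = (\<chi> i. x $ of_wo i)" for x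
  define \<psi> :: "real ^ 'n wo \<Rightarrow> real ^ 'n" where "\<psi> y = (\<chi> k. y $ to_wo k)" for y
  have bij: "bij (to_wo :: 'n \<Rightarrow> 'n wo)"
    by (metis (no_types) bijI' UNIV_I of_wo_inverse to_wo_inverse)
  have \<phi>\<psi>: "\<phi> (\<psi> y) = y" and \<psi>\<phi>: "\<psi> (\<phi> x) = x" for x y
    by (simp_all add: \<phi>_def \<psi>_def vec_eq_iff of_wo_inverse to_wo_inverse)
  have lin: "bounded_linear \<phi>" "bounded_linear \<psi>"
    unfolding \<phi>_def \<psi>_def linear_conv_bounded_linear[symmetric]
    by (auto intro!: linearI simp: vec_eq_iff)
  have meas: "\<phi> \<in> borel_measurable borel" "\<psi> \<in> borel_measurable borel"
    using lin by (auto intro!: borel_measurable_continuous_onI linear_continuous_on)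
  have T: "T \<in> borel_measurable borel"
    by (intro borel_measurable_continuous_onI)
      (meson der has_derivative_continuous continuous_at_imp_continuous_on)
  have d\<phi>: "distr lborel borel \<phi> = lborel" and d\<psi>: "distr lborel borel \<psi> = lborel"
    unfolding \<phi>_def \<psi>_def by (rule distr_lborel_reindex[OF bij_of_wo] distr_lborel_reindex[OF bij])+
  have "distr lborel borel (\<lambda>y. \<phi> (T (\<psi> y))) = lborel"
  proof (rule distr_lborel_unimodular_wo)
    show "((\<lambda>y. \<phi> (T (\<psi> y))) has_derivative (\<lambda>v. \<phi> (D (\<psi> y) (\<psi> v)))) (at y)" for y
      by (intro bounded_linear.has_derivative[OF lin(1)]
          has_derivative_compose[OF bounded_linear_imp_has_derivative[OF lin(2)] der])
    show "\<bar>det (matrix (\<lambda>v. \<phi> (D (\<psi> y) (\<psi> v))))\<bar> = 1" for y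
    proof -
      have ax: "\<psi> (axis j 1) = axis (of_wo j) 1" for j
        by (auto simp: \<psi>_def axis_def vec_eq_iff to_wo_inverse of_wo_inverse)
      have "matrix (\<lambda>v. \<phi> (D (\<psi> y) (\<psi> v))) =
          (\<chi> i j. matrix (D (\<psi> y)) $ of_wo i $ of_wo j)"
        unfolding matrix_def \<phi>_def ax by (simp add: vec_eq_iff)
      then show ?thesis
        using det by (simp add: det_reindex[OF bij_of_wo])
    qed
    show "\<phi> (T' (\<psi> (\<phi> (T (\<psi> y))))) = y" "\<phi> (T (\<psi> (\<phi> (T' (\<psi> y))))) = y" for y
      by (simp_all add: \<phi>\<psi> \<psi>\<phi> inv)
  qed
  then have "distr (distr lborel borel (\<lambda>y. \<phi> (T (\<psi> y)))) borel \<psi> = lborel"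
    using d\<psi> by simp
  then have "distr lborel borel (\<lambda>y. T (\<psi> y)) = lborel"
    using meas T by (simp add: distr_distr comp_def \<psi>\<phi>)
  then have "distr (distr lborel borel \<psi>) borel T = lborel"
    using meas T by (simp add: distr_distr comp_def)
  then show ?thesis
    by (simp add: d\<psi>)
qed

section \<open>Homogeneous Carnot groups\<close>

lemma bounded_linear_dilation: "bounded_linear (dilation wt R :: real ^ 'n::finite \<Rightarrow> real ^ 'n)"
  unfolding dilation_def linear_conv_bounded_linear[symmetric]
  by (auto intro!: linearI simp: vec_eq_iff algebra_simps)

lemma dilation_dilation: "dilation wt R (dilation wt R' x) = dilation wt (R * R') x"
  by (simp add: dilation_def vec_eq_iff power_mult_distrib mult_ac)

lemma dilation_1 [simp]: "dilation wt 1 x = x"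
  by (simp add: dilation_def vec_eq_iff)

lemma dilation_inverse: "R \<noteq> 0 \<Longrightarrow> dilation wt R (dilation wt (1 / R) x) = x"
  by (simp add: dilation_dilation)

text \<open>Used to evaluate homogeneous functions at the origin: for a function continuous there,
  invariance under dilations forces it to be constant and negative degree forces it to
  vanish.\<close>

lemma dilation_tendsto_0:
  assumes "\<And>k. wt k \<ge> 1"
  shows "(\<lambda>n. dilation wt (1 / real (Suc n)) x) \<longlonglongrightarrow> 0"
proof (rule vec_tendstoI)
  fix k
  have "(\<lambda>n. (1 / real (Suc n)) ^ wt k * x $ k) \<longlonglongrightarrow> 0 ^ wt k * x $ k"
    by (intro tendsto_mult tendsto_power tendsto_const LIMSEQ_Suc[OF lim_1_over_n])
  then show "(\<lambda>n. dilation wt (1 / real (Suc n)) x $ k) \<longlonglongrightarrow> 0 $ k"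
    using assms[of k] by (simp add: dilation_def power_0_left)
qed

lemma det_matrix_compose:
  fixes f g :: "real ^ 'n \<Rightarrow> real ^ 'n"
  assumes "linear f" "linear g"
  shows "det (matrix (\<lambda>x. f (g x))) = det (matrix f) * det (matrix g)"
  using matrix_compose[OF assms(2,1)] by (simp add: comp_def det_mul)

lemma smooth_curry:
  fixes m :: "'a::euclidean_space \<Rightarrow> 'b::euclidean_space \<Rightarrow> 'c::real_normed_vector"
  assumes "smooth (\<lambda>(x, y). m x y)" "smooth f" "smooth g"
  shows "smooth (\<lambda>x. m (f x) (g x))"
  using smooth_compose[OF assms(1) smooth_Pair[OF assms(2,3)]] by simp

lemmas smooth_ident = smooth_bounded_linear[OF bounded_linear_ident]
lemmas smooth_fst = smooth_bounded_linear[OF bounded_linear_fst]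
lemmas smooth_snd = smooth_bounded_linear[OF bounded_linear_snd]

text \<open>The Jacobian \<open>J(y, x)\<close> of \<open>x \<mapsto> y \<circ> x\<close> satisfies \<open>J(y \<circ> z, 0) = J(y, z) J(z, 0)\<close>, and
  \<open>J(\<sqdot>, 0)\<close> is continuous and invariant under dilations, hence constant.\<close>

lemma translation_unimodular:
  fixes m :: "real ^ 'n::finite \<Rightarrow> real ^ 'n \<Rightarrow> real ^ 'n"
  assumes smooth: "smooth (\<lambda>(x, y). m x y)"
    and assoc: "\<And>x y z. m (m x y) z = m x (m y z)"
    and neutral: "\<And>x. m 0 x = x" "\<And>x. m x 0 = x"
    and dil: "\<And>R x y. R > 0 \<Longrightarrow> dilation wt R (m x y) = m (dilation wt R x) (dilation wt R y)"
    and wt: "\<And>k. wt k \<ge> 1"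
  shows "det (matrix (frechet_derivative (m y) (at x))) = 1"
proof -
  define D where "D y x = frechet_derivative (m y) (at x)" for y x
  define J where "J y x = det (matrix (D y x))" for y x
  let ?m = "\<lambda>(x, y). m x y"
  have "smooth (m y)" for y
    using smooth_curry[OF smooth smooth_const smooth_ident] .
  then have D: "(m y has_derivative D y x) (at x)" for y x
    unfolding D_def by (rule smooth_has_derivative)
  then have lin: "linear (D y x)" for y x
    by (rule has_derivative_linear)
  have "(m (m y z) has_derivative (\<lambda>v. D y (m z x) (D z x v))) (at x)" for x y z
  proof -
    have "m (m y z) = (\<lambda>w. m y (m z w))"
      by (rule ext) (rule assoc)
    then show ?thesis
      using has_derivative_compose[OF D[of z x] D] by simp
  qed
  then have "D (m y z) x = (\<lambda>v. D y (m z x) (D z x v))" for x y z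
    by (rule has_derivative_unique[OF D])
  then have J_mult: "J (m y z) x = J y (m z x) * J z x" for x y z
    by (simp add: J_def det_matrix_compose[OF lin lin])
  \<comment> \<open>Differentiating \<open>dil\<close> at the origin shows that the derivatives of
    the translations by \<open>y\<close> and by its dilate are conjugate under the dilation, hence
    have the same determinant.\<close>
  have J_dil: "J (dilation wt R y) 0 = J y 0" if R: "R > 0" for R y
  proof -
    let ?\<delta> = "dilation wt R"
    have bl: "bounded_linear ?\<delta>" and \<delta>: "linear ?\<delta>"
      using bounded_linear_dilation[of wt R] by (simp_all add: bounded_linear.linear)
    have \<delta>0: "?\<delta> 0 = 0"
      using \<delta> by (rule linear_0)
    have "((\<lambda>x. m (?\<delta> y) (?\<delta> x)) has_derivative (\<lambda>v. D (?\<delta> y) 0 (?\<delta> v))) (at 0)"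
      using has_derivative_compose[OF bounded_linear_imp_has_derivative[OF bl, of "at 0"]
          D[of "?\<delta> y" "?\<delta> 0"]]
      by (simp add: \<delta>0)
    moreover have "((\<lambda>x. m (?\<delta> y) (?\<delta> x)) has_derivative (\<lambda>v. ?\<delta> (D y 0 v))) (at 0)"
      using bounded_linear.has_derivative[OF bl D[of y 0]] by (simp add: dil[OF R])
    ultimately have "(\<lambda>v. D (?\<delta> y) 0 (?\<delta> v)) = (\<lambda>v. ?\<delta> (D y 0 v))"
      by (rule has_derivative_unique)
    then have "det (matrix (\<lambda>v. D (?\<delta> y) 0 (?\<delta> v))) = det (matrix (\<lambda>v. ?\<delta> (D y 0 v)))"
      by simp
    then have "J (?\<delta> y) 0 * det (matrix ?\<delta>) = det (matrix ?\<delta>) * J y 0"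
      by (simp add: J_def det_matrix_compose[OF lin \<delta>] det_matrix_compose[OF \<delta> lin])
    moreover have "det (matrix ?\<delta>) \<noteq> 0"
    proof -
      have "det (matrix ?\<delta>) * det (matrix (dilation wt (1 / R))) =
          det (matrix (\<lambda>x. ?\<delta> (dilation wt (1 / R) x)))"
        by (rule det_matrix_compose[OF \<delta>, symmetric])
          (rule bounded_linear.linear[OF bounded_linear_dilation])
      also have "\<dots> = 1"
        using R by (simp add: dilation_dilation matrix_id[unfolded id_def])
      finally show ?thesis by auto
    qed
    ultimately show ?thesis by simp
  qed
  have "continuous_on UNIV (\<lambda>y. J y 0)"
  proof -
    have "D y 0 = (\<lambda>v. frechet_derivative ?m (at (y, 0)) (0, v))" for y
    proof -
      have "((\<lambda>x. (y, x)) has_derivative (\<lambda>v. (0, v))) (at 0)"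
        by (intro has_derivative_Pair has_derivative_const has_derivative_ident)
      then have "(m y has_derivative (\<lambda>v. frechet_derivative ?m (at (y, 0)) (0, v))) (at 0)"
        using has_derivative_compose[of "\<lambda>x. (y, x)" _ 0 UNIV ?m] smooth_has_derivative[OF smooth, of "(y, 0)"]
        by simp
      then show ?thesis
        by (rule has_derivative_unique[OF D])
    qed
    moreover have "continuous_on UNIV (\<lambda>y. frechet_derivative ?m (at (y, 0)) (0, v))" for v
      by (rule continuous_on_compose2[OF smooth_continuous[OF smooth_frechet_derivative[OF smooth]]])
        (intro continuous_on_Pair continuous_on_id continuous_on_const, simp)
    ultimately have "continuous_on UNIV (\<lambda>y. D y 0 v)" for v
      by simp
    then show ?thesis
      unfolding J_def det_def matrix_def vec_lambda_beta
      by (intro continuous_on_sum continuous_on_mult continuous_on_const continuous_on_prod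
          continuous_on_component)
  qed
  then have "(\<lambda>n. J (dilation wt (1 / real (Suc n)) y) 0) \<longlonglongrightarrow> J 0 0" for y
    by (rule continuous_on_tendsto_compose[where s = UNIV, OF _ dilation_tendsto_0[of wt, OF wt]]) simp_all
  moreover have "J 0 0 = 1"
  proof -
    have "m 0 = (\<lambda>x. x)"
      by (rule ext) (rule neutral)
    then have "(m 0 has_derivative (\<lambda>v. v)) (at 0)"
      by simp
    then have "D 0 0 = (\<lambda>v. v)"
      by (rule has_derivative_unique[OF D])
    then show ?thesis
      by (simp add: J_def matrix_id[unfolded id_def])
  qed
  ultimately have "(\<lambda>n. J y 0) \<longlonglongrightarrow> 1" for y
    by (simp add: J_dil)
  then have "J y 0 = 1" for y
    by (rule LIMSEQ_unique[OF tendsto_const])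
  then show ?thesis
    using J_mult[of y x 0] by (simp add: neutral J_def D_def)
qed

section \<open>Invariance of Lebesgue measure under translations and inversion\<close>

context homogeneous_carnot_group
begin

lemma wt_ge_1: "wt k \<ge> 1"
  using layers by force

lemma smooth_gmult: "smooth f \<Longrightarrow> smooth g \<Longrightarrow> smooth (\<lambda>x. gmult (f x) (g x))"
  by (rule smooth_curry[OF smooth_mult])

lemma smooth_ginv: "smooth f \<Longrightarrow> smooth (\<lambda>x. ginv (f x))"
  by (rule smooth_compose[OF smooth_inv])

lemma ginv_0: "ginv 0 = 0"
  by (metis left_inverse right_neutral)

lemma ginv_gmult: "ginv (gmult x y) = gmult (ginv y) (ginv x)"
  by (metis assoc left_inverse left_neutral right_inverse right_neutral)

lemma ginv_ginv: "ginv (ginv x) = x"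
  by (metis assoc left_inverse left_neutral right_inverse right_neutral)

lemma det_left_translation: "det (matrix (frechet_derivative (gmult y) (at x))) = 1"
  by (rule translation_unimodular[OF smooth_mult assoc left_neutral right_neutral
        dilation_automorphism wt_ge_1])

text \<open>The opposite multiplication is again smooth and associative with the same neutral
  element and dilations, and its left translations are the right translations of the group.\<close>

lemma det_right_translation: "det (matrix (frechet_derivative (\<lambda>x. gmult x y) (at x))) = 1"
proof (rule translation_unimodular[of "\<lambda>x y. gmult y x" wt])
  show "smooth (\<lambda>(x, y). gmult y x)"
    using smooth_gmult[OF smooth_snd smooth_fst] by (simp add: case_prod_unfold)
qed (auto simp: assoc dilation_automorphism wt_ge_1[simplified])

text \<open>Since translations are unimodular, differentiating (x o y)^-1 = y^-1 o x^-1 at y = 0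
  shows that the Jacobian of the inversion is constant; since the inversion is an involution, the
  square of this constant is one.\<close>

lemma det_inversion: "\<bar>det (matrix (frechet_derivative ginv (at x)))\<bar> = 1"
proof -
  define I where "I x = frechet_derivative ginv (at x)" for x
  have I: "(ginv has_derivative I x) (at x)" for x
    unfolding I_def by (rule smooth_has_derivative[OF smooth_inv])
  have L: "(gmult x has_derivative frechet_derivative (gmult x) (at y)) (at y)" for x y
    by (rule smooth_has_derivative[OF smooth_gmult[OF smooth_const smooth_ident]])
  have R: "((\<lambda>x. gmult x y) has_derivative frechet_derivative (\<lambda>x. gmult x y) (at x)) (at x)" for x y
    by (rule smooth_has_derivative[OF smooth_gmult[OF smooth_ident smooth_const]])
  have "det (matrix (I x)) = det (matrix (I 0))" for x
  proof -
    have "((\<lambda>y. ginv (gmult x y)) has_derivative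
        (\<lambda>v. I (gmult x 0) (frechet_derivative (gmult x) (at 0) v))) (at 0)"
      by (rule has_derivative_compose[OF L I])
    moreover have "((\<lambda>y. gmult (ginv y) (ginv x)) has_derivative
        (\<lambda>v. frechet_derivative (\<lambda>y. gmult y (ginv x)) (at (ginv 0)) (I 0 v))) (at 0)"
      by (rule has_derivative_compose[OF I R])
    ultimately have "(\<lambda>v. I x (frechet_derivative (gmult x) (at 0) v)) =
        (\<lambda>v. frechet_derivative (\<lambda>y. gmult y (ginv x)) (at (ginv 0)) (I 0 v))"
      unfolding ginv_gmult right_neutral by (rule has_derivative_unique)
    then have "det (matrix (\<lambda>v. I x (frechet_derivative (gmult x) (at 0) v))) =
        det (matrix (\<lambda>v. frechet_derivative (\<lambda>y. gmult y (ginv x)) (at (ginv 0)) (I 0 v)))"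
      by simp
    then show ?thesis
      by (simp add: det_matrix_compose[OF has_derivative_linear[OF I] has_derivative_linear[OF L]]
          det_matrix_compose[OF has_derivative_linear[OF R] has_derivative_linear[OF I]]
          det_left_translation det_right_translation)
  qed
  moreover have "det (matrix (I (ginv x))) * det (matrix (I x)) = 1"
  proof -
    have "((\<lambda>x. x) has_derivative (\<lambda>v. I (ginv x) (I x v))) (at x)"
      using has_derivative_compose[OF I[of x] I] by (simp add: ginv_ginv)
    then have "(\<lambda>v. I (ginv x) (I x v)) = (\<lambda>v. v)"
      by (rule has_derivative_unique[OF _ has_derivative_ident])
    then show ?thesis
      using det_matrix_compose[OF has_derivative_linear[OF I] has_derivative_linear[OF I],
          of "ginv x" x] by (simp add: matrix_id[unfolded id_def])
  qed
  ultimately have "det (matrix (I x)) * det (matrix (I x)) = 1"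
    by metis
  then show ?thesis
    unfolding I_def[symmetric] by (auto simp: square_eq_1_iff)
qed

lemma distr_lborel_left: "distr lborel borel (gmult y) = lborel"
proof (rule distr_lborel_unimodular)
  show "(gmult y has_derivative frechet_derivative (gmult y) (at x)) (at x)" for x
    by (rule smooth_has_derivative[OF smooth_gmult[OF smooth_const smooth_ident]])
  show "gmult (ginv y) (gmult y x) = x" "gmult y (gmult (ginv y) x) = x" for x
    by (simp_all add: assoc[symmetric])
qed (simp add: det_left_translation)

lemma distr_lborel_right: "distr lborel borel (\<lambda>x. gmult x y) = lborel"
proof (rule distr_lborel_unimodular)
  show "((\<lambda>x. gmult x y) has_derivative frechet_derivative (\<lambda>x. gmult x y) (at x)) (at x)" for x
    by (rule smooth_has_derivative[OF smooth_gmult[OF smooth_ident smooth_const]])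
  show "gmult (gmult x y) (ginv y) = x" "gmult (gmult x (ginv y)) y = x" for x
    by (simp_all add: assoc)
qed (simp add: det_right_translation)

lemma distr_lborel_ginv: "distr lborel borel ginv = lborel"
  by (rule distr_lborel_unimodular[where T' = ginv, OF smooth_has_derivative[OF smooth_inv]])
    (simp_all add: det_inversion ginv_ginv)

lemma distr_lborel_left_ginv: "distr lborel borel (\<lambda>z. gmult x (ginv z)) = lborel"
proof -
  have "continuous_on UNIV (gmult x)" "continuous_on UNIV ginv"
    by (intro smooth_continuous smooth_gmult smooth_const smooth_ident smooth_inv)+
  then have "distr (distr lborel borel ginv) borel (gmult x) = distr lborel borel (\<lambda>z. gmult x (ginv z))"
    by (subst distr_distr) (auto simp: comp_def intro!: borel_measurable_continuous_onI)
  then show ?thesis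
    by (simp add: distr_lborel_ginv distr_lborel_left)
qed

text \<open>The derivative of the multiplication at the origin is addition, because 0 is neutral on
  both sides; differentiating x o x^-1 = 0 then gives the claim.\<close>

lemma frechet_derivative_ginv_0: "frechet_derivative ginv (at 0) v = - v"
proof -
  let ?D = "frechet_derivative (\<lambda>(x, y). gmult x y) (at (0, 0))"
  let ?I = "frechet_derivative ginv (at 0)"
  have m: "((\<lambda>(x, y). gmult x y) has_derivative ?D) (at (0, 0))"
    by (rule smooth_has_derivative[OF smooth_mult])
  have lin: "linear ?D" using m by (rule has_derivative_linear)
  have c: "((\<lambda>x. gmult (f x) (g x)) has_derivative (\<lambda>v. ?D (f' v, g' v))) (at 0)"
    if "(f has_derivative f') (at 0)" "(g has_derivative g') (at 0)" "f 0 = 0" "g 0 = 0"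
    for f g :: "real ^ 'n \<Rightarrow> real ^ 'n" and f' g'
    using has_derivative_compose[OF has_derivative_Pair[OF that(1,2)], of "\<lambda>(x, y). gmult x y" ?D]
      m that(3,4) by simp
  have a: "?D (v, 0) = v" for v
    using has_derivative_unique[OF c[OF has_derivative_ident has_derivative_const[of 0] refl refl],
        of "\<lambda>v. v"] by (simp add: fun_eq_iff)
  have b: "?D (0, v) = v" for v
    using has_derivative_unique[OF c[OF has_derivative_const[of 0] has_derivative_ident refl refl],
        of "\<lambda>v. v"] by (simp add: fun_eq_iff)
  have "(\<lambda>v. ?D (v, ?I v)) = (\<lambda>v. 0)"
    using has_derivative_unique[OF c[OF has_derivative_ident smooth_has_derivative[OF smooth_inv]]]
      has_derivative_const ginv_0 by fastforce
  then have "?D (v, ?I v) = 0"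
    by metis
  moreover have "?D (v, ?I v) = ?D (v, 0) + ?D (0, ?I v)"
    using linear_add[OF lin, of "(v, 0)" "(0, ?I v)"] by simp
  ultimately show ?thesis
    using a b by (simp add: eq_neg_iff_add_eq_0 add.commute)
qed

subsection \<open>The horizontal vector fields\<close>

lemma X_eq: "X i x = frechet_derivative (gmult x) (at 0) (axis (\<iota> i) 1)"
  using X_left_invariant[of i] unfolding left_invariant_def
  by (metis right_neutral X_origin)

lemma smooth_X: "smooth (X i)"
  using X_left_invariant[of i] by (simp add: left_invariant_def)

text \<open>Both sides come from differentiating the automorphism property at the origin; the factor
  is \<open>R\<close> to the first power because \<open>\<iota> i\<close> belongs to the first
  layer. This homogeneity is the source of the factor 1/R in the gradient of a rescaled
  cutoff.\<close>

lemma X_dilation: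
  assumes R: "R > 0"
  shows "dilation wt R (X i x) = R *\<^sub>R X i (dilation wt R x)"
proof -
  let ?\<delta> = "dilation wt R" and ?D = "\<lambda>x. frechet_derivative (gmult x) (at 0)"
  have bl: "bounded_linear ?\<delta>" by (rule bounded_linear_dilation)
  have \<delta>0: "?\<delta> 0 = 0" by (simp add: dilation_def vec_eq_iff)
  have L: "(gmult x has_derivative ?D x) (at 0)" for x
    by (rule smooth_has_derivative[OF smooth_gmult[OF smooth_const smooth_ident]])
  have "((\<lambda>y. gmult (?\<delta> x) (?\<delta> y)) has_derivative (\<lambda>v. ?\<delta> (?D x v))) (at 0)"
    using bounded_linear.has_derivative[OF bl L[of x]] by (simp add: dilation_automorphism R)
  moreover have "((\<lambda>y. gmult (?\<delta> x) (?\<delta> y)) has_derivative (\<lambda>v. ?D (?\<delta> x) (?\<delta> v))) (at 0)"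
    using has_derivative_compose[OF bounded_linear_imp_has_derivative[OF bl, of "at 0"],
        of "gmult (?\<delta> x)" "?D (?\<delta> x)"] L[of "?\<delta> x"] by (simp add: \<delta>0)
  ultimately have "(\<lambda>v. ?\<delta> (?D x v)) = (\<lambda>v. ?D (?\<delta> x) (?\<delta> v))"
    by (rule has_derivative_unique)
  then have "?\<delta> (?D x (axis (\<iota> i) 1)) = ?D (?\<delta> x) (?\<delta> (axis (\<iota> i) 1))"
    by meson
  moreover have "wt (\<iota> i) = 1"
    using first_layer by (auto simp: bij_betw_def)
  then have "?\<delta> (axis (\<iota> i) 1) = R *\<^sub>R axis (\<iota> i) 1"
    by (auto simp: dilation_def vec_eq_iff axis_def)
  ultimately show ?thesis
    using linear_cmul[OF has_derivative_linear[OF L]] by (simp add: X_eq)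
qed

text \<open>The Euclidean divergence of the field, which is the zeroth-order coefficient of
  \<open>- formal_adjoint (X i)\<close>.\<close>

definition div_X :: "'l \<Rightarrow> real ^ 'n \<Rightarrow> real" where
  "div_X i x = (\<Sum>k\<in>UNIV. frechet_derivative (X i) (at x) (axis k 1) $ k)"

text \<open>\<open>div X\<^sub>i\<close> is homogeneous of degree \<open>-1\<close> and continuous at the origin.\<close>

lemma div_X_eq_0: "div_X i x = 0"
proof -
  let ?DX = "\<lambda>x. frechet_derivative (X i) (at x)"
  have DX: "(X i has_derivative ?DX x) (at x)" for x
    by (rule smooth_has_derivative[OF smooth_X])
  have scale: "div_X i x = R * div_X i (dilation wt R x)" if R: "R > 0" for R x
  proof -
    let ?\<delta> = "dilation wt R"
    have bl: "bounded_linear ?\<delta>" by (rule bounded_linear_dilation)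
    have "((\<lambda>x. ?\<delta> (X i x)) has_derivative (\<lambda>v. ?\<delta> (?DX x v))) (at x)"
      by (rule bounded_linear.has_derivative[OF bl DX])
    moreover have "((\<lambda>x. ?\<delta> (X i x)) has_derivative (\<lambda>v. R *\<^sub>R ?DX (?\<delta> x) (?\<delta> v))) (at x)"
      unfolding X_dilation[OF R]
      by (rule has_derivative_scaleR_right)
        (rule has_derivative_compose[OF bounded_linear_imp_has_derivative[OF bl] DX])
    ultimately have "(\<lambda>v. ?\<delta> (?DX x v)) = (\<lambda>v. R *\<^sub>R ?DX (?\<delta> x) (?\<delta> v))"
      by (rule has_derivative_unique)
    then have eq: "?\<delta> (?DX x v) = R *\<^sub>R ?DX (?\<delta> x) (?\<delta> v)" for v
      by meson
    \<comment> \<open>On the diagonal the input and the output coordinate carry the same weight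
      \<open>R ^ wt k\<close>, which cancels and leaves the single factor \<open>R\<close>.\<close>
    have "?DX x (axis k 1) $ k = R * ?DX (?\<delta> x) (axis k 1) $ k" for k
    proof -
      have "?\<delta> (axis k 1) = R ^ wt k *\<^sub>R axis k 1"
        by (auto simp: dilation_def vec_eq_iff axis_def)
      then have "R ^ wt k * ?DX x (axis k 1) $ k = R ^ wt k * (R * ?DX (?\<delta> x) (axis k 1) $ k)"
        using arg_cong[OF eq[of "axis k 1"], of "\<lambda>y. y $ k"]
        by (simp add: linear_cmul[OF has_derivative_linear[OF DX]] dilation_def)
      then show ?thesis
        using R by simp
    qed
    then show ?thesis
      by (simp add: div_X_def sum_distrib_left)
  qed
  have "continuous_on UNIV (div_X i)"
    unfolding div_X_def
    by (intro continuous_on_sum continuous_on_component smooth_continuous smooth_frechet_derivative smooth_X)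
  then have "(\<lambda>n. div_X i (dilation wt (1 / real (Suc n)) x)) \<longlonglongrightarrow> div_X i 0"
    by (rule continuous_on_tendsto_compose[where s = UNIV, OF _ dilation_tendsto_0[OF wt_ge_1]]) simp_all
  then have "(\<lambda>n. 1 / real (Suc n) * div_X i (dilation wt (1 / real (Suc n)) x)) \<longlonglongrightarrow> 0 * div_X i 0"
    by (intro tendsto_mult LIMSEQ_Suc[OF lim_1_over_n])
  then have "(\<lambda>n. div_X i x) \<longlonglongrightarrow> 0"
    using scale[of "1 / real (Suc n)" x for n] by simp
  then show ?thesis
    by (rule LIMSEQ_unique[OF tendsto_const])
qed

text \<open>Skew-adjointness of the horizontal fields: the product rule leaves the divergence as the
  only additional term, and it vanishes.\<close>

lemma formal_adjoint_eq:
  assumes \<phi>: "(\<phi> has_derivative \<phi>') (at x)"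
  shows "formal_adjoint (X i) \<phi> x = - \<phi>' (X i x)"
proof -
  let ?DX = "frechet_derivative (X i) (at x)"
  have "frechet_derivative (\<lambda>y. X i y $ k * \<phi> y) (at x) = (\<lambda>v. X i x $ k * \<phi>' v + ?DX v $ k * \<phi> x)" for k
    by (rule frechet_derivative_at[symmetric])
      (intro has_derivative_mult bounded_linear.has_derivative[OF bounded_linear_vec_nth]
        smooth_has_derivative[OF smooth_X] \<phi>)
  then have "formal_adjoint (X i) \<phi> x =
      - ((\<Sum>k\<in>UNIV. X i x $ k * \<phi>' (axis k 1)) + div_X i x * \<phi> x)"
    by (simp add: formal_adjoint_def div_X_def sum.distrib sum_distrib_right)
  also have "(\<Sum>k\<in>UNIV. X i x $ k * \<phi>' (axis k 1)) = \<phi>' (\<Sum>k\<in>UNIV. X i x $ k *\<^sub>R axis k 1)"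
    using has_derivative_linear[OF \<phi>] by (simp add: linear_sum linear_cmul)
  also have "(\<Sum>k\<in>UNIV. X i x $ k *\<^sub>R axis k 1) = X i x"
    using basis_expansion[of "X i x"] by (simp add: scalar_mult_eq_scaleR)
  finally show ?thesis
    by (simp add: div_X_eq_0)
qed

text \<open>Differentiating \<open>s \<mapsto> \<rho>(x \<circ> s \<circ> z\<^sup>-\<^sup>1)\<close> and \<open>s \<mapsto> \<rho>(x \<circ> (z \<circ> s)\<^sup>-\<^sup>1)\<close> at the origin: the second
  map is the first one precomposed with the inversion.\<close>

lemma X_right_convolution_kernel:
  assumes \<rho>: "smooth \<rho>"
  shows "frechet_derivative (\<lambda>x. \<rho> (gmult x (ginv z))) (at x) (X i x) =
      - frechet_derivative (\<lambda>z. \<rho> (gmult x (ginv z))) (at z) (X i z)"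
proof -
  let ?e = "axis (\<iota> i) 1"
  define k where "k s = \<rho> (gmult (gmult x s) (ginv z))" for s
  have L: "(gmult x has_derivative frechet_derivative (gmult x) (at 0)) (at 0)" for x
    by (rule smooth_has_derivative[OF smooth_gmult[OF smooth_const smooth_ident]])
  have "smooth k"
    unfolding k_def using smooth_compose[OF \<rho>, of "\<lambda>s. gmult (gmult x s) (ginv z)"]
    by (simp add: smooth_gmult smooth_const smooth_ident)
  then have k: "(k has_derivative frechet_derivative k (at s)) (at s)" for s
    by (rule smooth_has_derivative)
  have d1: "((\<lambda>x. \<rho> (gmult x (ginv z))) has_derivative
      frechet_derivative (\<lambda>x. \<rho> (gmult x (ginv z))) (at (gmult x 0))) (at (gmult x 0))"
    by (intro smooth_has_derivative smooth_compose[OF \<rho>] smooth_gmult smooth_const smooth_ident)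
  have d2: "((\<lambda>z. \<rho> (gmult x (ginv z))) has_derivative
      frechet_derivative (\<lambda>z. \<rho> (gmult x (ginv z))) (at (gmult z 0))) (at (gmult z 0))"
    by (intro smooth_has_derivative smooth_compose[OF \<rho>] smooth_gmult smooth_const smooth_ginv smooth_ident)
  have "frechet_derivative k (at 0) = (\<lambda>v. frechet_derivative (\<lambda>x. \<rho> (gmult x (ginv z))) (at (gmult x 0))
      (frechet_derivative (gmult x) (at 0) v))"
    using has_derivative_compose[OF L d1] unfolding k_def
    by (rule frechet_derivative_at[symmetric])
  then have 1: "frechet_derivative k (at 0) ?e =
      frechet_derivative (\<lambda>x. \<rho> (gmult x (ginv z))) (at x) (X i x)"
    by (simp add: X_eq)
  have "((\<lambda>s. k (ginv s)) has_derivative (\<lambda>v. frechet_derivative (\<lambda>z. \<rho> (gmult x (ginv z)))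
      (at (gmult z 0)) (frechet_derivative (gmult z) (at 0) v))) (at 0)"
    using has_derivative_compose[OF L d2] unfolding k_def by (simp add: ginv_gmult assoc)
  moreover have "((\<lambda>s. k (ginv s)) has_derivative
      (\<lambda>v. frechet_derivative k (at 0) (frechet_derivative ginv (at 0) v))) (at 0)"
    using has_derivative_compose[OF smooth_has_derivative[OF smooth_inv, of 0], of k] k[of 0]
    by (simp add: ginv_0)
  ultimately have "(\<lambda>v. frechet_derivative (\<lambda>z. \<rho> (gmult x (ginv z)))
      (at (gmult z 0)) (frechet_derivative (gmult z) (at 0) v)) =
      (\<lambda>v. frechet_derivative k (at 0) (frechet_derivative ginv (at 0) v))"
    by (rule has_derivative_unique)
  then have "frechet_derivative (\<lambda>z. \<rho> (gmult x (ginv z))) (at (gmult z 0))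
      (frechet_derivative (gmult z) (at 0) ?e) = frechet_derivative k (at 0) (- ?e)"
    unfolding frechet_derivative_ginv_0 by meson
  then show ?thesis
    using 1 linear_neg[OF has_derivative_linear[OF k]] by (simp add: X_eq)
qed

end

subsection \<open>Homogeneous balls\<close>

lemma sum_weights_eq_homogeneous_dim:
  fixes wt :: "'n::finite \<Rightarrow> nat"
  assumes "range wt \<subseteq> {1..r}"
  shows "(\<Sum>k\<in>UNIV. wt k) = homogeneous_dim wt r"
proof -
  have "(\<Sum>k\<in>UNIV. wt k) = (\<Sum>j = 1..r. \<Sum>k | k \<in> UNIV \<and> wt k = j. wt k)"
    using sum.group[of UNIV "{1..r}" wt wt] assms by simp
  also have "\<dots> = (\<Sum>j = 1..r. j * card {k. wt k = j})"
    by (intro sum.cong refl) simp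
  finally show ?thesis
    by (simp add: homogeneous_dim_def)
qed

lemma emeasure_dilation_vimage:
  fixes A :: "(real ^ 'n::finite) set"
  assumes R: "R > 0" and A: "A \<in> sets borel"
  shows "emeasure lborel A = ennreal (R ^ (\<Sum>k\<in>UNIV. wt k)) * emeasure lborel (dilation wt R -` A)"
proof -
  \<comment> \<open>The dilation factors are indexed by basis vectors instead of coordinates: on
    \<open>axis k 1\<close> this sum is \<open>R ^ wt k\<close>. The affine scaling rule for
    \<open>lborel\<close> expects this form.\<close>
  define c :: "real ^ 'n \<Rightarrow> real" where "c b = (\<Sum>k\<in>UNIV. R ^ wt k * b $ k)" for b
  have c: "c (axis k 1) = R ^ wt k" for k
    unfolding c_def axis_def by (simp add: if_distrib cong: if_cong)
  have Basis: "b \<in> Basis \<longleftrightarrow> (\<exists>k. b = axis k (1::real))" for b :: "real ^ 'n"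
    by (auto simp: Basis_vec_def)
  have eq: "(\<lambda>x. 0 + (\<Sum>j\<in>Basis. (c j * (x \<bullet> j)) *\<^sub>R j)) = dilation wt R"
  proof
    fix x :: "real ^ 'n"
    have "dilation wt R x = (\<Sum>j\<in>Basis. (dilation wt R x \<bullet> j) *\<^sub>R j)"
      by (simp only: euclidean_representation)
    also have "\<dots> = (\<Sum>j\<in>Basis. (c j * (x \<bullet> j)) *\<^sub>R j)"
      by (intro sum.cong refl) (auto simp: Basis c dilation_def inner_axis)
    finally show "0 + (\<Sum>j\<in>Basis. (c j * (x \<bullet> j)) *\<^sub>R j) = dilation wt R x"
      by simp
  qed
  have prod: "(\<Prod>j\<in>Basis. \<bar>c j\<bar>) = R ^ (\<Sum>k\<in>UNIV. wt k)"
  proof -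
    have "Basis = range (\<lambda>i::'n. axis i (1::real))" "inj (\<lambda>i::'n. axis i (1::real))"
      by (auto simp: Basis inj_def axis_eq_axis)
    then have "(\<Prod>j\<in>Basis. \<bar>c j\<bar>) = (\<Prod>k\<in>UNIV. \<bar>c (axis k 1)\<bar>)"
      using prod.reindex[of "\<lambda>i::'n. axis i (1::real)" UNIV "\<lambda>j. \<bar>c j\<bar>"] by (simp add: comp_def)
    then show ?thesis
      using R by (simp add: c power_sum)
  qed
  have "lborel = density (distr lborel borel (dilation wt R)) (\<lambda>_. ennreal (R ^ (\<Sum>k\<in>UNIV. wt k)))"
    using lborel_affine_euclidean[of c 0] R unfolding eq prod by (force simp: Basis c)
  then have "emeasure lborel A =
      emeasure (density (distr lborel borel (dilation wt R)) (\<lambda>_. ennreal (R ^ (\<Sum>k\<in>UNIV. wt k)))) A"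
    by metis
  also have "\<dots> = ennreal (R ^ (\<Sum>k\<in>UNIV. wt k)) * emeasure (distr lborel borel (dilation wt R)) A"
    using A by (simp add: emeasure_density_const)
  also have "emeasure (distr lborel borel (dilation wt R)) A = emeasure lborel (dilation wt R -` A)"
    using A linear_continuous_on[OF bounded_linear_dilation]
    by (subst emeasure_distr) (auto intro: borel_measurable_continuous_onI)
  finally show ?thesis .
qed

context homogeneous_carnot_group
begin

context
  fixes S :: "real ^ 'n \<Rightarrow> real"
  assumes S: "homogeneous_norm ginv wt S"
begin

lemma S_continuous: "continuous_on UNIV S"
  and S_nonneg: "S x \<ge> 0"
  and S_eq_0_iff: "S x = 0 \<longleftrightarrow> x = 0"
  and S_dilation: "R > 0 \<Longrightarrow> S (dilation wt R x) = R * S x"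
  using S by (auto simp: homogeneous_norm_def)

lemma open_hball: "open (hball S R)"
  unfolding hball_def by (intro open_Collect_less S_continuous continuous_on_const)

lemma hball_mono: "R \<le> R' \<Longrightarrow> hball S R \<subseteq> hball S R'"
  by (auto simp: hball_def)

lemma dilation_vimage_hball: "R > 0 \<Longrightarrow> dilation wt R -` hball S (R * t) = hball S t"
  by (auto simp: hball_def S_dilation)

text \<open>Let x0 minimise \<open>S\<close> on the Euclidean unit sphere. A point outside the open
  unit ball is brought back to the sphere by a dilation with factor R in (0, 1], and there S x0 <= R
  S x <= S x.\<close>

lemma bounded_hball_aux: "\<exists>c>0. hball S c \<subseteq> ball 0 1"
proof -
  have "sphere 0 1 \<noteq> ({} :: (real ^ 'n) set)" by simp
  then obtain x0 where x0: "norm x0 = 1" "\<And>x. norm x = 1 \<Longrightarrow> S x0 \<le> S x"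
    using continuous_attains_inf[of "sphere 0 1" S] continuous_on_subset[OF S_continuous] by auto
  have "S x0 > 0"
    using x0(1) S_nonneg[of x0] S_eq_0_iff[of x0] by fastforce
  moreover have "S x0 \<le> S x" if x: "norm x \<ge> 1" for x
  proof -
    have "continuous_on {0..1} (\<lambda>R. norm (dilation wt R x))"
      unfolding dilation_def by (intro continuous_intros)
    moreover have wt0: "wt k \<noteq> 0" for k
      using wt_ge_1[of k] by simp
    have 0: "dilation wt 0 x = 0"
      by (simp add: dilation_def vec_eq_iff power_0_left wt0)
    ultimately obtain R where R: "0 \<le> R" "R \<le> 1" "norm (dilation wt R x) = 1"
      using IVT'[of "\<lambda>R. norm (dilation wt R x)" 0 1 1] x by auto
    then have "R > 0"
      using 0 by (cases "R = 0") auto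
    then have "S x0 \<le> R * S x"
      using x0(2)[OF R(3)] by (simp add: S_dilation)
    also have "\<dots> \<le> S x"
      using R(2) S_nonneg[of x] by (simp add: mult_left_le_one_le R(1))
    finally show ?thesis .
  qed
  ultimately show ?thesis
    by (intro exI[of _ "S x0"]) (auto simp: hball_def not_le[symmetric])
qed

lemma bounded_hball: "bounded (hball S R)"
proof -
  obtain c where c: "c > 0" "hball S c \<subseteq> ball 0 1"
    using bounded_hball_aux by blast
  define \<kappa> where "\<kappa> = max 1 (R / c)"
  have l: "\<kappa> > 0" by (simp add: \<kappa>_def)
  have "hball S (\<kappa> * c) \<subseteq> dilation wt \<kappa> ` hball S c"
  proof
    fix x assume x: "x \<in> hball S (\<kappa> * c)"
    then have "dilation wt \<kappa> (dilation wt (1 / \<kappa>) x) \<in> hball S (\<kappa> * c)"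
      using l by (simp add: dilation_inverse)
    then have "dilation wt (1 / \<kappa>) x \<in> hball S c"
      using dilation_vimage_hball[OF l, of c] by blast
    then show "x \<in> dilation wt \<kappa> ` hball S c"
      using dilation_inverse[of \<kappa> wt x] l by (metis imageI less_irrefl)
  qed
  moreover have "bounded (dilation wt \<kappa> ` hball S c)"
    using c(2) by (intro bounded_linear_image bounded_linear_dilation) (rule bounded_subset[OF bounded_ball])
  moreover have "R \<le> \<kappa> * c"
    using c(1) by (simp add: \<kappa>_def max_def field_simps)
  ultimately show ?thesis
    using bounded_subset hball_mono by metis
qed

lemma hball_lmeasurable: "hball S R \<in> lmeasurable"
  by (intro lmeasurable_open bounded_hball open_hball)

text \<open>The dilation is diagonal with determinant R^Q, where Q is the sum of all weights. The
  volume factors \<open>R powr Q\<close> in the estimates below originate here.\<close>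

lemma measure_hball:
  assumes R: "R > 0"
  shows "measure lebesgue (hball S R) =
    R powr real (homogeneous_dim wt r) * measure lebesgue (hball S 1)"
proof -
  have "emeasure lborel (hball S R) =
      ennreal (R ^ homogeneous_dim wt r) * emeasure lborel (hball S 1)"
    using emeasure_dilation_vimage[OF R, of "hball S R" wt] dilation_vimage_hball[OF R, of 1]
      open_hball[of R] layers by (simp add: sum_weights_eq_homogeneous_dim[of wt r])
  then have "measure lborel (hball S R) = R ^ homogeneous_dim wt r * measure lborel (hball S 1)"
    using R by (simp add: measure_def enn2real_mult)
  then show ?thesis
    using R open_hball by (simp add: powr_realpow measure_completion)
qed

lemma measure_hball_pos:
  assumes R: "R > 0"
  shows "measure lebesgue (hball S R) > 0"
proof -
  have "0 \<in> hball S R"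
    using R S_eq_0_iff[of 0] by (simp add: hball_def)
  then have "\<not> negligible (hball S R)"
    using open_not_negligible[OF open_hball] by blast
  then show ?thesis
    using hball_lmeasurable[of R]
    by (metis measure_nonneg negligible_iff_measure order_le_less)
qed

end

end

subsection \<open>Integral operators with smooth kernels\<close>

lemma Lp_loc_1_set_integrable:
  fixes w :: "real ^ 'n::finite \<Rightarrow> 'b::euclidean_space"
  assumes "Lp_loc 1 w" "compact K"
  shows "set_integrable lebesgue K w"
proof -
  have "set_integrable lebesgue K (\<lambda>x. norm (w x))"
    using assms by (auto simp: Lp_loc_def)
  moreover have "set_borel_measurable lebesgue K w"
    using assms unfolding Lp_loc_def set_borel_measurable_def
    by (intro borel_measurable_scaleR borel_measurable_indicator fmeasurableD lmeasurable_compact) auto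
  ultimately show ?thesis
    by (rule set_integrable_bound) simp
qed

lemma Lp_loc_imp_Lp_loc_1:
  assumes "Lp_loc p w" "p \<ge> 1"
  shows "Lp_loc 1 w"
  unfolding Lp_loc_def
proof (intro conjI allI impI)
  show w: "w \<in> borel_measurable lebesgue"
    using assms by (simp add: Lp_loc_def)
  fix K :: "(real ^ 'a) set"
  assume K: "compact K"
  then have i: "set_integrable lebesgue K (\<lambda>x. 1 + norm (w x) powr p)"
    using assms lmeasurable_compact[OF K]
    by (intro set_integral_add) (auto simp: Lp_loc_def lmeasurable_iff_integrable set_integrable_def)
  have m: "set_borel_measurable lebesgue K (\<lambda>x. norm (w x) powr 1)"
    using w K unfolding set_borel_measurable_def
    by (intro borel_measurable_scaleR borel_measurable_indicator fmeasurableD lmeasurable_compact) auto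
  have le: "norm (w x) \<le> 1 + norm (w x) powr p" for x
  proof (cases "norm (w x) \<le> 1")
    case False
    then have "norm (w x) powr 1 \<le> norm (w x) powr p"
      using assms(2) by (intro powr_mono) auto
    then show ?thesis using False by simp
  qed (use powr_ge_zero[of "norm (w x)" p] in linarith)
  then have le': "norm (norm (w x) powr 1) \<le> norm (1 + norm (w x) powr p)" for x
    using le[of x] by simp
  show "set_integrable lebesgue K (\<lambda>x. norm (w x) powr 1)"
    by (rule set_integrable_bound[OF i m]) (intro AE_I2 impI le')
qed

lemma integrable_continuous_mult:
  fixes \<psi> w :: "real ^ 'n::finite \<Rightarrow> real"
  assumes w: "Lp_loc 1 w" and \<psi>: "continuous_on UNIV \<psi>"
    and K: "compact K" "\<And>z. z \<notin> K \<Longrightarrow> \<psi> z = 0"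
  shows "integrable lebesgue (\<lambda>z. \<psi> z * w z)"
proof -
  have "compact (\<psi> ` K)"
    by (intro compact_continuous_image K continuous_on_subset[OF \<psi>]) simp
  then obtain B where B: "\<And>z. z \<in> K \<Longrightarrow> \<bar>\<psi> z\<bar> \<le> B"
    using compact_imp_bounded[of "\<psi> ` K"] unfolding bounded_iff by force
  have i: "integrable lebesgue (\<lambda>z. B *\<^sub>R (indicator K z *\<^sub>R w z))"
    using Lp_loc_1_set_integrable[OF w K(1)] unfolding set_integrable_def
    by (rule integrable_scaleR_right)
  have m: "(\<lambda>z. \<psi> z * w z) \<in> borel_measurable lebesgue"
    using \<psi> w by (intro borel_measurable_times)
      (auto simp: Lp_loc_def measurable_completion borel_measurable_continuous_onI)
  have le: "norm (\<psi> z * w z) \<le> norm (B *\<^sub>R (indicator K z *\<^sub>R w z))" for z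
  proof (cases "z \<in> K")
    case True
    then have "\<bar>\<psi> z\<bar> \<le> \<bar>B\<bar>" using B by fastforce
    then show ?thesis using True by (simp add: abs_mult mult_right_mono)
  qed (simp add: K(2))
  show ?thesis
    by (rule Bochner_Integration.integrable_bound[OF i m]) (intro AE_I2 le)
qed

lemma integral_continuous_mult_bound:
  fixes \<psi> w :: "real ^ 'n::finite \<Rightarrow> real"
  assumes w: "Lp_loc 1 w" and \<psi>: "continuous_on UNIV \<psi>"
    and K: "compact K" "\<And>z. z \<notin> K \<Longrightarrow> \<psi> z = 0" and B: "\<And>z. z \<in> K \<Longrightarrow> \<bar>\<psi> z\<bar> \<le> B"
  shows "\<bar>LINT z|lebesgue. \<psi> z * w z\<bar> \<le> B * (LINT z:K|lebesgue. \<bar>w z\<bar>)"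
proof -
  have "\<bar>LINT z|lebesgue. \<psi> z * w z\<bar> \<le> (LINT z|lebesgue. \<bar>\<psi> z * w z\<bar>)"
    by (rule integral_abs_bound)
  also have "\<dots> \<le> (LINT z|lebesgue. B * (indicator K z *\<^sub>R \<bar>w z\<bar>))"
  proof (rule integral_mono)
    show "integrable lebesgue (\<lambda>z. \<bar>\<psi> z * w z\<bar>)"
      using integrable_continuous_mult[OF w \<psi> K] by (rule integrable_abs)
    have "set_integrable lebesgue K (\<lambda>z. \<bar>w z\<bar>)"
      using Lp_loc_1_set_integrable[OF w K(1)] by (rule set_integrable_abs)
    then show "integrable lebesgue (\<lambda>z. B * (indicator K z *\<^sub>R \<bar>w z\<bar>))"
      unfolding set_integrable_def by (rule integrable_mult_right)
    show "\<bar>\<psi> z * w z\<bar> \<le> B * (indicator K z *\<^sub>R \<bar>w z\<bar>)" for z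
      using B[of z] K(2)[of z] by (cases "z \<in> K") (auto simp: abs_mult mult_right_mono)
  qed
  finally show ?thesis
    by (simp add: set_lebesgue_integral_def)
qed

text \<open>Differentiation under the integral against a weight that is merely locally integrable.
  For \<open>x\<close> near a given point all kernels live on one compact set of \<open>z\<close>,
  on which \<open>D\<close> is uniformly continuous, so every error is a small constant times the L1
  norm of \<open>w\<close> on that set.\<close>

lemma Ck_1_integral_kernel:
  fixes \<Psi> :: "(real ^ 'm::finite) \<times> (real ^ 'n::finite) \<Rightarrow> real" and w :: "real ^ 'n \<Rightarrow> real"
  assumes \<Psi>: "smooth \<Psi>" and w: "Lp_loc 1 w"
    and supp: "\<And>x0. \<exists>K. compact K \<and> (\<forall>x z. dist x x0 < 1 \<longrightarrow> z \<notin> K \<longrightarrow> \<Psi> (x, z) = 0)"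
  defines "D x z v \<equiv> frechet_derivative \<Psi> (at (x, z)) (v, 0)"
  shows "((\<lambda>x. LINT z|lebesgue. \<Psi> (x, z) * w z) has_derivative
      (\<lambda>v. LINT z|lebesgue. D x z v * w z)) (at x)"
    and "Ck 1 (\<lambda>x. LINT z|lebesgue. \<Psi> (x, z) * w z)"
proof -
  let ?f = "\<lambda>x. LINT z|lebesgue. \<Psi> (x, z) * w z" and ?f' = "\<lambda>x v. LINT z|lebesgue. D x z v * w z"
  have \<Psi>': "(\<Psi> has_derivative frechet_derivative \<Psi> (at y)) (at y)" for y
    by (rule smooth_has_derivative[OF \<Psi>])
  have der: "((\<lambda>x. \<Psi> (x, z)) has_derivative D x z) (at x)" for x z
  proof -
    have "((\<lambda>x. (x, z)) has_derivative (\<lambda>v. (v, 0))) (at x)"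
      by (intro has_derivative_Pair has_derivative_const has_derivative_ident)
    from has_derivative_compose[OF this \<Psi>'] show ?thesis
      by (simp add: D_def[abs_def])
  qed
  have lin: "linear (D x z)" for x z
    using der by (rule has_derivative_linear)
  have D_cont: "continuous_on UNIV (\<lambda>(x, z). D x z v)" for v
    using smooth_continuous[OF smooth_frechet_derivative[OF \<Psi>], of "(v, 0)"]
    by (simp add: D_def case_prod_beta)
  have D_cont2: "continuous_on UNIV (\<lambda>z. D x z v)" for x v
    using continuous_on_compose2[OF D_cont[of v], of UNIV "\<lambda>z. (x, z)"]
    by (simp add: continuous_on_Pair continuous_on_const continuous_on_id)
  have \<Psi>_cont2: "continuous_on UNIV (\<lambda>z. \<Psi> (x, z))" for x
    using continuous_on_compose2[OF smooth_continuous[OF \<Psi>], of UNIV "\<lambda>z. (x, z)"]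
    by (simp add: continuous_on_Pair continuous_on_const continuous_on_id)
  have D_0: "D x z v = 0" if K: "\<And>x z. dist x x0 < 1 \<Longrightarrow> z \<notin> K \<Longrightarrow> \<Psi> (x, z) = 0"
    and x: "dist x x0 < 1" and z: "z \<notin> K" for x0 x z v K
  proof -
    have "((\<lambda>x. \<Psi> (x, z)) has_derivative (\<lambda>v. 0)) (at x)"
      by (rule has_derivative_transform_within_open[OF has_derivative_const[of 0], of "ball x0 1"])
        (use x z K in \<open>auto simp: dist_commute\<close>)
    from has_derivative_unique[OF der this] show ?thesis
      by simp
  qed
  \<comment> \<open>Compactness gives uniform continuity for each fixed direction. The least of the
    finitely many radii, with the share \<open>e / ?n\<close> for each basis vector, makes the bound
    uniform in \<open>v\<close>.\<close>
  have unif: "\<exists>d>0. d \<le> 1 \<and> (\<forall>x z v. dist x x0 < d \<longrightarrow> z \<in> K \<longrightarrow> \<bar>D x z v - D x0 z v\<bar> \<le> e * norm v)"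
    if K: "compact K" and e: "e > 0" for x0 K e
  proof -
    let ?n = "real DIM(real ^ 'm)"
    have "\<exists>d>0. \<forall>x z. dist x x0 < d \<longrightarrow> dist x x0 \<le> 1 \<longrightarrow> z \<in> K \<longrightarrow> \<bar>D x z b - D x0 z b\<bar> < e / ?n" for b
    proof -
      have "uniformly_continuous_on (cball x0 1 \<times> K) (\<lambda>(x, z). D x z b)"
        by (intro compact_uniformly_continuous compact_Times compact_cball K
            continuous_on_subset[OF D_cont]) simp
      from this[unfolded uniformly_continuous_on_def, rule_format, of "e / ?n"] e
      obtain d where d: "d > 0" "\<forall>y\<in>cball x0 1 \<times> K. \<forall>y'\<in>cball x0 1 \<times> K. dist y' y < d \<longrightarrow>
          dist (case y' of (x, z) \<Rightarrow> D x z b) (case y of (x, z) \<Rightarrow> D x z b) < e / ?n"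
        by (simp only: zero_less_divide_iff of_nat_0_less_iff DIM_positive) blast
      show ?thesis
      proof (intro exI[of _ d] conjI allI impI)
        fix x z assume "dist x x0 < d" "dist x x0 \<le> 1" "z \<in> K"
        then show "\<bar>D x z b - D x0 z b\<bar> < e / ?n"
          using d(2)[rule_format, of "(x0, z)" "(x, z)"] by (simp add: dist_commute dist_Pair_Pair dist_real_def)
      qed (rule d(1))
    qed
    then have "\<exists>d. \<forall>b. d b > 0 \<and>
        (\<forall>x z. dist x x0 < d b \<longrightarrow> dist x x0 \<le> 1 \<longrightarrow> z \<in> K \<longrightarrow> \<bar>D x z b - D x0 z b\<bar> < e / ?n)"
      by (intro choice allI)
    then obtain d where d: "\<And>b. d b > 0"
      "\<And>b x z. dist x x0 < d b \<Longrightarrow> dist x x0 \<le> 1 \<Longrightarrow> z \<in> K \<Longrightarrow> \<bar>D x z b - D x0 z b\<bar> < e / ?n"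
      by blast
    define d' where "d' = Min (insert 1 (d ` Basis))"
    have d': "d' > 0" "d' \<le> 1" "\<And>b. b \<in> Basis \<Longrightarrow> d' \<le> d b"
      using d(1) by (auto simp: d'_def intro: min.coboundedI2)
    have "\<bar>D x z v - D x0 z v\<bar> \<le> e * norm v" if x: "dist x x0 < d'" and z: "z \<in> K" for x z v
    proof -
      have exp: "D x z v = (\<Sum>b\<in>Basis. (v \<bullet> b) *\<^sub>R D x z b)" for x
      proof -
        have "D x z (\<Sum>b\<in>Basis. (v \<bullet> b) *\<^sub>R b) = (\<Sum>b\<in>Basis. (v \<bullet> b) *\<^sub>R D x z b)"
          by (simp only: linear_sum[OF lin] linear_cmul[OF lin])
        then show ?thesis by (simp only: euclidean_representation)
      qed
      have "D x z v - D x0 z v = (\<Sum>b\<in>Basis. (v \<bullet> b) * (D x z b - D x0 z b))"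
        by (subst (1 2) exp) (simp add: sum_subtractf right_diff_distrib)
      also have "\<bar>\<dots>\<bar> \<le> (\<Sum>b\<in>(Basis :: (real ^ 'm) set). norm v * (e / ?n))"
      proof (rule order_trans[OF sum_abs sum_mono])
        fix b :: "real ^ 'm" assume b: "b \<in> Basis"
        have "\<bar>D x z b - D x0 z b\<bar> \<le> e / ?n"
          using d(2)[of x b z] d'(2) d'(3)[OF b] x z by linarith
        then show "\<bar>v \<bullet> b * (D x z b - D x0 z b)\<bar> \<le> norm v * (e / ?n)"
          unfolding abs_mult using Basis_le_norm[OF b, of v] by (intro mult_mono) auto
      qed
      finally show ?thesis by (simp add: mult.commute)
    qed
    then show ?thesis using d'(1,2) by blast
  qed
  have supp': "\<exists>K. compact K \<and> (\<forall>x z. dist x x0 < 1 \<longrightarrow> z \<notin> K \<longrightarrow> \<Psi> (x, z) = 0) \<and>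
      (\<forall>x z v. dist x x0 < 1 \<longrightarrow> z \<notin> K \<longrightarrow> D x z v = 0)" for x0
  proof -
    from supp[of x0] obtain K where K: "compact K" "\<forall>x z. dist x x0 < 1 \<longrightarrow> z \<notin> K \<longrightarrow> \<Psi> (x, z) = 0"
      by (elim exE conjE)
    have "D x z v = 0" if "dist x x0 < 1" "z \<notin> K" for x z v
      by (rule D_0[where K = K, OF _ that]) (rule K(2)[rule_format])
    then have "\<forall>x z v. dist x x0 < 1 \<longrightarrow> z \<notin> K \<longrightarrow> D x z v = 0"
      by (intro allI impI)
    with K show ?thesis
      by (intro exI[of _ K] conjI)
  qed
  have integrable: "integrable lebesgue (\<lambda>z. \<Psi> (x, z) * w z)"
    "integrable lebesgue (\<lambda>z. D x z v * w z)" for x v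
  proof -
    obtain K where K: "compact K" "\<forall>y z. dist y x < 1 \<longrightarrow> z \<notin> K \<longrightarrow> \<Psi> (y, z) = 0"
      "\<forall>y z v. dist y x < 1 \<longrightarrow> z \<notin> K \<longrightarrow> D y z v = 0"
      using supp'[of x] by (elim exE conjE)
    show "integrable lebesgue (\<lambda>z. \<Psi> (x, z) * w z)" "integrable lebesgue (\<lambda>z. D x z v * w z)"
      by (rule integrable_continuous_mult[OF w _ K(1)]; use K \<Psi>_cont2 D_cont2 in simp)+
  qed
  \<comment> \<open>One estimate serves both claims: its first half is the continuity of the
    derivative, its second half the differentiability at \<open>x0\<close>.\<close>
  have est: "\<exists>d>0. d \<le> 1 \<and> (\<forall>x. dist x x0 < d \<longrightarrow>
      (\<forall>v. \<bar>?f' x v - ?f' x0 v\<bar> \<le> e * norm v) \<and> \<bar>?f x - ?f x0 - ?f' x0 (x - x0)\<bar> \<le> e * norm (x - x0))"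
    if e: "e > 0" for x0 e
  proof -
    obtain K where K: "compact K" "\<And>x z. dist x x0 < 1 \<Longrightarrow> z \<notin> K \<Longrightarrow> \<Psi> (x, z) = 0"
      "\<And>x z v. dist x x0 < 1 \<Longrightarrow> z \<notin> K \<Longrightarrow> D x z v = 0"
      using supp'[of x0] by (elim exE conjE) simp
    define W where "W = (LINT z:K|lebesgue. \<bar>w z\<bar>)"
    have W: "W \<ge> 0"
      by (simp add: W_def set_lebesgue_integral_def)
    define e' where "e' = e / (W + 1)"
    have e': "e' > 0" "e' * W \<le> e"
      using e W by (auto simp: e'_def field_simps)
    obtain d where d: "d > 0" "d \<le> 1"
      "\<And>x z v. dist x x0 < d \<Longrightarrow> z \<in> K \<Longrightarrow> \<bar>D x z v - D x0 z v\<bar> \<le> e' * norm v"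
      using unif[OF K(1) e'(1), of x0] by blast
    show ?thesis
    proof (intro exI[of _ d] conjI allI impI d(1,2))
      fix x assume x: "dist x x0 < d"
      have x1: "dist x x0 < 1" using x d(2) by linarith
      show "\<bar>?f' x v - ?f' x0 v\<bar> \<le> e * norm v" for v
      proof -
        have "?f' x v - ?f' x0 v = (LINT z|lebesgue. (D x z v - D x0 z v) * w z)"
          using integrable by (simp add: left_diff_distrib)
        also have "\<bar>\<dots>\<bar> \<le> (e' * norm v) * W"
          unfolding W_def
          by (rule integral_continuous_mult_bound[OF w _ K(1)])
            (use x x1 d K D_cont2 in \<open>auto intro: continuous_on_diff\<close>)
        also have "\<dots> \<le> e * norm v"
          using mult_right_mono[OF e'(2), of "norm v"] by (simp add: mult_ac)
        finally show ?thesis .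
      qed
      show "\<bar>?f x - ?f x0 - ?f' x0 (x - x0)\<bar> \<le> e * norm (x - x0)"
      proof -
        have "?f x - ?f x0 - ?f' x0 (x - x0) =
            (LINT z|lebesgue. (\<Psi> (x, z) - \<Psi> (x0, z) - D x0 z (x - x0)) * w z)"
          using integrable by (simp add: left_diff_distrib)
        also have "\<bar>\<dots>\<bar> \<le> (e' * norm (x - x0)) * W"
          unfolding W_def
        proof (rule integral_continuous_mult_bound[OF w _ K(1)])
          show "continuous_on UNIV (\<lambda>z. \<Psi> (x, z) - \<Psi> (x0, z) - D x0 z (x - x0))"
            by (intro continuous_on_diff \<Psi>_cont2 D_cont2)
          show "\<Psi> (x, z) - \<Psi> (x0, z) - D x0 z (x - x0) = 0" if "z \<notin> K" for z
            using K(2)[OF x1 that] K(2)[of x0 z] K(3)[of x0 z] that by simp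
          fix z assume z: "z \<in> K"
          have "norm (\<Psi> (x, z) - \<Psi> (x0, z) - D x0 z (x - x0)) \<le> norm (x - x0) * e'"
          proof (rule differentiable_bound_linearization[where S = "ball x0 d"])
            show "x0 + t *\<^sub>R (x - x0) \<in> ball x0 d" if "t \<in> {0..1}" for t
            proof -
              have "norm (t *\<^sub>R (x - x0)) \<le> norm (x - x0)"
                using that by (simp add: mult_left_le_one_le)
              then show ?thesis
                using x by (simp add: dist_norm norm_minus_commute)
            qed
            show "((\<lambda>x. \<Psi> (x, z)) has_derivative D y z) (at y within ball x0 d)" for y
              using der by (rule has_derivative_at_withinI)
            show "onorm (D y z - D x0 z) \<le> e'" if "y \<in> ball x0 d" for y
              by (rule onorm_bound) (use e' d(3)[of y z] that z in \<open>auto simp: dist_commute\<close>)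
          qed (use d in simp)
          then show "\<bar>\<Psi> (x, z) - \<Psi> (x0, z) - D x0 z (x - x0)\<bar> \<le> e' * norm (x - x0)"
            by (simp add: mult.commute)
        qed
        also have "\<dots> \<le> e * norm (x - x0)"
          using mult_right_mono[OF e'(2), of "norm (x - x0)"] by (simp add: mult_ac)
        finally show ?thesis .
      qed
    qed
  qed
  have lin': "linear (?f' x)" for x
  proof (rule linearI)
    show "?f' x (v + v') = ?f' x v + ?f' x v'" for v v'
      using integrable by (simp add: linear_add[OF lin] distrib_right)
    show "?f' x (c *\<^sub>R v) = c *\<^sub>R ?f' x v" for c v
      using integral_mult_right_zero[of lebesgue c "\<lambda>z. D x z v * w z"]
      by (simp add: linear_cmul[OF lin] mult.assoc)
  qed
  have *: "(?f has_derivative ?f' x) (at x)" for x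
    unfolding has_derivative_at_alt
  proof (intro conjI allI impI)
    show "bounded_linear (?f' x)"
      using lin' by (simp add: linear_conv_bounded_linear)
    fix e :: real assume "e > 0"
    from est[OF this, of x] show "\<exists>d>0. \<forall>y. norm (y - x) < d \<longrightarrow>
        norm (?f y - ?f x - ?f' x (y - x)) \<le> e * norm (y - x)"
      unfolding dist_norm real_norm_def by blast
  qed
  then show "(?f has_derivative ?f' x) (at x)" .
  have "continuous_on UNIV (\<lambda>x. ?f' x v)" for v
    unfolding continuous_on_iff
  proof (intro ballI allI impI)
    fix x0 and e :: real assume e: "e > 0"
    then have "e / (norm v + 1) > 0"
      by (simp add: add_nonneg_pos)
    from est[OF this, of x0] obtain d where d: "d > 0"
      "\<And>x. dist x x0 < d \<Longrightarrow> \<bar>?f' x v - ?f' x0 v\<bar> \<le> e / (norm v + 1) * norm v"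
      by blast
    have "e / (norm v + 1) * norm v < e"
      using e by (simp add: pos_divide_less_eq add_nonneg_pos distrib_left)
    then show "\<exists>d>0. \<forall>x\<in>UNIV. dist x x0 < d \<longrightarrow> dist (?f' x v) (?f' x0 v) < e"
      unfolding dist_real_def by (intro exI[of _ d]) (auto intro: le_less_trans[OF d(2)] d(1))
  qed
  moreover have "frechet_derivative ?f (at x) = ?f' x" for x
    by (rule frechet_derivative_at[OF *, symmetric])
  moreover have "?f differentiable (at x)" for x
    using * unfolding differentiable_def by blast
  ultimately show "Ck 1 ?f"
    by (simp only: One_nat_def Ck.simps simp_thms)
qed

section \<open>Mollification by convolution on the group\<close>

text \<open>Young's inequality for the product of \<kappa>^(1/q) a and \<kappa>^(-1/q) b, with the
  factors 1/q and 1/p estimated by one. The free parameter allows one of the two terms to be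
  absorbed or made small.\<close>

lemma Young_scaled:
  fixes p q a b \<kappa> :: real
  assumes p: "p > 1" and pq: "1 / p + 1 / q = 1" and ab: "a \<ge> 0" "b \<ge> 0" and l: "\<kappa> > 0"
  shows "a * b \<le> \<kappa> * a powr q + \<kappa> powr (1 - p) * b powr p"
proof -
  have q: "q > 1"
  proof -
    have "1 / q = (p - 1) / p"
      using p pq by (simp add: field_simps)
    then have "q = p / (p - 1)"
      using p by (metis inverse_eq_divide inverse_inverse_eq inverse_divide)
    then show ?thesis using p by simp
  qed
  have pq': "p / q = p - 1"
    using p q pq by (simp add: field_simps)
  let ?s = "\<kappa> powr (1 / q)"
  have s: "?s > 0" using l by simp
  have "a * b = (?s * a) * (b / ?s)"
    using s by simp
  also have "\<dots> \<le> (?s * a) powr q / q + (b / ?s) powr p / p"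
    using Youngs_inequality[OF q p, of "?s * a" "b / ?s"] pq ab s by (simp add: add.commute)
  also have "(?s * a) powr q = \<kappa> * a powr q"
    using q l ab by (simp add: powr_mult powr_powr)
  also have "(b / ?s) powr p = \<kappa> powr (1 - p) * b powr p"
  proof -
    have "?s powr p = \<kappa> powr (p - 1)"
      using pq' by (simp add: powr_powr)
    then have "(b / ?s) powr p = b powr p / \<kappa> powr (p - 1)"
      using ab s by (simp add: powr_divide)
    also have "\<dots> = \<kappa> powr (1 - p) * b powr p"
      using powr_minus_divide[of \<kappa> "p - 1"] by simp
    finally show ?thesis .
  qed
  also have "\<kappa> * a powr q / q + \<kappa> powr (1 - p) * b powr p / p \<le>
      \<kappa> * a powr q / 1 + \<kappa> powr (1 - p) * b powr p / 1"
    using p q l by (intro add_mono divide_left_mono mult_nonneg_nonneg) auto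
  finally show ?thesis by simp
qed

lemma powr_add_le:
  fixes a b p :: real
  assumes "a \<ge> 0" "b \<ge> 0" "p \<ge> 0"
  shows "(a + b) powr p \<le> 2 powr p * (a powr p + b powr p)"
proof -
  have "(a + b) powr p \<le> (2 * max a b) powr p"
    using assms by (intro powr_mono2) auto
  also have "\<dots> = 2 powr p * max a b powr p"
    by (simp add: powr_mult)
  also have "\<dots> \<le> 2 powr p * (a powr p + b powr p)"
    by (intro mult_left_mono) (auto simp: max_def)
  finally show ?thesis .
qed

text \<open>\<open>w\<close> is truncated, and so are continuous functions converging to it almost
  everywhere. The truncation supplies the dominating function in the second passage to the limit,
  where the approximants themselves have no common bound.\<close>

lemma Lp_loc_approx_continuous:
  fixes w :: "real ^ 'n::finite \<Rightarrow> real"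
  assumes w: "Lp_loc p w" and p: "p \<ge> 1" and K: "compact K" and \<delta>: "\<delta> > 0"
  obtains g where "continuous_on UNIV g"
    "integrable lebesgue (\<lambda>x. indicator K x * \<bar>w x - g x\<bar> powr p)"
    "(LINT x|lebesgue. indicator K x * \<bar>w x - g x\<bar> powr p) < \<delta>"
proof -
  have wm [measurable]: "w \<in> borel_measurable lebesgue"
    using w by (simp add: Lp_loc_def)
  have Km [measurable]: "K \<in> sets lebesgue"
    using K by (intro fmeasurableD lmeasurable_compact)
  have cm: "g \<in> borel_measurable lebesgue" if "continuous_on UNIV g" for g :: "real ^ 'n \<Rightarrow> real"
    using that by (intro measurable_completion) (simp add: borel_measurable_continuous_onI)
  define clip where "clip M t = max (- M) (min M t)" for M t :: real
  have clipm [measurable]: "(\<lambda>x. clip M (h x)) \<in> borel_measurable lebesgue"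
    if "h \<in> borel_measurable lebesgue" for M and h :: "real ^ 'n \<Rightarrow> real"
    using that unfolding clip_def by measurable
  have c: "2 powr p > 0" by simp
  have wp: "integrable lebesgue (\<lambda>x. indicator K x * \<bar>w x\<bar> powr p)"
    using w K unfolding Lp_loc_def set_integrable_def by simp
  have lim1: "(\<lambda>n. LINT x|lebesgue. indicator K x * \<bar>w x - clip (real n) (w x)\<bar> powr p) \<longlonglongrightarrow>
      (LINT x|(lebesgue :: (real ^ 'n) measure). 0)"
  proof (rule integral_dominated_convergence[OF _ _ wp])
    show "AE x in lebesgue. (\<lambda>n. indicator K x * \<bar>w x - clip (real n) (w x)\<bar> powr p) \<longlonglongrightarrow> 0"
    proof (intro AE_I2 tendsto_eventually)
      fix x
      show "\<forall>\<^sub>F n in sequentially. indicator K x * \<bar>w x - clip (real n) (w x)\<bar> powr p = 0"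
        using eventually_ge_at_top[of "nat \<lceil>\<bar>w x\<bar>\<rceil>"]
      proof eventually_elim
        case (elim n)
        then have "\<bar>w x\<bar> \<le> real n" by linarith
        then have "clip (real n) (w x) = w x" by (auto simp: clip_def)
        then show ?case by simp
      qed
    qed
    show "AE x in lebesgue. norm (indicator K x * \<bar>w x - clip (real n) (w x)\<bar> powr p)
        \<le> indicator K x * \<bar>w x\<bar> powr p" for n
      using p by (intro AE_I2) (auto simp: abs_mult clip_def intro!: mult_left_mono powr_mono2)
  qed measurable
  \<comment> \<open>The two errors are recombined by \<open>powr_add_le\<close> at the price of
    \<open>2 powr p\<close>, so each may use half of \<open>\<delta>\<close> divided by that
    factor.\<close>
  then obtain M :: nat where M: "(LINT x|lebesgue. indicator K x * \<bar>w x - clip (real M) (w x)\<bar> powr p) < \<delta> / 2 / 2 powr p"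
    using order_tendstoD(2)[OF lim1, of "\<delta> / 2 / 2 powr p"] \<delta> by (auto simp: eventually_sequentially)
  have i1: "integrable lebesgue (\<lambda>x. indicator K x * \<bar>w x - clip (real M) (w x)\<bar> powr p)"
    by (rule Bochner_Integration.integrable_bound[OF wp])
      (use p in \<open>auto simp: abs_mult clip_def intro!: mult_left_mono powr_mono2\<close>)
  obtain N gs where N: "negligible N" and gs: "\<And>n. continuous_on UNIV (gs n)"
    "\<And>x. x \<notin> N \<Longrightarrow> (\<lambda>n. gs n x) \<longlonglongrightarrow> w x"
    using lebesgue_measurable_imp_measurable_on[OF wm, of UNIV] unfolding measurable_on_def by auto
  have gc: "continuous_on UNIV (\<lambda>x. clip M (gs n x))" for n M
    unfolding clip_def by (intro continuous_on_max continuous_on_min continuous_on_const gs)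
  have bd: "integrable lebesgue (\<lambda>x. (2 * real M) powr p * indicator K x)"
    using K lmeasurable_compact[OF K] by (intro integrable_mult_right) (simp add: lmeasurable_iff_integrable)
  have le2: "norm (indicator K x * \<bar>clip (real M) (w x) - clip (real M) t\<bar> powr p)
      \<le> (2 * real M) powr p * indicator K x" for x t
    using p by (auto simp: clip_def indicator_def intro!: powr_mono2)
  have m2: "(\<lambda>x. indicator K x * \<bar>clip (real M) (w x) - clip (real M) (gs n x)\<bar> powr p) \<in> borel_measurable lebesgue" for n
    using cm[OF gc[of "real M" n]] by measurable
  have lim2: "(\<lambda>n. LINT x|lebesgue. indicator K x * \<bar>clip (real M) (w x) - clip (real M) (gs n x)\<bar> powr p) \<longlonglongrightarrow>
      (LINT x|(lebesgue :: (real ^ 'n) measure). 0)"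
  proof (rule integral_dominated_convergence[OF _ m2 bd])
    have "AE x in lebesgue. x \<notin> N"
      using N by (simp add: negligible_iff_null_sets AE_not_in)
    then show "AE x in lebesgue. (\<lambda>n. indicator K x * \<bar>clip (real M) (w x) - clip (real M) (gs n x)\<bar> powr p) \<longlonglongrightarrow> 0"
    proof eventually_elim
      case (elim x)
      have "(\<lambda>n. indicator K x * \<bar>clip (real M) (w x) - clip (real M) (gs n x)\<bar> powr p)
          \<longlonglongrightarrow> indicator K x * \<bar>clip (real M) (w x) - clip (real M) (w x)\<bar> powr p"
        unfolding clip_def
        by (rule tendsto_mult[OF tendsto_const tendsto_powr'[OF tendsto_rabs[OF tendsto_diff[OF tendsto_const
                tendsto_max[OF tendsto_const tendsto_min[OF tendsto_const gs(2)[OF elim]]]]] tendsto_const]])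
          (use p in auto)
      then show ?case by simp
    qed
    show "AE x in lebesgue. norm (indicator K x * \<bar>clip (real M) (w x) - clip (real M) (gs n x)\<bar> powr p)
        \<le> (2 * real M) powr p * indicator K x" for n
      by (intro AE_I2 le2)
  qed simp
  then obtain n where n: "(LINT x|lebesgue. indicator K x * \<bar>clip (real M) (w x) - clip (real M) (gs n x)\<bar> powr p)
      < \<delta> / 2 / 2 powr p"
    using order_tendstoD(2)[OF lim2, of "\<delta> / 2 / 2 powr p"] \<delta> by (auto simp: eventually_sequentially)
  have i2: "integrable lebesgue (\<lambda>x. indicator K x * \<bar>clip (real M) (w x) - clip (real M) (gs n x)\<bar> powr p)"
    by (rule Bochner_Integration.integrable_bound[OF bd m2]) (intro AE_I2 order_trans[OF le2], simp)
  define g where "g x = clip (real M) (gs n x)" for x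
  let ?b = "\<lambda>x. 2 powr p * (indicator K x * \<bar>w x - clip (real M) (w x)\<bar> powr p
      + indicator K x * \<bar>clip (real M) (w x) - g x\<bar> powr p)"
  have ib: "integrable lebesgue ?b"
    using i1 i2 by (auto simp: g_def)
  have le: "indicator K x * \<bar>w x - g x\<bar> powr p \<le> ?b x" for x
  proof -
    have "\<bar>w x - g x\<bar> powr p \<le> (\<bar>w x - clip (real M) (w x)\<bar> + \<bar>clip (real M) (w x) - g x\<bar>) powr p"
      using p by (intro powr_mono2) auto
    also have "\<dots> \<le> 2 powr p * (\<bar>w x - clip (real M) (w x)\<bar> powr p + \<bar>clip (real M) (w x) - g x\<bar> powr p)"
      using p by (intro powr_add_le) auto
    finally show ?thesis
      by (auto simp: indicator_def)
  qed
  have gcont: "continuous_on UNIV g"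
    using gc by (simp add: g_def[abs_def])
  have [measurable]: "g \<in> borel_measurable lebesgue"
    by (rule cm[OF gcont])
  have i: "integrable lebesgue (\<lambda>x. indicator K x * \<bar>w x - g x\<bar> powr p)"
    by (rule Bochner_Integration.integrable_bound[OF ib])
      (measurable, intro AE_I2, use le in \<open>simp add: abs_mult order_trans[OF _ abs_ge_self]\<close>)
  have "(LINT x|lebesgue. indicator K x * \<bar>w x - g x\<bar> powr p) \<le> (LINT x|lebesgue. ?b x)"
    by (intro integral_mono i ib le)
  also have "\<dots> = 2 powr p * ((LINT x|lebesgue. indicator K x * \<bar>w x - clip (real M) (w x)\<bar> powr p)
      + (LINT x|lebesgue. indicator K x * \<bar>clip (real M) (w x) - g x\<bar> powr p))"
    using i1 i2 by (simp add: g_def)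
  also have "\<dots> < 2 powr p * (\<delta> / 2 / 2 powr p + \<delta> / 2 / 2 powr p)"
    using M n c by (intro mult_strict_left_mono add_strict_mono) (auto simp: g_def)
  also have "\<dots> = \<delta>"
    using c by (simp add: field_simps)
  finally show thesis
    using that gcont i by blast
qed

lemma sigma_finite_lebesgue: "sigma_finite_measure (lebesgue :: 'a::euclidean_space measure)"
proof
  obtain A :: "'a set set" where A: "countable A" "A \<subseteq> sets lborel" "\<Union>A = space lborel"
    "\<forall>a\<in>A. emeasure lborel a \<noteq> \<infinity>"
    using lborel.sigma_finite_countable by blast
  then show "\<exists>A :: 'a set set. countable A \<and> A \<subseteq> sets lebesgue \<and> \<Union>A = space lebesgue \<and>
      (\<forall>a\<in>A. emeasure lebesgue a \<noteq> \<infinity>)"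
    by (intro exI[of _ A]) auto
qed

section \<open>Group convolution and its horizontal gradient\<close>

context homogeneous_carnot_group
begin

text \<open>The group convolution of \<open>\<rho>\<close> with \<open>w\<close>. With y = x o z^-1
  it averages the left translates w(y^-1 o x), and left translations commute with left-invariant
  fields; a kernel in z^-1 o x would average right translates.\<close>

definition moll :: "(real ^ 'n \<Rightarrow> real) \<Rightarrow> (real ^ 'n \<Rightarrow> real) \<Rightarrow> real ^ 'n \<Rightarrow> real" where
  "moll \<rho> w x = (LINT z|lebesgue. \<rho> (gmult x (ginv z)) * w z)"

text \<open>The points z for which x o z^-1 lies in the closed Euclidean unit ball for some x in
  \<open>K\<close>. Values of \<open>w\<close> outside this set do not influence its mollification
  on \<open>K\<close>.\<close>

definition reach :: "(real ^ 'n) set \<Rightarrow> (real ^ 'n) set" where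
  "reach K = (\<lambda>(y, x). gmult (ginv y) x) ` (cball 0 1 \<times> K)"

lemma continuous_ginv_gmult: "continuous_on UNIV (\<lambda>(y, x). gmult (ginv y) x)"
  using smooth_continuous[OF smooth_gmult[OF smooth_ginv[OF smooth_fst] smooth_snd]]
  by (simp add: case_prod_unfold)

lemma compact_reach: "compact K \<Longrightarrow> compact (reach K)"
  unfolding reach_def
  by (intro compact_continuous_image compact_Times compact_cball continuous_on_subset[OF continuous_ginv_gmult])
    auto

lemma recover: "gmult (ginv (gmult x (ginv z))) x = z"
  by (metis assoc ginv_ginv ginv_gmult left_inverse right_neutral)

lemma in_reach: "x \<in> K \<Longrightarrow> norm (gmult x (ginv z)) \<le> 1 \<Longrightarrow> z \<in> reach K"
  unfolding reach_def
  by (rule image_eqI[of _ _ "(gmult x (ginv z), x)"]) (simp_all add: recover)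

lemma subset_reach: "K \<subseteq> reach K"
  using in_reach[where z = x and x = x for x] by (auto simp: right_inverse)

context
  fixes \<rho> :: "real ^ 'n \<Rightarrow> real"
  assumes \<rho>: "smooth \<rho>" and supp: "\<And>y. norm y \<ge> 1 \<Longrightarrow> \<rho> y = 0"
begin

lemma kernel_eq_0: "x \<in> K \<Longrightarrow> z \<notin> reach K \<Longrightarrow> \<rho> (gmult x (ginv z)) = 0"
  using in_reach supp by (meson le_cases)

lemma smooth_kernel: "smooth (\<lambda>(x, z). \<rho> (gmult x (ginv z)))"
  using smooth_compose[OF \<rho> smooth_gmult[OF smooth_fst smooth_ginv[OF smooth_snd]]]
  by (simp add: case_prod_unfold)

lemma smooth_kernel_right: "smooth (\<lambda>z. \<rho> (gmult x (ginv z)))"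
  by (rule smooth_compose[OF \<rho> smooth_gmult[OF smooth_const smooth_ginv[OF smooth_ident]]])

lemma smooth_kernel_left: "smooth (\<lambda>x. \<rho> (gmult x (ginv z)))"
  by (rule smooth_compose[OF \<rho> smooth_gmult[OF smooth_ident smooth_const]])

lemma compactly_supported_kernel: "compactly_supported (\<lambda>z. \<rho> (gmult x (ginv z)))"
proof -
  have "{z. \<rho> (gmult x (ginv z)) \<noteq> 0} \<subseteq> reach {x}"
    using kernel_eq_0[of x "{x}"] by auto
  moreover have "bounded (reach {x})"
    by (simp add: compact_imp_bounded compact_reach)
  ultimately show ?thesis
    unfolding compactly_supported_def compact_closure by (rule bounded_subset[rotated])
qed

lemma integrable_kernel: "Lp_loc 1 w \<Longrightarrow> integrable lebesgue (\<lambda>z. \<rho> (gmult x (ginv z)) * w z)"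
  by (rule integrable_continuous_mult[where K = "reach {x}"])
    (simp_all add: smooth_continuous[OF smooth_kernel_right] compact_reach kernel_eq_0[of x "{x}"])

lemma moll_support: "\<exists>K. compact K \<and> (\<forall>x z. dist x x0 < 1 \<longrightarrow> z \<notin> K \<longrightarrow>
    (case (x, z) of (x, z) \<Rightarrow> \<rho> (gmult x (ginv z))) = 0)"
  by (intro exI[of _ "reach (cball x0 1)"] conjI allI impI)
    (simp_all add: compact_reach, rule kernel_eq_0[of _ "cball x0 1"], simp_all add: dist_commute)

lemma Ck_1_moll: "Lp_loc 1 w \<Longrightarrow> Ck 1 (moll \<rho> w)"
  using Ck_1_integral_kernel(2)[OF smooth_kernel _ moll_support, of w] by (simp add: moll_def[abs_def])

text \<open>The derivative falls on the kernel as a function of \<open>x\<close>.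
  \<open>X_right_convolution_kernel\<close> turns it into minus the derivative in \<open>z\<close>,
  which is the formal adjoint because the fields are skew-adjoint; the kernel is then an admissible
  test function of \<open>z\<close> for the weak gradient.\<close>

lemma grad_L_moll:
  assumes w: "Lp_loc 1 w" and G: "is_weak_grad_L X w G"
  shows "grad_L X (moll \<rho> w) x $ i = moll \<rho> (\<lambda>z. G z $ i) x"
proof -
  let ?\<Psi> = "\<lambda>(x, z). \<rho> (gmult x (ginv z))"
  let ?D = "\<lambda>z v. frechet_derivative ?\<Psi> (at (x, z)) (v, 0)"
  let ?\<phi> = "\<lambda>z. \<rho> (gmult x (ginv z))"
  have "(moll \<rho> w has_derivative (\<lambda>v. LINT z|lebesgue. ?D z v * w z)) (at x)"
    using Ck_1_integral_kernel(1)[OF smooth_kernel w moll_support, of x] by (simp add: moll_def[abs_def])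
  from frechet_derivative_at[OF this, symmetric]
  have "grad_L X (moll \<rho> w) x $ i = (LINT z|lebesgue. ?D z (X i x) * w z)"
    by (simp add: grad_L_def)
  also have "\<dots> = (LINT z|lebesgue. w z * formal_adjoint (X i) ?\<phi> z)"
  proof (rule Bochner_Integration.integral_cong[OF refl])
    fix z :: "real ^ 'n"
    have "((\<lambda>x. (x, z)) has_derivative (\<lambda>v. (v, 0))) (at x)"
      by (intro has_derivative_Pair has_derivative_const has_derivative_ident)
    from has_derivative_compose[OF this, of ?\<Psi>] smooth_has_derivative[OF smooth_kernel, of "(x, z)"]
    have "((\<lambda>x. \<rho> (gmult x (ginv z))) has_derivative ?D z) (at x)"
      by simp
    from fun_cong[OF frechet_derivative_at[OF this], of "X i x"]
    have "?D z (X i x) = frechet_derivative (\<lambda>x. \<rho> (gmult x (ginv z))) (at x) (X i x)"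
      by simp
    also have "\<dots> = formal_adjoint (X i) ?\<phi> z"
      using formal_adjoint_eq[OF smooth_has_derivative[OF smooth_kernel_right]]
        X_right_convolution_kernel[OF \<rho>] by simp
    finally show "?D z (X i x) * w z = w z * formal_adjoint (X i) ?\<phi> z"
      by simp
  qed
  also have "\<dots> = (LINT z|lebesgue. G z $ i * ?\<phi> z)"
    using G smooth_kernel_right compactly_supported_kernel by (simp add: is_weak_grad_L_def)
  finally show ?thesis
    by (simp add: moll_def mult.commute)
qed

lemma moll_nonneg:
  assumes "\<And>y. \<rho> y \<ge> 0" "AE x in lebesgue. w x \<ge> 0"
  shows "moll \<rho> w x \<ge> 0"
  unfolding moll_def by (rule integral_nonneg_AE) (use assms(2) in eventually_elim, simp add: assms(1))

context
  assumes nonneg: "\<And>y. \<rho> y \<ge> 0" and total: "(\<integral>\<^sup>+ y. ennreal (\<rho> y) \<partial>lborel) = 1"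
begin

lemma \<rho>_measurable [measurable]: "\<rho> \<in> borel_measurable borel"
  using smooth_continuous[OF \<rho>] by (rule borel_measurable_continuous_onI)

text \<open>Mass one in \<open>z\<close> for fixed \<open>x\<close> rests on invariance under
  inversion and left translations; mass one in \<open>x\<close> for fixed \<open>z\<close>, in the
  companion lemma, rests on right translations.\<close>

lemma nn_integral_kernel_right: "(\<integral>\<^sup>+ z. ennreal (\<rho> (gmult x (ginv z))) \<partial>lebesgue) = 1"
proof -
  have m: "(\<lambda>z. gmult x (ginv z)) \<in> borel_measurable borel"
    by (intro borel_measurable_continuous_onI smooth_continuous smooth_gmult smooth_const smooth_ginv smooth_ident)
  have "1 = (\<integral>\<^sup>+ y. ennreal (\<rho> y) \<partial>distr lborel borel (\<lambda>z. gmult x (ginv z)))"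
    by (simp add: distr_lborel_left_ginv total)
  also have "\<dots> = (\<integral>\<^sup>+ z. ennreal (\<rho> (gmult x (ginv z))) \<partial>lborel)"
    using m by (subst nn_integral_distr) auto
  also have "\<dots> = (\<integral>\<^sup>+ z. ennreal (\<rho> (gmult x (ginv z))) \<partial>lebesgue)"
    by (rule nn_integral_completion[symmetric])
  finally show ?thesis by simp
qed

lemma nn_integral_kernel_left: "(\<integral>\<^sup>+ x. ennreal (\<rho> (gmult x (ginv z))) \<partial>lebesgue) = 1"
proof -
  have m: "(\<lambda>x. gmult x (ginv z)) \<in> borel_measurable borel"
    by (intro borel_measurable_continuous_onI smooth_continuous smooth_gmult smooth_const smooth_ident)
  have "1 = (\<integral>\<^sup>+ y. ennreal (\<rho> y) \<partial>distr lborel borel (\<lambda>x. gmult x (ginv z)))"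
    by (simp add: distr_lborel_right total)
  also have "\<dots> = (\<integral>\<^sup>+ x. ennreal (\<rho> (gmult x (ginv z))) \<partial>lborel)"
    using m by (subst nn_integral_distr) auto
  also have "\<dots> = (\<integral>\<^sup>+ x. ennreal (\<rho> (gmult x (ginv z))) \<partial>lebesgue)"
    by (rule nn_integral_completion[symmetric])
  finally show ?thesis by simp
qed

text \<open>The kernel is Borel on the product, and the identity from Lebesgue to Borel sets is
  measurable in each factor. The sigma-algebra here is the product of the two completions, as Fubini
  requires.\<close>

lemma kernel_measurable_pair [measurable]:
  "(\<lambda>(x, z). \<rho> (gmult x (ginv z))) \<in> borel_measurable (lebesgue \<Otimes>\<^sub>M lebesgue)"
proof -
  have id: "(\<lambda>x. x) \<in> lebesgue \<rightarrow>\<^sub>M (borel :: (real ^ 'n) measure)"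
    by (rule measurable_completion) simp
  have "(\<lambda>p. (fst p, snd p)) \<in> lebesgue \<Otimes>\<^sub>M lebesgue \<rightarrow>\<^sub>M (borel \<Otimes>\<^sub>M borel :: ((real ^ 'n) \<times> (real ^ 'n)) measure)"
    by (intro measurable_Pair measurable_compose[OF measurable_fst id] measurable_compose[OF measurable_snd id])
  then have p: "(\<lambda>p. p) \<in> lebesgue \<Otimes>\<^sub>M lebesgue \<rightarrow>\<^sub>M (borel :: ((real ^ 'n) \<times> (real ^ 'n)) measure)"
    by (simp add: borel_prod)
  show ?thesis
    by (rule measurable_compose[OF p borel_measurable_continuous_onI[OF smooth_continuous[OF smooth_kernel]]])
qed

lemma kernel_measurable_right [measurable]: "(\<lambda>z. \<rho> (gmult x (ginv z))) \<in> borel_measurable lebesgue"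
  using smooth_continuous[OF smooth_kernel_right]
  by (intro measurable_completion) (simp add: borel_measurable_continuous_onI)

lemma moll_diff_le:
  assumes w: "Lp_loc 1 w"
  shows "ennreal \<bar>moll \<rho> w x - w x\<bar> \<le>
    (\<integral>\<^sup>+ z. ennreal (\<rho> (gmult x (ginv z)) * \<bar>w z - w x\<bar>) \<partial>lebesgue)"
proof -
  let ?k = "\<lambda>z. \<rho> (gmult x (ginv z))"
  have k: "integrable lebesgue ?k"
    by (rule integrableI_nonneg) (simp_all add: nonneg nn_integral_kernel_right)
  have "(LINT z|lebesgue. ?k z) = 1"
    by (subst integral_eq_nn_integral) (simp_all add: nonneg nn_integral_kernel_right)
  then have "moll \<rho> w x - w x = (LINT z|lebesgue. ?k z * w z) - (LINT z|lebesgue. ?k z * w x)"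
    by (simp add: moll_def)
  also have "\<dots> = (LINT z|lebesgue. ?k z * (w z - w x))"
    using integrable_kernel[OF w] k by (simp add: right_diff_distrib)
  finally have "\<bar>moll \<rho> w x - w x\<bar> = norm (LINT z|lebesgue. ?k z * (w z - w x))"
    by simp
  moreover have "integrable lebesgue (\<lambda>z. ?k z * (w z - w x))"
    using integrable_kernel[OF w] k by (simp add: right_diff_distrib)
  ultimately have "ennreal \<bar>moll \<rho> w x - w x\<bar> \<le> (\<integral>\<^sup>+ z. ennreal (norm (?k z * (w z - w x))) \<partial>lebesgue)"
    using integral_norm_bound_ennreal[of lebesgue "\<lambda>z. ?k z * (w z - w x)"] by simp
  then show ?thesis
    by (simp add: abs_mult nonneg)
qed

text \<open>The kernel is a probability density in each variable: the term in \<open>x\<close>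
  integrates out at once, the term in \<open>z\<close> after exchanging the integrals.\<close>

lemma nn_integral_kernel_add_le:
  fixes b h :: "real ^ 'n \<Rightarrow> ennreal"
  assumes [measurable]: "b \<in> borel_measurable lebesgue" "h \<in> borel_measurable lebesgue"
  shows "(\<integral>\<^sup>+ x. (\<integral>\<^sup>+ z. ennreal (\<rho> (gmult x (ginv z))) * (b x + h z) \<partial>lebesgue) \<partial>lebesgue) \<le>
    (\<integral>\<^sup>+ x. b x \<partial>lebesgue) + (\<integral>\<^sup>+ z. h z \<partial>lebesgue)"
proof -
  let ?k = "\<lambda>x z. ennreal (\<rho> (gmult x (ginv z)))"
  interpret sigma_finite_measure "lebesgue :: (real ^ 'n) measure"
    by (rule sigma_finite_lebesgue)
  interpret pair_sigma_finite "lebesgue :: (real ^ 'n) measure" "lebesgue :: (real ^ 'n) measure" ..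
  have [measurable]: "(\<lambda>p. ?k (fst p) (snd p)) \<in> borel_measurable (lebesgue \<Otimes>\<^sub>M lebesgue)"
    using kernel_measurable_pair by (simp add: case_prod_unfold)
  have "(\<integral>\<^sup>+ z. ?k x z * (b x + h z) \<partial>lebesgue) = b x + (\<integral>\<^sup>+ z. ?k x z * h z \<partial>lebesgue)" for x
    by (simp add: distrib_left nn_integral_add nn_integral_multc nn_integral_kernel_right)
  moreover have "(\<lambda>x. \<integral>\<^sup>+ z. ?k x z * h z \<partial>lebesgue) \<in> borel_measurable lebesgue"
    by (rule sigma_finite_measure.borel_measurable_nn_integral[OF sigma_finite_lebesgue,
          where f = "\<lambda>x z. ?k x z * h z"]) (simp add: case_prod_unfold)
  ultimately have "(\<integral>\<^sup>+ x. (\<integral>\<^sup>+ z. ?k x z * (b x + h z) \<partial>lebesgue) \<partial>lebesgue) =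
      (\<integral>\<^sup>+ x. b x \<partial>lebesgue) + (\<integral>\<^sup>+ x. (\<integral>\<^sup>+ z. ?k x z * h z \<partial>lebesgue) \<partial>lebesgue)"
    by (simp add: nn_integral_add)
  also have "(\<integral>\<^sup>+ x. (\<integral>\<^sup>+ z. ?k x z * h z \<partial>lebesgue) \<partial>lebesgue) =
      (\<integral>\<^sup>+ z. (\<integral>\<^sup>+ x. ?k x z * h z \<partial>lebesgue) \<partial>lebesgue)"
    by (rule Fubini'[symmetric]) (simp add: case_prod_unfold)
  also have "\<dots> = (\<integral>\<^sup>+ z. h z \<partial>lebesgue)"
    by (simp add: nn_integral_multc nn_integral_kernel_left)
  finally show ?thesis by simp
qed

end

end

end

section \<open>Standard mollifiers and convergence of the mollifications\<close>

definition mollifier :: "nat \<Rightarrow> 'a::euclidean_space \<Rightarrow> real" where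
  "mollifier n y = bump (1 / real (Suc n)) y / (LINT y|lborel. bump (1 / real (Suc n)) (y :: 'a))"

lemma integrable_bump:
  assumes r: "r > 0"
  shows "integrable lborel (bump r :: 'a::euclidean_space \<Rightarrow> real)"
proof -
  have "integrable lborel (\<lambda>x::'a. indicator (cball 0 r) x *\<^sub>R bump r x)"
    using borel_integrable_compact[OF compact_cball continuous_on_subset[OF smooth_continuous[OF smooth_bump]]]
    by (simp add: indicator_scaleR_eq_if)
  moreover have "(\<lambda>x::'a. indicator (cball 0 r) x *\<^sub>R bump r x) = bump r"
    using bump_eq_0[OF r, where 'a = 'a] by (auto simp: indicator_def fun_eq_iff)
  ultimately show ?thesis by metis
qed

lemma integral_bump_pos:
  assumes r: "r > 0"
  shows "(LINT x|lborel. bump r (x :: 'a::euclidean_space)) > 0"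
proof -
  have "\<not> (AE x in lborel. bump r (x :: 'a) = 0)"
  proof
    assume "AE x in lborel. bump r (x :: 'a) = 0"
    then have "AE x in lborel. x \<notin> ball (0 :: 'a) r"
      by eventually_elim (simp flip: bump_pos_iff[OF r])
    then have "ball (0 :: 'a) r \<in> null_sets lborel"
      by (simp add: AE_iff_null_sets)
    then have "negligible (ball (0 :: 'a) r)"
      by (simp add: negligible_iff_null_sets null_sets_completionI)
    then show False
      using open_not_negligible[of "ball (0 :: 'a) r"] r by auto
  qed
  then have "(LINT x|lborel. bump r (x :: 'a)) \<noteq> 0"
    using integral_nonneg_eq_0_iff_AE[OF integrable_bump[OF r, where 'a = 'a]] by (simp add: bump_nonneg)
  moreover have "(LINT x|lborel. bump r (x :: 'a)) \<ge> 0"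
    by (intro Bochner_Integration.integral_nonneg bump_nonneg)
  ultimately show ?thesis by linarith
qed

lemma mollifier_nonneg: "mollifier n y \<ge> 0"
  using integral_bump_pos[of "1 / real (Suc n)"] by (simp add: mollifier_def bump_nonneg less_imp_le)

lemma mollifier_eq_0: "norm y \<ge> 1 / real (Suc n) \<Longrightarrow> mollifier n y = 0"
  by (simp add: mollifier_def bump_eq_0)

text \<open>The kernel lemmas ask for support in the unit ball, so that one set
  \<open>reach K\<close> serves for all \<open>n\<close>.\<close>

lemma mollifier_eq_0': "norm y \<ge> 1 \<Longrightarrow> mollifier n y = 0"
proof (rule mollifier_eq_0)
  assume "norm y \<ge> 1"
  moreover have "1 / real (Suc n) \<le> 1" by simp
  ultimately show "norm y \<ge> 1 / real (Suc n)" by linarith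
qed

lemma smooth_mollifier: "smooth (mollifier n)"
  unfolding mollifier_def[abs_def]
  by (rule smooth_compose[OF smooth_bounded_linear[OF bounded_linear_divide] smooth_bump])

lemma nn_integral_mollifier: "(\<integral>\<^sup>+ y. ennreal (mollifier n (y :: 'a::euclidean_space)) \<partial>lborel) = 1"
proof -
  let ?I = "LINT y|lborel. bump (1 / real (Suc n)) (y :: 'a)"
  have "?I > 0" by (rule integral_bump_pos) simp
  then have "(LINT y|lborel. mollifier n (y :: 'a)) = 1"
    by (simp add: mollifier_def)
  moreover have "integrable lborel (mollifier n :: 'a \<Rightarrow> real)"
    unfolding mollifier_def[abs_def] by (intro integrable_divide integrable_bump) simp
  ultimately show ?thesis
    using nn_integral_eq_integral[of lborel "mollifier n :: 'a \<Rightarrow> real"] by (simp add: mollifier_nonneg)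
qed

lemma tendsto_0_ennrealI:
  fixes f :: "nat \<Rightarrow> ennreal"
  assumes "\<And>\<eta>. \<eta> > 0 \<Longrightarrow> \<exists>n0. \<forall>n\<ge>n0. f n \<le> ennreal \<eta>"
  shows "f \<longlonglongrightarrow> 0"
proof (rule order_tendstoI)
  fix y :: ennreal assume "0 < y"
  then obtain z where z: "0 < z" "z < y"
    using dense by blast
  then have "z = ennreal (enn2real z)" "enn2real z > 0"
    using less_top_ennreal order_less_le_trans[OF z(2) top_greatest]
    by (auto simp: enn2real_positive_iff)
  with assms[of "enn2real z"] obtain n0 where "\<forall>n\<ge>n0. f n \<le> z"
    by metis
  with z(2) show "\<forall>\<^sub>F n in sequentially. f n < y"
    by (auto simp: eventually_sequentially intro: le_less_trans)
qed simp

context homogeneous_carnot_group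
begin

text \<open>Closeness is measured by y = x o z^-1. Since z = y^-1 o x, the two values of
  \<open>g\<close> are those of one function of (y, x) at y and at y = 0, and this function is
  uniformly continuous on a compact product.\<close>

lemma uniform_oscillation:
  fixes g :: "real ^ 'n \<Rightarrow> real"
  assumes g: "continuous_on UNIV g" and K: "compact K" and \<epsilon>: "\<epsilon> > 0"
  shows "\<exists>d>0. \<forall>x z. x \<in> K \<longrightarrow> norm (gmult x (ginv z)) < d \<longrightarrow> \<bar>g z - g x\<bar> \<le> \<epsilon>"
proof -
  let ?h = "\<lambda>p. g (case p of (y, x) \<Rightarrow> gmult (ginv y) x)"
  have "continuous_on (cball 0 1 \<times> K) ?h"
    by (rule continuous_on_compose2[OF g continuous_on_subset[OF continuous_ginv_gmult]]) auto
  then have "uniformly_continuous_on (cball 0 1 \<times> K) ?h"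
    by (intro compact_uniformly_continuous compact_Times compact_cball K)
  from this[unfolded uniformly_continuous_on_def, rule_format, OF \<epsilon>]
  obtain d where d: "d > 0" "\<forall>p\<in>cball 0 1 \<times> K. \<forall>p'\<in>cball 0 1 \<times> K. dist p' p < d \<longrightarrow> dist (?h p') (?h p) < \<epsilon>"
    by (elim exE conjE)
  show ?thesis
  proof (intro exI[of _ "min d 1"] conjI allI impI)
    fix x z assume x: "x \<in> K" and z: "norm (gmult x (ginv z)) < min d 1"
    let ?y = "gmult x (ginv z)"
    have "dist (?h (?y, x)) (?h (0, x)) < \<epsilon>"
      by (rule d(2)[rule_format]) (use x z in \<open>auto simp: dist_Pair_Pair\<close>)
    then show "\<bar>g z - g x\<bar> \<le> \<epsilon>"
      by (simp add: recover ginv_0 left_neutral dist_real_def)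
  qed (use d(1) in simp)
qed

text \<open>The weight \<open>a\<close> and the oscillation of \<open>w\<close> are separated by Young's inequality under the
  integral sign, so that no convexity inequality for the mollified function is needed.\<close>

lemma moll_tendsto:
  fixes a w :: "real ^ 'n \<Rightarrow> real"
  assumes p: "p > 1" and pq: "1 / p + 1 / q = 1" and K: "compact K"
    and a: "a \<in> borel_measurable lebesgue" "\<And>x. a x \<ge> 0"
      "integrable lebesgue (\<lambda>x. indicator K x * a x powr q)"
    and w: "Lp_loc p w"
  shows "(\<lambda>n. \<integral>\<^sup>+ x. ennreal (indicator K x * a x * \<bar>moll (mollifier n) w x - w x\<bar>) \<partial>lebesgue) \<longlonglongrightarrow> 0"
proof -
  have w1: "Lp_loc 1 w"
    using Lp_loc_imp_Lp_loc_1[OF w] p by simp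
  have q: "q > 1"
  proof -
    have "1 / q = 1 - 1 / p" using pq by simp
    moreover have "0 < 1 - 1 / p" "1 - 1 / p < 1" using p by auto
    ultimately show ?thesis
      by (metis less_divide_eq_1_pos zero_less_divide_1_iff divide_less_eq_1_pos)
  qed
  define K' where "K' = reach K"
  have K': "compact K'" "K \<subseteq> K'"
    using compact_reach[OF K] subset_reach[of K] by (auto simp: K'_def)
  have [measurable]: "w \<in> borel_measurable lebesgue" "a \<in> borel_measurable lebesgue"
    "K \<in> sets lebesgue" "K' \<in> sets lebesgue"
    using w a(1) K K'(1) by (auto simp: Lp_loc_def intro: fmeasurableD lmeasurable_compact)
  have Ki: "integrable lebesgue (indicator K :: _ \<Rightarrow> real)"
    using lmeasurable_compact[OF K] by (simp add: lmeasurable_iff_integrable)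
  define V where "V = (LINT x|lebesgue. indicator K x :: real)"
  define A where "A = (LINT x|lebesgue. indicator K x * a x powr q)"
  have VA: "V \<ge> 0" "A \<ge> 0"
    by (simp_all add: V_def A_def)
  have "\<exists>n0. \<forall>n\<ge>n0. (\<integral>\<^sup>+ x. ennreal (indicator K x * a x * \<bar>moll (mollifier n) w x - w x\<bar>) \<partial>lebesgue) \<le> ennreal \<eta>"
    if \<eta>: "\<eta> > 0" for \<eta>
  proof -
    \<comment> \<open>The budget is four quarters of \<open>\<eta>\<close>: one for the oscillation
      of \<open>g\<close> (\<open>\<epsilon>\<close>), one for the Young terms in the weight
      (\<open>\<kappa>\<close>), and two for the approximation error (\<open>\<delta>\<close>),
      which occurs once at \<open>x\<close> and once at \<open>z\<close>. The summand 1 keeps the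
      denominators positive.\<close>
    define \<epsilon> where "\<epsilon> = \<eta> / (4 * (V + A + 1))"
    define \<kappa> where "\<kappa> = \<eta> / (8 * (A + 1))"
    define C where "C = \<kappa> powr (1 - p)"
    define \<delta> where "\<delta> = \<eta> / (4 * C)"
    have pos: "\<epsilon> > 0" "\<kappa> > 0"
      using \<eta> VA by (auto simp: \<epsilon>_def \<kappa>_def)
    then have C: "C > 0" by (simp add: C_def)
    then have \<delta>: "\<delta> > 0" using \<eta> by (simp add: \<delta>_def)
    obtain g where g: "continuous_on UNIV g"
      "integrable lebesgue (\<lambda>x. indicator K' x * \<bar>w x - g x\<bar> powr p)"
      "(LINT x|lebesgue. indicator K' x * \<bar>w x - g x\<bar> powr p) < \<delta>"
      using Lp_loc_approx_continuous[OF w _ K'(1) \<delta>] p by auto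
    have [measurable]: "g \<in> borel_measurable lebesgue"
      using g(1) by (intro measurable_completion) (simp add: borel_measurable_continuous_onI)
    from uniform_oscillation[OF g(1) K pos(1)]
    obtain d where d: "d > 0" "\<forall>x z. x \<in> K \<longrightarrow> norm (gmult x (ginv z)) < d \<longrightarrow> \<bar>g z - g x\<bar> \<le> \<epsilon>"
      by (elim exE conjE)
    obtain n0 where n0: "1 / real (Suc n0) < d"
      using d(1) nat_approx_posE by blast
    \<comment> \<open>\<open>b x + h z\<close> dominates \<open>a x * \<bar>w z - w x\<bar>\<close>
      for \<open>x\<close> in \<open>K\<close> wherever the kernel is nonzero: \<open>h\<close> is
      the approximation error at \<open>z\<close>, and \<open>b\<close> gathers the error at
      \<open>x\<close>, the oscillation and the powers of the weight.\<close>
    define h where "h z = C * (indicator K' z * \<bar>w z - g z\<bar> powr p)" for z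
    define b where "b x = indicator K x * (\<epsilon> * (1 + a x powr q) + 2 * \<kappa> * a x powr q)
        + C * (indicator K' x * \<bar>w x - g x\<bar> powr p)" for x
    have nn: "h z \<ge> 0" "b z \<ge> 0" for z
      using pos C by (auto simp: h_def b_def)
    have [measurable]: "h \<in> borel_measurable lebesgue" "b \<in> borel_measurable lebesgue"
      unfolding h_def[abs_def] b_def[abs_def] by measurable
    have hi: "integrable lebesgue h"
      unfolding h_def[abs_def] by (intro integrable_mult_right g(2))
    have b_eq: "b = (\<lambda>x. \<epsilon> * indicator K x + (\<epsilon> + 2 * \<kappa>) * (indicator K x * a x powr q) + h x)"
      by (auto simp: b_def h_def fun_eq_iff algebra_simps)
    have bi: "integrable lebesgue b"
      unfolding b_eq by (intro Bochner_Integration.integrable_add integrable_mult_right Ki a(3) hi)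
    have Ih: "(LINT x|lebesgue. h x) \<le> \<eta> / 4"
    proof -
      have "(LINT x|lebesgue. h x) \<le> C * \<delta>"
        unfolding h_def using g(3) C by simp
      then show ?thesis using C by (simp add: \<delta>_def)
    qed
    have "(LINT x|lebesgue. b x) = \<epsilon> * V + (\<epsilon> + 2 * \<kappa>) * A + (LINT x|lebesgue. h x)"
      unfolding b_eq V_def A_def using Ki a(3) hi by simp
    also have "\<dots> \<le> \<eta> / 4 + \<eta> / 4 + \<eta> / 4"
    proof -
      have "\<epsilon> * (V + A) \<le> \<epsilon> * (V + A + 1)" using pos by simp
      also have "\<dots> = \<eta> / 4" using VA by (simp add: \<epsilon>_def field_simps)
      finally have 1: "\<epsilon> * (V + A) \<le> \<eta> / 4" .
      have "2 * \<kappa> * A \<le> 2 * \<kappa> * (A + 1)" using pos by simp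
      also have "\<dots> = \<eta> / 4" using VA by (simp add: \<kappa>_def field_simps)
      finally show ?thesis using 1 Ih by (simp add: algebra_simps)
    qed
    finally have Ib: "(LINT x|lebesgue. b x) \<le> 3 * \<eta> / 4" by simp
    show ?thesis
    proof (intro exI[of _ n0] allI impI)
      fix n assume n: "n \<ge> n0"
      have nd: "1 / real (Suc n) < d"
        using n n0 by (smt (verit) frac_le of_nat_0_less_iff of_nat_le_iff Suc_le_mono zero_less_Suc)
      let ?k = "\<lambda>x z. mollifier n (gmult x (ginv z))"
      have ptw: "ennreal (indicator K x * a x * \<bar>moll (mollifier n) w x - w x\<bar>) \<le>
          (\<integral>\<^sup>+ z. ennreal (?k x z) * (ennreal (b x) + ennreal (h z)) \<partial>lebesgue)" for x
      proof (cases "x \<in> K")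
        case True
        have *: "a x * \<bar>w z - w x\<bar> \<le> b x + h z" if z: "norm (gmult x (ginv z)) < 1 / real (Suc n)" for z
        proof -
          have "1 / real (Suc n) \<le> 1" by simp
          with z have "norm (gmult x (ginv z)) \<le> 1" by linarith
          then have z': "z \<in> K'"
            unfolding K'_def using True by (intro in_reach)
          have x': "x \<in> K'" using True K'(2) by blast
          have "\<bar>w z - w x\<bar> \<le> \<bar>w z - g z\<bar> + \<bar>w x - g x\<bar> + \<bar>g z - g x\<bar>" by linarith
          also have "\<bar>g z - g x\<bar> \<le> \<epsilon>"
            using d(2) True z nd by auto
          finally have "a x * \<bar>w z - w x\<bar> \<le> a x * (\<bar>w z - g z\<bar> + \<bar>w x - g x\<bar> + \<epsilon>)"
            using a(2) by (intro mult_left_mono) auto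
          also have "\<dots> = a x * \<bar>w z - g z\<bar> + a x * \<bar>w x - g x\<bar> + \<epsilon> * a x"
            by (simp add: algebra_simps)
          also have "\<dots> \<le> (\<kappa> * a x powr q + C * \<bar>w z - g z\<bar> powr p)
              + (\<kappa> * a x powr q + C * \<bar>w x - g x\<bar> powr p) + \<epsilon> * (1 + a x powr q)"
          proof (intro add_mono mult_left_mono)
            show "a x * \<bar>w z - g z\<bar> \<le> \<kappa> * a x powr q + C * \<bar>w z - g z\<bar> powr p"
              "a x * \<bar>w x - g x\<bar> \<le> \<kappa> * a x powr q + C * \<bar>w x - g x\<bar> powr p"
              unfolding C_def using Young_scaled[OF p pq a(2) _ pos(2)] by auto
            show "a x \<le> 1 + a x powr q"
            proof (cases "a x \<le> 1")
              case False
              then have "a x powr 1 \<le> a x powr q" using q by (intro powr_mono) auto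
              then show ?thesis using False by simp
            qed (use powr_ge_zero[of "a x" q] in linarith)
          qed (use pos in simp)
          also have "\<dots> = b x + h z"
            using True z' x' by (simp add: b_def h_def algebra_simps)
          finally show ?thesis .
        qed
        have "ennreal (indicator K x * a x * \<bar>moll (mollifier n) w x - w x\<bar>) =
            ennreal (a x) * ennreal \<bar>moll (mollifier n) w x - w x\<bar>"
          using True a(2) by (simp add: ennreal_mult)
        also have "\<dots> \<le> ennreal (a x) * (\<integral>\<^sup>+ z. ennreal (?k x z * \<bar>w z - w x\<bar>) \<partial>lebesgue)"
          by (intro mult_left_mono moll_diff_le smooth_mollifier mollifier_eq_0' mollifier_nonneg
              nn_integral_mollifier w1) auto
        also have "\<dots> = (\<integral>\<^sup>+ z. ennreal (a x) * ennreal (?k x z * \<bar>w z - w x\<bar>) \<partial>lebesgue)"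
        proof (rule nn_integral_cmult[symmetric])
          have [measurable]: "(\<lambda>z. ?k x z) \<in> borel_measurable lebesgue"
            by (rule kernel_measurable_right[OF smooth_mollifier mollifier_eq_0' mollifier_nonneg
                  nn_integral_mollifier])
          show "(\<lambda>z. ennreal (?k x z * \<bar>w z - w x\<bar>)) \<in> borel_measurable lebesgue"
            by measurable
        qed
        also have "\<dots> \<le> (\<integral>\<^sup>+ z. ennreal (?k x z) * (ennreal (b x) + ennreal (h z)) \<partial>lebesgue)"
        proof (rule nn_integral_mono)
          fix z
          have "ennreal (a x) * ennreal (?k x z * \<bar>w z - w x\<bar>) = ennreal (?k x z * (a x * \<bar>w z - w x\<bar>))"
            using a(2) mollifier_nonneg by (subst ennreal_mult[symmetric]) (auto simp: mult_ac intro!: mult_nonneg_nonneg mollifier_nonneg)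
          also have "\<dots> \<le> ennreal (?k x z * (b x + h z))"
          proof (cases "norm (gmult x (ginv z)) < 1 / real (Suc n)")
            case True
            then show ?thesis
              using * mollifier_nonneg by (intro ennreal_leI mult_left_mono) auto
          qed (simp add: mollifier_eq_0)
          also have "\<dots> = ennreal (?k x z) * (ennreal (b x) + ennreal (h z))"
            using nn mollifier_nonneg by (subst ennreal_mult) auto
          finally show "ennreal (a x) * ennreal (?k x z * \<bar>w z - w x\<bar>) \<le>
              ennreal (?k x z) * (ennreal (b x) + ennreal (h z))" .
        qed
        finally show ?thesis .
      qed simp
      have "(\<integral>\<^sup>+ x. ennreal (indicator K x * a x * \<bar>moll (mollifier n) w x - w x\<bar>) \<partial>lebesgue) \<le>
          (\<integral>\<^sup>+ x. (\<integral>\<^sup>+ z. ennreal (?k x z) * (ennreal (b x) + ennreal (h z)) \<partial>lebesgue) \<partial>lebesgue)"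
        by (intro nn_integral_mono ptw)
      also have "\<dots> \<le> (\<integral>\<^sup>+ x. ennreal (b x) \<partial>lebesgue) + (\<integral>\<^sup>+ z. ennreal (h z) \<partial>lebesgue)"
        by (rule nn_integral_kernel_add_le[OF smooth_mollifier mollifier_eq_0' mollifier_nonneg
              nn_integral_mollifier]) measurable
      also have "\<dots> = ennreal ((LINT x|lebesgue. b x) + (LINT x|lebesgue. h x))"
        using nn bi hi by (simp add: nn_integral_eq_integral)
      also have "\<dots> \<le> ennreal \<eta>"
        using Ib Ih by (intro ennreal_leI) linarith
      finally show "(\<integral>\<^sup>+ x. ennreal (indicator K x * a x * \<bar>moll (mollifier n) w x - w x\<bar>) \<partial>lebesgue) \<le> ennreal \<eta>" .
    qed
  qed
  then show ?thesis
    by (rule tendsto_0_ennrealI)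
qed

end

section \<open>Testing with functions of the solution\<close>

text \<open>The pair (u, G) is a pointwise limit of simple functions. Composition with a function of
  finite range needs measurability in \<open>x\<close> only, and joint continuity in the remaining
  variables passes to the limit.\<close>

lemma caratheodory_measurable:
  fixes A :: "('n::finite, 'l::finite) operator"
  assumes A: "caratheodory A" and u: "u \<in> borel_measurable lebesgue" and G: "G \<in> borel_measurable lebesgue"
  shows "(\<lambda>x. A x (u x) (G x)) \<in> borel_measurable lebesgue"
proof -
  have "(\<lambda>x. (u x, G x)) \<in> borel_measurable lebesgue"
    using u G by (rule borel_measurable_Pair)
  from borel_measurable_implies_sequence_metric[OF this, of "(0, 0)"]
  obtain F where F: "\<And>i. simple_function lebesgue (F i)" "\<And>x. (\<lambda>i. F i x) \<longlonglongrightarrow> (u x, G x)"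
    by auto
  show ?thesis
  proof (rule borel_measurable_LIMSEQ_metric)
    show "(\<lambda>i. A x (fst (F i x)) (snd (F i x))) \<longlonglongrightarrow> A x (u x) (G x)" for x
    proof -
      have "continuous_on UNIV (\<lambda>(t, \<xi>). A x t \<xi>)"
        using A by (simp add: caratheodory_def)
      from continuous_on_tendsto_compose[OF this F(2)] show ?thesis
        by (simp add: case_prod_unfold)
    qed
    show "(\<lambda>x. A x (fst (F i x)) (snd (F i x))) \<in> borel_measurable lebesgue" for i
    proof (rule measurable_compose_countable'[where g = "F i" and I = "range (F i)"
          and f = "\<lambda>y x. A x (fst y) (snd y)"])
      show "(\<lambda>x. A x (fst y) (snd y)) \<in> borel_measurable lebesgue" for y
        using A by (simp add: caratheodory_def)
      have fin: "finite (range (F i))"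
        using simple_functionD(1)[OF F(1)[of i]] by simp
      then show "countable (range (F i))"
        by (rule countable_finite)
      show "F i \<in> lebesgue \<rightarrow>\<^sub>M count_space (range (F i))"
        using simple_functionD(2)[OF F(1)[of i]] fin by (subst measurable_count_space_eq2) auto
    qed
  qed
qed

lemma compactly_supported_eq_0:
  "x \<notin> closure {x. \<eta> x \<noteq> 0} \<Longrightarrow> \<eta> x = 0"
  using closure_subset[of "{x. \<eta> x \<noteq> 0}"] by auto

lemma grad_L_eq_0:
  assumes "x \<notin> closure {x. \<eta> x \<noteq> 0}"
  shows "grad_L X \<eta> x = 0"
proof -
  have "(\<eta> has_derivative (\<lambda>v. 0)) (at x)"
  proof (rule has_derivative_transform_within_open[OF has_derivative_const[of 0]])
    show "open (- closure {x. \<eta> x \<noteq> 0})" "x \<in> - closure {x. \<eta> x \<noteq> 0}"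
      using assms by (simp_all add: open_Compl)
    show "0 = \<eta> y" if "y \<in> - closure {x. \<eta> x \<noteq> 0}" for y
      by (rule compactly_supported_eq_0[symmetric]) (use that in blast)
  qed
  from frechet_derivative_at[OF this, symmetric] show ?thesis
    by (simp add: grad_L_def vec_eq_iff)
qed

lemma integrable_indicator_continuous:
  fixes f :: "'a::euclidean_space \<Rightarrow> real"
  assumes "continuous_on UNIV f" "compact K"
  shows "integrable lebesgue (\<lambda>x. indicator K x * f x)"
proof -
  have "integrable lborel (\<lambda>x. indicator K x * f x)"
    using borel_integrable_compact[OF assms(2) continuous_on_subset[OF assms(1)]]
    by (simp add: indicator_scaleR_eq_if[symmetric])
  then show ?thesis
    by (subst integrable_completion) auto
qed

lemma measurable_vec_nth:
  fixes G :: "'a \<Rightarrow> real ^ 'l::finite"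
  assumes "G \<in> borel_measurable M"
  shows "(\<lambda>x. G x $ i) \<in> borel_measurable M"
  by (rule measurable_compose[OF assms borel_measurable_continuous_onI])
    (intro continuous_on_component continuous_on_id)

lemma Lp_loc_component:
  fixes G :: "real ^ 'n::finite \<Rightarrow> real ^ 'l::finite"
  assumes "Lp_loc p G" "p \<ge> 0"
  shows "Lp_loc p (\<lambda>x. G x $ i)"
  unfolding Lp_loc_def
proof (intro conjI allI impI)
  show G: "(\<lambda>x. G x $ i) \<in> borel_measurable lebesgue"
    using assms by (auto simp: Lp_loc_def intro: measurable_vec_nth)
  fix K :: "(real ^ 'n) set" assume K: "compact K"
  have "set_integrable lebesgue K (\<lambda>x. norm (G x) powr p)"
    using assms K by (simp add: Lp_loc_def)
  moreover have "set_borel_measurable lebesgue K (\<lambda>x. norm (G x $ i) powr p)"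
  proof -
    note [measurable] = G fmeasurableD[OF lmeasurable_compact[OF K]]
    show ?thesis unfolding set_borel_measurable_def by measurable
  qed
  ultimately show "set_integrable lebesgue K (\<lambda>x. norm (G x $ i) powr p)"
  proof (rule set_integrable_bound)
    have "norm (norm (G x $ i) powr p) \<le> norm (norm (G x) powr p)" for x
      using assms(2) component_le_norm_cart[of "G x" i] by (auto intro!: powr_mono2)
    then show "AE x in lebesgue. x \<in> K \<longrightarrow> norm (norm (G x $ i) powr p) \<le> norm (norm (G x) powr p)"
      by (intro AE_I2 impI)
  qed
qed

lemma conj_exponent_props:
  assumes "p > 1"
  shows "conj_exponent p > 1" "1 / p + 1 / conj_exponent p = 1"
  using assms by (auto simp: conj_exponent_def field_simps)

lemma le_one_plus_powr: "x \<ge> 0 \<Longrightarrow> q \<ge> 1 \<Longrightarrow> x \<le> 1 + x powr q" for x q :: real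
proof (cases "x \<le> 1")
  case False
  assume "q \<ge> 1"
  then have "x powr 1 \<le> x powr q" using False by (intro powr_mono) auto
  then show ?thesis using False by simp
qed (use powr_ge_zero[of x q] in linarith)

lemma W1p_loc_weak_grad: "W1p_loc X p u \<Longrightarrow> is_weak_grad_L X u (weak_grad_L X u)"
proof -
  assume "W1p_loc X p u"
  then have "\<exists>G. is_weak_grad_L X u G"
    by (simp add: W1p_loc_def)
  then show ?thesis
    unfolding weak_grad_L_def by (rule someI_ex)
qed

context homogeneous_carnot_group
begin

text \<open>\<open>Ck 1\<close> provides continuity of derivatives in constant directions; the
  direction \<open>X i x\<close> varies and is expanded in the standard basis.\<close>

lemma continuous_grad_L:
  assumes \<psi>: "Ck 1 \<psi>"
  shows "continuous_on UNIV (grad_L X \<psi>)"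
proof -
  have d: "(\<psi> has_derivative frechet_derivative \<psi> (at x)) (at x)" for x
    using \<psi> by (simp only: One_nat_def Ck_Suc_has_derivative)
  have "frechet_derivative \<psi> (at x) (X i x) =
      (\<Sum>k\<in>UNIV. X i x $ k * frechet_derivative \<psi> (at x) (axis k 1))" for i x
  proof -
    have "X i x = (\<Sum>k\<in>UNIV. X i x $ k *\<^sub>R axis k 1)"
      using basis_expansion[of "X i x"] by (simp add: scalar_mult_eq_scaleR)
    then have "frechet_derivative \<psi> (at x) (X i x) =
        frechet_derivative \<psi> (at x) (\<Sum>k\<in>UNIV. X i x $ k *\<^sub>R axis k 1)"
      by simp
    then show ?thesis
      using has_derivative_linear[OF d] by (simp add: linear_sum linear_cmul)
  qed
  moreover have "continuous_on UNIV (\<lambda>x. \<Sum>k\<in>UNIV. X i x $ k * frechet_derivative \<psi> (at x) (axis k 1))" for i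
    using \<psi> by (intro continuous_on_sum continuous_on_mult continuous_on_component
        smooth_continuous[OF smooth_X]) (simp only: One_nat_def Ck.simps)
  ultimately show ?thesis
    unfolding grad_L_def by (intro continuous_on_vec_lambda) simp
qed

text \<open>The definition of a supersolution only allows \<open>C\<^sup>1\<close> test functions; \<open>F(u) \<eta>\<close> is reached as a
  limit of \<open>F(u\<^sub>n) \<eta>\<close>, where \<open>u\<^sub>n\<close> is the mollification of \<open>u\<close>.\<close>

lemma supersolution_test:
  fixes A :: "('n, 'l) operator" and F F' :: "real \<Rightarrow> real"
  assumes p: "p > 1" and A: "caratheodory A"
    and sol: "weak_supersolution X p A h u" and u0: "AE x in lebesgue. u x \<ge> 0"
    and F: "\<And>t. t \<ge> 0 \<Longrightarrow> (F has_real_derivative F' t) (at t)" "continuous_on {0..} F'"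
      "\<And>t. t \<ge> 0 \<Longrightarrow> F t \<ge> 0" "\<And>t. t \<ge> 0 \<Longrightarrow> \<bar>F t\<bar> \<le> B" "\<And>t. t \<ge> 0 \<Longrightarrow> \<bar>F' t\<bar> \<le> B"
      "F \<in> borel_measurable borel" "F' \<in> borel_measurable borel"
    and \<eta>: "Ck 1 \<eta>" "compactly_supported \<eta>" "\<And>x. \<eta> x \<ge> 0"
  defines "Au x \<equiv> A x (u x) (weak_grad_L X u x)"
  shows "integrable lebesgue (\<lambda>x. F' (u x) * \<eta> x * (Au x \<bullet> weak_grad_L X u x) + F (u x) * (Au x \<bullet> grad_L X \<eta> x))"
    and "integrable lebesgue (\<lambda>x. h x * (F (u x) * \<eta> x))"
    and "(LINT x|lebesgue. h x * (F (u x) * \<eta> x)) \<le>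
      (LINT x|lebesgue. F' (u x) * \<eta> x * (Au x \<bullet> weak_grad_L X u x) + F (u x) * (Au x \<bullet> grad_L X \<eta> x))"
proof -
  define q where "q = conj_exponent p"
  have q: "q > 1" "1 / p + 1 / q = 1"
    using conj_exponent_props[OF p] by (simp_all add: q_def)
  define G where "G = weak_grad_L X u"
  define K where "K = closure {x. \<eta> x \<noteq> 0}"
  have K: "compact K" using \<eta>(2) by (simp add: K_def compactly_supported_def)
  have \<eta>0: "\<eta> x = 0" if "x \<notin> K" for x
    using that unfolding K_def by (rule compactly_supported_eq_0)
  have g\<eta>0: "grad_L X \<eta> x = 0" if "x \<notin> K" for x
    using that unfolding K_def by (rule grad_L_eq_0)
  have W: "W1p_loc X p u" and h1: "Lp_loc 1 h"
    and Aq: "Lp_loc 1 (\<lambda>x. norm (Au x) powr q)"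
    and test: "\<And>\<phi>. Ck 1 \<phi> \<Longrightarrow> compactly_supported \<phi> \<Longrightarrow> (\<And>x. \<phi> x \<ge> 0) \<Longrightarrow>
      (LINT x|lebesgue. h x * \<phi> x) \<le> (LINT x|lebesgue. Au x \<bullet> grad_L X \<phi> x)"
    using sol by (auto simp: weak_supersolution_def Au_def q_def)
  have up: "Lp_loc p u" and Gp: "Lp_loc p G" and wg: "is_weak_grad_L X u G"
    using W W1p_loc_weak_grad[OF W] by (auto simp: W1p_loc_def G_def)
  have u1: "Lp_loc 1 u" using Lp_loc_imp_Lp_loc_1[OF up] p by simp
  have um [measurable]: "u \<in> borel_measurable lebesgue" and Gm [measurable]: "G \<in> borel_measurable lebesgue"
    and hm [measurable]: "h \<in> borel_measurable lebesgue"
    using up Gp h1 by (auto simp: Lp_loc_def)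
  have Km [measurable]: "K \<in> sets lebesgue"
    using K by (intro fmeasurableD lmeasurable_compact)
  have Am [measurable]: "Au \<in> borel_measurable lebesgue"
    unfolding Au_def[abs_def] G_def[symmetric] by (rule caratheodory_measurable[OF A um Gm])
  have \<eta>c: "continuous_on UNIV \<eta>"
    using \<eta>(1) by (rule Ck_continuous)
  have \<eta>d: "(\<eta> has_derivative frechet_derivative \<eta> (at x)) (at x)" for x
    using \<eta>(1) by (simp only: One_nat_def Ck_Suc_has_derivative)
  have D\<eta>c: "continuous_on UNIV (\<lambda>x. frechet_derivative \<eta> (at x) v)" for v
    using \<eta>(1) by (simp only: One_nat_def Ck.simps)
  note grad_cont = continuous_grad_L
  have bounded_on_K: "\<exists>c\<ge>0. \<forall>x\<in>K. norm (f x) \<le> c" if "continuous_on UNIV f" for f :: "real ^ 'n \<Rightarrow> 'c::real_normed_vector"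
  proof -
    have "compact (f ` K)"
      by (intro compact_continuous_image K continuous_on_subset[OF that]) simp
    from compact_imp_bounded[OF this] obtain c where c: "\<forall>y\<in>f ` K. norm y \<le> c"
      unfolding bounded_iff by (elim exE)
    show ?thesis
    proof (intro exI[of _ "max c 0"] conjI ballI)
      fix x assume "x \<in> K"
      then have "norm (f x) \<le> c" using c by simp
      then show "norm (f x) \<le> max c 0" by simp
    qed simp
  qed
  obtain c1 where c1: "c1 \<ge> 0" "\<And>x. x \<in> K \<Longrightarrow> \<bar>\<eta> x\<bar> \<le> c1"
    using bounded_on_K[OF \<eta>c] by auto
  obtain c2 where c2: "c2 \<ge> 0" "\<And>x. x \<in> K \<Longrightarrow> norm (grad_L X \<eta> x) \<le> c2"
    using bounded_on_K[OF grad_cont[OF \<eta>(1)]] by auto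
  have B: "B \<ge> 0" using F(4)[of 0] by linarith
  let ?i = "\<lambda>x. indicator K x :: real"
  have iK: "integrable lebesgue ?i"
    using lmeasurable_compact[OF K] by (simp add: lmeasurable_iff_integrable)
  have iAq: "integrable lebesgue (\<lambda>x. ?i x * norm (Au x) powr q)"
    using Lp_loc_1_set_integrable[OF Aq K] by (simp add: set_integrable_def)
  have iA: "integrable lebesgue (\<lambda>x. ?i x * norm (Au x))"
  proof (rule Bochner_Integration.integrable_bound)
    show "integrable lebesgue (\<lambda>x. ?i x + ?i x * norm (Au x) powr q)"
      by (intro Bochner_Integration.integrable_add iK iAq)
    show "AE x in lebesgue. norm (?i x * norm (Au x)) \<le> norm (?i x + ?i x * norm (Au x) powr q)"
      using le_one_plus_powr[of "norm (Au x)" q for x] q(1) by (intro AE_I2) (auto simp: indicator_def)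
  qed measurable
  have iGp: "integrable lebesgue (\<lambda>x. ?i x * norm (G x) powr p)"
    using Gp K by (simp add: Lp_loc_def set_integrable_def)
  \<comment> \<open>The powers q of |A| and p of the weak gradient are locally integrable, and these
    exponents are conjugate, so the product is dominated through Young's inequality.\<close>
  have iAG: "integrable lebesgue (\<lambda>x. ?i x * (norm (Au x) * norm (G x)))"
  proof (rule Bochner_Integration.integrable_bound)
    show "integrable lebesgue (\<lambda>x. ?i x * norm (Au x) powr q + ?i x * norm (G x) powr p)"
      by (intro Bochner_Integration.integrable_add iAq iGp)
    have "norm (Au x) * norm (G x) \<le> norm (Au x) powr q + norm (G x) powr p" for x
      using Young_scaled[OF p q(2), of "norm (Au x)" "norm (G x)" 1] by simp
    then show "AE x in lebesgue. norm (?i x * (norm (Au x) * norm (G x))) \<le>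
        norm (?i x * norm (Au x) powr q + ?i x * norm (G x) powr p)"
      by (intro AE_I2) (auto simp: indicator_def)
  qed measurable
  have ih: "integrable lebesgue (\<lambda>x. ?i x * \<bar>h x\<bar>)"
    using set_integrable_abs[OF Lp_loc_1_set_integrable[OF h1 K]] by (simp add: set_integrable_def)
  define un where "un n = moll (mollifier n) u" for n
  note m = smooth_mollifier mollifier_eq_0'
  have unC: "Ck 1 (un n)" for n
    unfolding un_def by (rule Ck_1_moll[OF m u1])
  have unc: "continuous_on UNIV (un n)" for n
    using unC by (rule Ck_continuous)
  \<comment> \<open>Mollification preserves the sign, so \<open>F\<close> and \<open>F'\<close> are
    evaluated only on the half-line where their hypotheses hold.\<close>
  have un0: "un n x \<ge> 0" for n x
    unfolding un_def by (rule moll_nonneg[OF m mollifier_nonneg u0])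
  have ungrad: "grad_L X (un n) x $ i = moll (mollifier n) (\<lambda>z. G z $ i) x" for n x i
    unfolding un_def by (rule grad_L_moll[OF m u1 wg])
  define \<phi> where "\<phi> n x = F (un n x) * \<eta> x" for n x
  define D where "D n x v = F' (un n x) * frechet_derivative (un n) (at x) v * \<eta> x
      + F (un n x) * frechet_derivative \<eta> (at x) v" for n x v
  have Fc: "continuous_on {0..} F"
    using F(1) by (intro continuous_at_imp_continuous_on ballI) (auto intro: DERIV_isCont)
  have Fun: "continuous_on UNIV (\<lambda>x. F (un n x))" "continuous_on UNIV (\<lambda>x. F' (un n x))" for n
    by (rule continuous_on_compose2[OF _ unc[of n]], rule Fc F(2), use un0 in auto)+
  have \<phi>d: "(\<phi> n has_derivative D n x) (at x)" for n x
  proof -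
    have un': "(un n has_derivative frechet_derivative (un n) (at x)) (at x)"
      using unC[of n] by (simp only: One_nat_def Ck_Suc_has_derivative)
    have "((\<lambda>x. F (un n x)) has_derivative (\<lambda>v. F' (un n x) * frechet_derivative (un n) (at x) v)) (at x)"
      using has_derivative_compose[OF un' F(1)[OF un0, unfolded has_field_derivative_def]] by simp
    from has_derivative_mult[OF this \<eta>d] show ?thesis
      unfolding \<phi>_def D_def[abs_def] by (simp add: add.commute mult_ac)
  qed
  have \<phi>C: "Ck 1 (\<phi> n)" for n
  proof -
    have "continuous_on UNIV (\<lambda>x. D n x v)" for v
      unfolding D_def using unC[of n]
      by (intro continuous_on_add continuous_on_mult Fun \<eta>c D\<eta>c) (simp only: One_nat_def Ck.simps)
    then have "Ck 0 (\<lambda>x. D n x v)" for v by simp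
    then show ?thesis
      unfolding One_nat_def by (rule Ck_SucI[where f' = "D n", OF \<phi>d])
  qed
  have \<phi>grad: "grad_L X (\<phi> n) x = (F' (un n x) * \<eta> x) *\<^sub>R grad_L X (un n) x + F (un n x) *\<^sub>R grad_L X \<eta> x" for n x
    using frechet_derivative_at[OF \<phi>d, of n x, symmetric] by (simp add: grad_L_def D_def vec_eq_iff)
  have \<phi>cs: "compactly_supported (\<phi> n)" for n
  proof -
    have "{x. \<phi> n x \<noteq> 0} \<subseteq> K"
      using \<eta>0 by (auto simp: \<phi>_def)
    then show ?thesis
      unfolding compactly_supported_def compact_closure
      by (rule bounded_subset[OF compact_imp_bounded[OF K]])
  qed
  have ineq: "(LINT x|lebesgue. h x * \<phi> n x) \<le> (LINT x|lebesgue. Au x \<bullet> grad_L X (\<phi> n) x)" for n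
    by (rule test[OF \<phi>C \<phi>cs]) (simp add: \<phi>_def F(3) un0 \<eta>(3))
  have unm [measurable]: "un n \<in> borel_measurable lebesgue" for n
    using unc by (intro measurable_completion) (simp add: borel_measurable_continuous_onI)
  have gunm [measurable]: "grad_L X (un n) \<in> borel_measurable lebesgue" for n
    using grad_cont[OF unC] by (intro measurable_completion) (simp add: borel_measurable_continuous_onI)
  have g\<eta>m [measurable]: "grad_L X \<eta> \<in> borel_measurable lebesgue" "\<eta> \<in> borel_measurable lebesgue"
    using grad_cont[OF \<eta>(1)] \<eta>c by (auto intro!: measurable_completion simp: borel_measurable_continuous_onI)
  have Funm [measurable]: "(\<lambda>x. F (un n x)) \<in> borel_measurable lebesgue" "(\<lambda>x. F' (un n x)) \<in> borel_measurable lebesgue" for n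
    using Fun by (auto intro!: measurable_completion simp: borel_measurable_continuous_onI)
  \<comment> \<open>\<open>moll_tendsto\<close> with weight 1 gives convergence in L1 on
    \<open>K\<close>, hence almost everywhere along a subsequence.\<close>
  obtain r where r: "strict_mono r" "AE x in lebesgue. (\<lambda>n. ?i x * (un (r n) x - u x)) \<longlonglongrightarrow> 0"
  proof -
    have i: "integrable lebesgue (\<lambda>x. ?i x * (un n x - u x))" for n
    proof -
      have "integrable lebesgue (\<lambda>x. ?i x * u x)"
        using Lp_loc_1_set_integrable[OF u1 K] by (simp add: set_integrable_def)
      then show ?thesis
        using integrable_indicator_continuous[OF unc K, of n] by (simp add: right_diff_distrib)
    qed
    have "(\<lambda>n. \<integral>\<^sup>+ x. ennreal (?i x * 1 * \<bar>moll (mollifier n) u x - u x\<bar>) \<partial>lebesgue) \<longlonglongrightarrow> 0"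
      by (rule moll_tendsto[OF p q(2) K _ _ _ up]) (use iK in auto)
    moreover have "(\<integral>\<^sup>+ x. ennreal (?i x * 1 * \<bar>moll (mollifier n) u x - u x\<bar>) \<partial>lebesgue) =
        ennreal (LINT x|lebesgue. norm (?i x * (un n x - u x)))" for n
    proof -
      have "(\<integral>\<^sup>+ x. ennreal (?i x * 1 * \<bar>moll (mollifier n) u x - u x\<bar>) \<partial>lebesgue) =
          (\<integral>\<^sup>+ x. ennreal (norm (?i x * (un n x - u x))) \<partial>lebesgue)"
        by (intro nn_integral_cong) (simp add: un_def abs_mult)
      also have "\<dots> = ennreal (LINT x|lebesgue. norm (?i x * (un n x - u x)))"
        by (rule nn_integral_eq_integral[OF integrable_norm[OF i]]) simp
      finally show ?thesis .
    qed
    ultimately have "(\<lambda>n. LINT x|lebesgue. norm (?i x * (un n x - u x))) \<longlonglongrightarrow> 0"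
      using ennreal_tendsto_0_iff[of "\<lambda>n. LINT x|lebesgue. norm (?i x * (un n x - u x))"] by simp
    from tendsto_L1_AE_subseq[OF i this] show thesis
      using that by blast
  qed
  have conv: "AE x in lebesgue. x \<in> K \<longrightarrow> u x \<ge> 0 \<and> (\<lambda>n. F (un (r n) x)) \<longlonglongrightarrow> F (u x) \<and> (\<lambda>n. F' (un (r n) x)) \<longlonglongrightarrow> F' (u x)"
    using r(2) u0
  proof eventually_elim
    case (elim x)
    show ?case
    proof
      assume "x \<in> K"
      then have l: "(\<lambda>n. un (r n) x) \<longlonglongrightarrow> u x"
        using elim(1) by (simp add: LIM_zero_iff)
      show "u x \<ge> 0 \<and> (\<lambda>n. F (un (r n) x)) \<longlonglongrightarrow> F (u x) \<and> (\<lambda>n. F' (un (r n) x)) \<longlonglongrightarrow> F' (u x)"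
        using continuous_on_tendsto_compose[OF Fc l] continuous_on_tendsto_compose[OF F(2) l] elim(2) un0
        by auto
    qed
  qed
  \<comment> \<open>The tested integrand will be split as \<open>P n + E n\<close>. In
    \<open>P n\<close> the gradient of \<open>un n\<close> is already replaced by \<open>G\<close>,
    so only the bounded factors F(un) and F'(un) depend on \<open>n\<close> and dominated
    convergence applies; \<open>E n\<close> carries the difference of the gradients.\<close>
  define P where "P n x = F' (un n x) * \<eta> x * (Au x \<bullet> G x) + F (un n x) * (Au x \<bullet> grad_L X \<eta> x)" for n x
  define P0 where "P0 x = F' (u x) * \<eta> x * (Au x \<bullet> G x) + F (u x) * (Au x \<bullet> grad_L X \<eta> x)" for x
  have PB: "integrable lebesgue (\<lambda>x. B * c1 * (?i x * (norm (Au x) * norm (G x))) + B * c2 * (?i x * norm (Au x)))"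
    by (intro Bochner_Integration.integrable_add integrable_mult_right iAG iA)
  have Pbd: "\<bar>s * \<eta> x * (Au x \<bullet> G x) + t * (Au x \<bullet> grad_L X \<eta> x)\<bar> \<le>
      B * c1 * (?i x * (norm (Au x) * norm (G x))) + B * c2 * (?i x * norm (Au x))"
    if "\<bar>s\<bar> \<le> B" "\<bar>t\<bar> \<le> B" for s t x
  proof (cases "x \<in> K")
    case True
    have "\<bar>s * \<eta> x * (Au x \<bullet> G x)\<bar> \<le> B * c1 * (norm (Au x) * norm (G x))"
      unfolding abs_mult using that c1 True B by (intro mult_mono Cauchy_Schwarz_ineq2) auto
    moreover have "\<bar>t * (Au x \<bullet> grad_L X \<eta> x)\<bar> \<le> B * (norm (Au x) * c2)"
      unfolding abs_mult using that c2 True B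
      by (intro mult_mono order_trans[OF Cauchy_Schwarz_ineq2] mult_left_mono) auto
    ultimately show ?thesis using True by (simp add: mult_ac)
  qed (simp add: \<eta>0 g\<eta>0)
  have FuK: "AE x in lebesgue. \<bar>F (u x)\<bar> \<le> B \<and> \<bar>F' (u x)\<bar> \<le> B"
    using u0 by eventually_elim (use F(4,5) in auto)
  have [measurable]: "(\<lambda>x. F (u x)) \<in> borel_measurable lebesgue" "(\<lambda>x. F' (u x)) \<in> borel_measurable lebesgue"
    by (rule measurable_compose[OF um F(6)], rule measurable_compose[OF um F(7)])
  have P0m [measurable]: "P0 \<in> borel_measurable lebesgue" and Pm [measurable]: "P n \<in> borel_measurable lebesgue" for n
    unfolding P0_def[abs_def] P_def[abs_def] by measurable
  have P0i: "integrable lebesgue P0"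
  proof (rule Bochner_Integration.integrable_bound[OF PB P0m])
    show "AE x in lebesgue. norm (P0 x) \<le> norm (B * c1 * (?i x * (norm (Au x) * norm (G x))) + B * c2 * (?i x * norm (Au x)))"
      using FuK unfolding P0_def real_norm_def
      by eventually_elim (rule order_trans[OF Pbd abs_ge_self]; blast)
  qed
  have Pi: "integrable lebesgue (P n)" for n
  proof (rule Bochner_Integration.integrable_bound[OF PB Pm])
    show "AE x in lebesgue. norm (P n x) \<le> norm (B * c1 * (?i x * (norm (Au x) * norm (G x))) + B * c2 * (?i x * norm (Au x)))"
      using Pbd[OF F(5)[OF un0] F(4)[OF un0]]
      by (intro AE_I2) (auto simp: P_def intro: order_trans[OF _ abs_ge_self])
  qed
  have limP: "(\<lambda>n. LINT x|lebesgue. P (r n) x) \<longlonglongrightarrow> (LINT x|lebesgue. P0 x)"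
  proof (rule integral_dominated_convergence[OF P0m Pm PB])
    show "AE x in lebesgue. (\<lambda>n. P (r n) x) \<longlonglongrightarrow> P0 x"
      using conv
    proof eventually_elim
      case (elim x)
      show ?case
      proof (cases "x \<in> K")
        case True
        then show ?thesis
          using elim unfolding P_def P0_def by (intro tendsto_add tendsto_mult tendsto_const) auto
      qed (simp add: P_def P0_def \<eta>0 g\<eta>0)
    qed
    show "AE x in lebesgue. norm (P (r n) x) \<le> B * c1 * (?i x * (norm (Au x) * norm (G x))) + B * c2 * (?i x * norm (Au x))" for n
      using Pbd[OF F(5)[OF un0] F(4)[OF un0]] by (intro AE_I2) (simp add: P_def)
  qed
  have hB: "integrable lebesgue (\<lambda>x. B * c1 * (?i x * \<bar>h x\<bar>))"
    by (intro integrable_mult_right ih)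
  have hbd: "norm (h x * (t * \<eta> x)) \<le> B * c1 * (?i x * \<bar>h x\<bar>)" if "\<bar>t\<bar> \<le> B" for t x
  proof (cases "x \<in> K")
    case True
    have "\<bar>h x\<bar> * (\<bar>t\<bar> * \<bar>\<eta> x\<bar>) \<le> \<bar>h x\<bar> * (B * c1)"
      using that c1 True B by (intro mult_left_mono mult_mono) auto
    then show ?thesis using True by (simp add: abs_mult mult_ac)
  qed (simp add: \<eta>0)
  have hm0: "(\<lambda>x. h x * (F (u x) * \<eta> x)) \<in> borel_measurable lebesgue"
    "(\<lambda>x. h x * \<phi> n x) \<in> borel_measurable lebesgue" for n
    unfolding \<phi>_def by measurable
  have limh: "(\<lambda>n. LINT x|lebesgue. h x * \<phi> (r n) x) \<longlonglongrightarrow> (LINT x|lebesgue. h x * (F (u x) * \<eta> x))"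
  proof (rule integral_dominated_convergence[OF hm0 hB])
    show "AE x in lebesgue. (\<lambda>n. h x * \<phi> (r n) x) \<longlonglongrightarrow> h x * (F (u x) * \<eta> x)"
      using conv
    proof eventually_elim
      case (elim x)
      show ?case
      proof (cases "x \<in> K")
        case True
        then show ?thesis
          using elim unfolding \<phi>_def by (intro tendsto_mult tendsto_const) auto
      qed (simp add: \<phi>_def \<eta>0)
    qed
    show "AE x in lebesgue. norm (h x * \<phi> (r n) x) \<le> B * c1 * (?i x * \<bar>h x\<bar>)" for n
      unfolding \<phi>_def by (intro AE_I2 hbd F(4) un0)
  qed
  define E where "E n x = F' (un n x) * \<eta> x * (Au x \<bullet> (grad_L X (un n) x - G x))" for n x
  have split: "Au x \<bullet> grad_L X (\<phi> n) x = P n x + E n x" for n x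
    by (simp add: \<phi>grad P_def E_def inner_add_right inner_diff_right algebra_simps)
  have Ti: "integrable lebesgue (\<lambda>x. Au x \<bullet> grad_L X (\<phi> n) x)" for n
  proof -
    obtain c where c: "c \<ge> 0" "\<forall>x\<in>K. norm (grad_L X (\<phi> n) x) \<le> c"
      using bounded_on_K[OF grad_cont[OF \<phi>C]] by blast
    have [measurable]: "grad_L X (\<phi> n) \<in> borel_measurable lebesgue"
      using grad_cont[OF \<phi>C] by (intro measurable_completion) (simp add: borel_measurable_continuous_onI)
    show ?thesis
    proof (rule Bochner_Integration.integrable_bound)
      show "integrable lebesgue (\<lambda>x. c * (?i x * norm (Au x)))"
        by (intro integrable_mult_right iA)
      have "norm (Au x \<bullet> grad_L X (\<phi> n) x) \<le> norm (c * (?i x * norm (Au x)))" for x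
      proof (cases "x \<in> K")
        case True
        have "\<bar>Au x \<bullet> grad_L X (\<phi> n) x\<bar> \<le> norm (Au x) * c"
          using c True by (intro order_trans[OF Cauchy_Schwarz_ineq2] mult_left_mono) auto
        then show ?thesis using True c(1) by (simp add: abs_mult mult.commute)
      qed (simp add: \<phi>grad \<eta>0 g\<eta>0)
      then show "AE x in lebesgue. norm (Au x \<bullet> grad_L X (\<phi> n) x) \<le> norm (c * (?i x * norm (Au x)))"
        by (intro AE_I2)
    qed measurable
  qed
  have Ei: "integrable lebesgue (E n)" for n
  proof -
    have "E n = (\<lambda>x. Au x \<bullet> grad_L X (\<phi> n) x - P n x)"
      by (simp add: split fun_eq_iff)
    then show ?thesis
      using Ti Pi by simp
  qed
  \<comment> \<open>Here the weight in \<open>moll_tendsto\<close> is the norm of \<open>Au\<close>,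
    whose power q is integrable on \<open>K\<close>. Mollification commutes with the horizontal
    gradient, so each component of the gradient error is a mollification error of
    \<open>G\<close>.\<close>
  have limE: "(\<lambda>n. LINT x|lebesgue. E n x) \<longlonglongrightarrow> 0"
  proof -
    let ?e = "\<lambda>i n. \<integral>\<^sup>+ x. ennreal (?i x * norm (Au x) * \<bar>moll (mollifier n) (\<lambda>z. G z $ i) x - G x $ i\<bar>) \<partial>lebesgue"
    have "?e i \<longlonglongrightarrow> 0" for i
      by (rule moll_tendsto[OF p q(2) K _ _ iAq Lp_loc_component[OF Gp]]) (use p in auto)
    then have "(\<lambda>n. \<Sum>i\<in>UNIV. ?e i n) \<longlonglongrightarrow> (\<Sum>i\<in>(UNIV::'l set). 0)"
      by (intro tendsto_sum)
    then have "(\<lambda>n. ennreal (B * c1) * (\<Sum>i\<in>UNIV. ?e i n)) \<longlonglongrightarrow> ennreal (B * c1) * 0"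
      by (intro ennreal_tendsto_cmult) auto
    then have lim: "(\<lambda>n. ennreal (B * c1) * (\<Sum>i\<in>UNIV. ?e i n)) \<longlonglongrightarrow> 0"
      by simp
    have le: "ennreal (norm (LINT x|lebesgue. E n x)) \<le> ennreal (B * c1) * (\<Sum>i\<in>UNIV. ?e i n)" for n
    proof -
      let ?d = "\<lambda>i x. \<bar>moll (mollifier n) (\<lambda>z. G z $ i) x - G x $ i\<bar>"
      have [measurable]: "?d i \<in> borel_measurable lebesgue" for i
      proof -
        have "(\<lambda>x. \<bar>grad_L X (un n) x $ i - G x $ i\<bar>) \<in> borel_measurable lebesgue"
          using measurable_vec_nth[OF gunm[of n]] measurable_vec_nth[OF Gm] by measurable
        then show ?thesis by (simp add: ungrad)
      qed
      have ptw: "norm (E n x) \<le> B * c1 * (\<Sum>i\<in>UNIV. ?i x * norm (Au x) * ?d i x)" for x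
      proof (cases "x \<in> K")
        case True
        have "norm (E n x) \<le> (B * c1) * (norm (Au x) * norm (grad_L X (un n) x - G x))"
          unfolding E_def real_norm_def abs_mult using F(5)[OF un0] c1 True B
          by (intro mult_mono Cauchy_Schwarz_ineq2) auto
        also have "\<dots> \<le> (B * c1) * (norm (Au x) * (\<Sum>i\<in>UNIV. ?d i x))"
          using norm_le_l1_cart[of "grad_L X (un n) x - G x"] B c1
          by (intro mult_left_mono) (auto simp: ungrad)
        finally show ?thesis
          using True by (simp add: sum_distrib_left)
      qed (simp add: E_def \<eta>0)
      have "ennreal (norm (LINT x|lebesgue. E n x)) \<le> (\<integral>\<^sup>+ x. ennreal (norm (E n x)) \<partial>lebesgue)"
        by (rule integral_norm_bound_ennreal[OF Ei])
      also have "\<dots> \<le> (\<integral>\<^sup>+ x. ennreal (B * c1) * (\<Sum>i\<in>UNIV. ennreal (?i x * norm (Au x) * ?d i x)) \<partial>lebesgue)"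
      proof (rule nn_integral_mono)
        fix x
        have "ennreal (norm (E n x)) \<le> ennreal (B * c1 * (\<Sum>i\<in>UNIV. ?i x * norm (Au x) * ?d i x))"
          by (rule ennreal_leI[OF ptw])
        also have "\<dots> = ennreal (B * c1) * ennreal (\<Sum>i\<in>UNIV. ?i x * norm (Au x) * ?d i x)"
          using B c1(1) by (intro ennreal_mult sum_nonneg) simp_all
        also have "ennreal (\<Sum>i\<in>UNIV. ?i x * norm (Au x) * ?d i x) = (\<Sum>i\<in>UNIV. ennreal (?i x * norm (Au x) * ?d i x))"
          by (rule sum_ennreal[symmetric]) simp
        finally show "ennreal (norm (E n x)) \<le>
            ennreal (B * c1) * (\<Sum>i\<in>UNIV. ennreal (?i x * norm (Au x) * ?d i x))" .
      qed
      also have "\<dots> = ennreal (B * c1) * (\<Sum>i\<in>UNIV. ?e i n)"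
        by (simp add: nn_integral_cmult nn_integral_sum del: sum_ennreal)
      finally show ?thesis .
    qed
    have "(\<lambda>n. ennreal (norm (LINT x|lebesgue. E n x))) \<longlonglongrightarrow> 0"
      by (rule tendsto_sandwich[OF _ _ tendsto_const lim]) (use le in auto)
    from iffD1[OF ennreal_tendsto_0_iff[OF norm_ge_zero] this] show ?thesis
      by (rule tendsto_norm_zero_cancel)
  qed
  have "(\<lambda>n. (LINT x|lebesgue. P (r n) x) + (LINT x|lebesgue. E (r n) x)) \<longlonglongrightarrow> (LINT x|lebesgue. P0 x) + 0"
    using limP LIMSEQ_subseq_LIMSEQ[OF limE r(1)] by (intro tendsto_add) (simp_all add: comp_def)
  moreover have "(LINT x|lebesgue. h x * \<phi> (r n) x) \<le> (LINT x|lebesgue. P (r n) x) + (LINT x|lebesgue. E (r n) x)" for n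
    using ineq[of "r n"] Pi Ei by (simp add: split)
  ultimately have "(LINT x|lebesgue. h x * (F (u x) * \<eta> x)) \<le> (LINT x|lebesgue. P0 x) + 0"
    using limh by (intro LIMSEQ_le) auto
  then show "(LINT x|lebesgue. h x * (F (u x) * \<eta> x)) \<le>
      (LINT x|lebesgue. F' (u x) * \<eta> x * (Au x \<bullet> weak_grad_L X u x) + F (u x) * (Au x \<bullet> grad_L X \<eta> x))"
    by (simp add: P0_def G_def)
  show "integrable lebesgue (\<lambda>x. F' (u x) * \<eta> x * (Au x \<bullet> weak_grad_L X u x) + F (u x) * (Au x \<bullet> grad_L X \<eta> x))"
    using P0i by (simp add: P0_def[abs_def] G_def)
  show "integrable lebesgue (\<lambda>x. h x * (F (u x) * \<eta> x))"
  proof (rule Bochner_Integration.integrable_bound[OF hB hm0(1)])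
    have le: "norm (h x * (F (u x) * \<eta> x)) \<le> norm (B * c1 * (?i x * \<bar>h x\<bar>))" if "\<bar>F (u x)\<bar> \<le> B" for x
      using hbd[OF that, of x] unfolding real_norm_def by linarith
    show "AE x in lebesgue. norm (h x * (F (u x) * \<eta> x)) \<le> norm (B * c1 * (?i x * \<bar>h x\<bar>))"
      using FuK
    proof eventually_elim
      case (elim x)
      then show ?case by (intro le) simp
    qed
  qed
qed

end

section \<open>The a priori estimate\<close>

lemma ess_inf_ge:
  assumes "E \<in> sets lebesgue" "AE x in lebesgue. x \<in> E \<longrightarrow> c \<le> w x"
  shows "ereal c \<le> ess_inf E w"
  unfolding ess_inf_def
proof (rule Liminf_bounded)
  show "\<forall>\<^sub>F x in ae_filter (restrict_space lebesgue E). ereal c \<le> ereal (w x)"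
    using assms by (subst AE_restrict_space_iff) auto
qed

lemma AE_greater_if_less_ess_inf:
  assumes "E \<in> sets lebesgue" "ereal y < ess_inf E w"
  shows "AE x in lebesgue. x \<in> E \<longrightarrow> y < w x"
  using less_LiminfD[OF assms(2)[unfolded ess_inf_def]] assms(1)
  by (subst (asm) AE_restrict_space_iff) auto

text \<open>Each level m - 1/(n+1) has its own null set of exceptions; the countable union of these
  is null, and the levels tend to m.\<close>

lemma AE_ge_ess_inf:
  assumes E: "E \<in> sets lebesgue" and m: "ess_inf E w = ereal m"
  shows "AE x in lebesgue. x \<in> E \<longrightarrow> m \<le> w x"
proof -
  have *: "AE x in lebesgue. x \<in> E \<longrightarrow> m - 1 / real (Suc n) < w x" for n
    by (rule AE_greater_if_less_ess_inf[OF E]) (simp add: m)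
  have "AE x in lebesgue. \<forall>n. x \<in> E \<longrightarrow> m - 1 / real (Suc n) < w x"
    by (subst AE_all_countable) (intro allI *)
  then show ?thesis
  proof eventually_elim
    case (elim x)
    show ?case
    proof
      assume "x \<in> E"
      then have "m - 1 / real (Suc n) \<le> w x" for n
        using elim by (simp add: less_imp_le)
      moreover have "(\<lambda>n. m - 1 / real (Suc n)) \<longlonglongrightarrow> m - 0"
        by (intro tendsto_diff tendsto_const LIMSEQ_Suc[OF lim_1_over_n])
      ultimately show "m \<le> w x"
        using LIMSEQ_le_const2[of "\<lambda>n. m - 1 / real (Suc n)" "m - 0" "w x"] by auto
    qed
  qed
qed

lemma ess_inf_less_top:
  assumes E: "E \<in> sets lebesgue" "emeasure lebesgue E \<noteq> 0"
  shows "ess_inf E w < \<infinity>"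
proof (rule ccontr)
  assume "\<not> ess_inf E w < \<infinity>"
  then have top: "ess_inf E w = \<infinity>"
    by simp
  then have *: "AE x in lebesgue. x \<in> E \<longrightarrow> real n < w x" for n
    by (intro AE_greater_if_less_ess_inf[OF E(1)]) simp
  have "AE x in lebesgue. \<forall>n. x \<in> E \<longrightarrow> real n < w x"
    by (subst AE_all_countable) (intro allI *)
  then have "AE x in lebesgue. x \<notin> E"
  proof eventually_elim
    case (elim x)
    show ?case
    proof
      assume "x \<in> E"
      then have "real n < w x" for n
        using elim by blast
      moreover obtain n where "w x \<le> real n"
        using real_arch_simple by blast
      ultimately show False
        using not_le by blast
    qed
  qed
  then show False
    using E by (simp add: AE_iff_null_sets[symmetric] null_sets_def)
qed

lemma bump_le_1: "bump r x \<le> 1"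
  by (simp add: bump_def flat_exp_def)

context homogeneous_carnot_group
begin

text \<open>The estimate tests with \<open>(u + m)\<^sup>-\<^sup>\<alpha> \<eta>\<close> and with \<open>\<eta>\<close>. The exponent \<open>\<alpha> = \<sigma>/(p - 1) - 1\<close> is
  the largest one for which the resulting power of \<open>u\<close> is controlled by the weak Harnack inequality,
  and the shift \<open>m = ess inf u\<close> makes \<open>(u + m)/m \<ge> 1\<close>, so that lower powers need no separate
  treatment.\<close>

lemma supersolution_mass_le:
  fixes A :: "('n, 'l) operator"
  assumes p: "p > 1" and A: "caratheodory A"
    and k: "k > 0" "\<And>x t \<xi>. A x t \<xi> \<bullet> \<xi> \<ge> k * norm (A x t \<xi>) powr conj_exponent p"
    and \<sigma>: "\<sigma> > p - 1" and c1: "c1 > 0"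
  obtains C where "C > 0"
    "\<forall>h u \<eta> R m B. weak_supersolution X p A h u \<longrightarrow> (AE x in lebesgue. u x \<ge> 0) \<longrightarrow>
      (AE x in lebesgue. h x \<ge> 0) \<longrightarrow>
      Ck 1 \<eta> \<longrightarrow> compactly_supported \<eta> \<longrightarrow> (\<forall>x. 0 \<le> \<eta> x \<and> \<eta> x \<le> 1) \<longrightarrow> (\<forall>x. x \<notin> B \<longrightarrow> \<eta> x = 0) \<longrightarrow>
      R > 0 \<longrightarrow> (\<forall>x. norm (grad_L X \<eta> x) \<le> c1 / R * \<eta> x powr (1 / conj_exponent p)) \<longrightarrow>
      m > 0 \<longrightarrow> B \<in> sets lebesgue \<longrightarrow> integrable lebesgue (\<lambda>x. indicator B x * (u x + m) powr \<sigma>) \<longrightarrow>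
      (LINT x|lebesgue. h x * \<eta> x) \<le>
        C * R powr (- p) * m powr (p - 1 - \<sigma>) * (LINT x|lebesgue. indicator B x * (u x + m) powr \<sigma>)"
proof -
  define q where "q = conj_exponent p"
  have q: "q > 1" "1 / p + 1 / q = 1"
    using conj_exponent_props[OF p] by (simp_all add: q_def)
  have pq: "p / q = p - 1"
    using p q by (simp add: field_simps)
  define \<alpha> where "\<alpha> = \<sigma> / (p - 1) - 1"
  have \<alpha>: "\<alpha> > 0" "(\<alpha> + 1) * (p - 1) = \<sigma>"
    using p \<sigma> by (auto simp: \<alpha>_def field_simps)
  \<comment> \<open>Coercivity yields the good term \<open>- 2 * l * Z\<close>; Young's inequality
    with parameter \<open>l\<close> spends half of it on the cross term, and the other half bounds
    the integral of \<open>Z\<close>.\<close>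
  define l where "l = \<alpha> * k / 2"
  have l: "l > 0" using \<alpha> k by (simp add: l_def)
  define C1 where "C1 = l powr (1 - p) * c1 powr p / l"
  define C where "C = C1 + c1 powr p"
  have C1: "C1 > 0" using l c1 by (simp add: C1_def)
  have C: "C > 0" using C1 by (simp add: C_def add_pos_nonneg)
  show thesis
  proof (rule that[OF C], intro allI impI)
    fix h u \<eta> :: "real ^ 'n \<Rightarrow> real" and R m :: real and B :: "(real ^ 'n) set"
    assume sol: "weak_supersolution X p A h u" and u0: "AE x in lebesgue. u x \<ge> 0"
      and h0: "AE x in lebesgue. h x \<ge> 0"
      and \<eta>: "Ck 1 \<eta>" "compactly_supported \<eta>" and \<eta>01: "\<forall>x. 0 \<le> \<eta> x \<and> \<eta> x \<le> 1"
      and \<eta>B: "\<forall>x. x \<notin> B \<longrightarrow> \<eta> x = 0" and R: "R > 0"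
      and gradle: "\<forall>x. norm (grad_L X \<eta> x) \<le> c1 / R * \<eta> x powr (1 / conj_exponent p)"
      and m: "m > 0" and B [measurable]: "B \<in> sets lebesgue"
      and int: "integrable lebesgue (\<lambda>x. indicator B x * (u x + m) powr \<sigma>)"
    note \<eta> = \<eta> \<eta>01[rule_format] \<eta>B[rule_format] and grad = gradle[rule_format]
    define Au where "Au x = A x (u x) (weak_grad_L X u x)" for x
    define I where "I = (LINT x|lebesgue. indicator B x * (u x + m) powr \<sigma>)"
    define F where "F t = (t + m) powr (- \<alpha>)" for t
    define F' where "F' t = - \<alpha> * (t + m) powr (- \<alpha> - 1)" for t
    define M where "M = max (m powr (- \<alpha>)) (\<alpha> * m powr (- \<alpha> - 1))"
    have mono: "(t + m) powr (- s) \<le> m powr (- s)" if "t \<ge> 0" "s \<ge> 0" for t s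
      using that m by (intro powr_mono2') auto
    have F1: "(F has_real_derivative F' t) (at t)" if "t \<ge> 0" for t
      unfolding F_def F'_def using that m by (auto intro!: derivative_eq_intros)
    have F2: "continuous_on {0..} F'"
      unfolding F'_def using m by (intro continuous_intros) auto
    have F4: "\<bar>F t\<bar> \<le> M" if "t \<ge> 0" for t
      using mono[OF that, of \<alpha>] \<alpha>(1) by (simp add: F_def M_def)
    have F5: "\<bar>F' t\<bar> \<le> M" if "t \<ge> 0" for t
      using mono[OF that, of "\<alpha> + 1"] \<alpha>(1) by (simp add: F'_def M_def abs_mult le_max_iff_disj)
    have W: "W1p_loc X p u" and h1: "Lp_loc 1 h" and Aq: "Lp_loc 1 (\<lambda>x. norm (Au x) powr q)"
      and test1: "(LINT x|lebesgue. h x * \<eta> x) \<le> (LINT x|lebesgue. Au x \<bullet> grad_L X \<eta> x)"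
      using sol \<eta> by (auto simp: weak_supersolution_def Au_def q_def)
    have um [measurable]: "u \<in> borel_measurable lebesgue"
      and Gm: "weak_grad_L X u \<in> borel_measurable lebesgue"
      using W by (auto simp: W1p_loc_def Lp_loc_def)
    have Am [measurable]: "Au \<in> borel_measurable lebesgue"
      unfolding Au_def[abs_def] by (rule caratheodory_measurable[OF A um Gm])
    have [measurable]: "\<eta> \<in> borel_measurable lebesgue" "grad_L X \<eta> \<in> borel_measurable lebesgue"
      using Ck_continuous[OF \<eta>(1)] continuous_grad_L[OF \<eta>(1)]
      by (auto intro!: measurable_completion simp: borel_measurable_continuous_onI)
    \<comment> \<open>The weighted energy density linking the two tests: the first test bounds its
      integral, and the flux in the second test is bounded by it.\<close>
    define Z where "Z x = (u x + m) powr (- \<alpha> - 1) * (norm (Au x) powr q * \<eta> x)" for x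
    define Y where "Y x = indicator B x * (u x + m) powr \<sigma>" for x
    have [measurable]: "Z \<in> borel_measurable lebesgue" "Y \<in> borel_measurable lebesgue"
      unfolding Z_def[abs_def] Y_def[abs_def] by measurable
    have Yi: "integrable lebesgue Y" "I = (LINT x|lebesgue. Y x)"
      using int by (simp_all add: Y_def[abs_def] I_def)
    have Z0: "Z x \<ge> 0" for x
      using \<eta>(3)[of x] by (simp add: Z_def)
    define K where "K = closure {x. \<eta> x \<noteq> 0}"
    have K: "compact K" using \<eta>(2) by (simp add: K_def compactly_supported_def)
    have \<eta>0: "\<eta> x = 0" if "x \<notin> K" for x
      using that unfolding K_def by (rule compactly_supported_eq_0)
    have Zi: "integrable lebesgue Z"
    proof (rule Bochner_Integration.integrable_bound)
      show "integrable lebesgue (\<lambda>x. m powr (- \<alpha> - 1) * (indicator K x * norm (Au x) powr q))"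
        using Lp_loc_1_set_integrable[OF Aq K] by (intro integrable_mult_right) (simp add: set_integrable_def)
      show "AE x in lebesgue. norm (Z x) \<le> norm (m powr (- \<alpha> - 1) * (indicator K x * norm (Au x) powr q))"
        using u0
      proof eventually_elim
        case (elim x)
        show ?case
        proof (cases "x \<in> K")
          case True
          have "Z x \<le> m powr (- \<alpha> - 1) * (norm (Au x) powr q * 1)"
            unfolding Z_def using mono[OF elim, of "\<alpha> + 1"] \<alpha>(1) \<eta>(3)[of x]
            by (intro mult_mono mult_left_mono) auto
          then show ?thesis using True Z0[of x] by simp
        qed (simp add: Z_def \<eta>0)
      qed
    qed measurable
    \<comment> \<open>Used with s = -\<alpha> for the first test and s = 0 for the second. The
      factor \<eta>^(1/q) in the gradient bound becomes \<eta> after taking the power q. The other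
      factor leaves the power p s + \<sigma> of u + m, and since p s <= 0 and u + m >= m its part p
      s is moved onto m.\<close>
    have young: "norm (Au x) * norm (grad_L X \<eta> x) * (u x + m) powr s \<le>
        r * Z x + r powr (1 - p) * (c1 powr p * R powr (- p) * m powr (p * s) * Y x)"
      if u: "u x \<ge> 0" and r: "r > 0" and s: "s \<le> 0" for x s r
    proof (cases "x \<in> B")
      case True
      define v where "v = u x + m"
      have v: "v > 0" "v \<ge> m" using u m by (auto simp: v_def)
      define a1 where "a1 = v powr (- (\<alpha> + 1) / q) * norm (Au x) * \<eta> x powr (1 / q)"
      define a2 where "a2 = v powr (s + (\<alpha> + 1) / q) * (c1 / R)"
      have nn: "a1 \<ge> 0" "a2 \<ge> 0"
        using c1 R by (simp_all add: a1_def a2_def)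
      have "norm (Au x) * norm (grad_L X \<eta> x) * v powr s \<le>
          norm (Au x) * (c1 / R * \<eta> x powr (1 / q)) * v powr s"
        using grad[of x] by (intro mult_right_mono mult_left_mono) (auto simp: q_def)
      also have "\<dots> = a1 * a2"
      proof -
        have "s = - (\<alpha> + 1) / q + (s + (\<alpha> + 1) / q)"
          using q(1) by (simp add: field_simps)
        then have "v powr s = v powr (- (\<alpha> + 1) / q) * v powr (s + (\<alpha> + 1) / q)"
          by (metis powr_add)
        then show ?thesis by (simp add: a1_def a2_def mult_ac)
      qed
      also have "\<dots> \<le> r * a1 powr q + r powr (1 - p) * a2 powr p"
        by (rule Young_scaled[OF p q(2) nn r])
      also have "a1 powr q = Z x"
        using q(1) \<eta>(3)[of x] by (simp add: a1_def Z_def v_def powr_mult powr_powr mult.assoc)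
      also have "a2 powr p = c1 powr p * R powr (- p) * v powr (p * s + \<sigma>)"
      proof -
        have "p * ((\<alpha> + 1) / q) = \<sigma>"
          using pq \<alpha>(2) by (metis mult.commute times_divide_eq_right times_divide_eq_left)
        then have "(s + (\<alpha> + 1) / q) * p = p * s + \<sigma>"
          by (simp add: algebra_simps)
        then show ?thesis
          using c1 R by (simp add: a2_def powr_mult powr_powr powr_divide powr_minus_divide mult_ac)
      qed
      also have "v powr (p * s + \<sigma>) \<le> m powr (p * s) * Y x"
      proof -
        have "v powr (p * s) \<le> m powr (p * s)"
          using v m s p by (intro powr_mono2') (auto simp: mult_nonneg_nonpos)
        then show ?thesis
          using True by (simp add: Y_def powr_add v_def[symmetric] mult_right_mono)
      qed
      finally show ?thesis
        using r c1 R by (simp add: v_def mult_left_mono mult.assoc)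
    next
      case False
      then have "norm (grad_L X \<eta> x) = 0"
        using grad[of x] \<eta>(4)[OF False] by simp
      then show ?thesis
        using \<eta>(4)[OF False] by (simp add: Z_def Y_def False)
    qed
    let ?c = "c1 powr p * R powr (- p)"
    define T where "T x = F' (u x) * \<eta> x * (Au x \<bullet> weak_grad_L X u x) + F (u x) * (Au x \<bullet> grad_L X \<eta> x)" for x
    note test = supersolution_test[OF p A sol u0 F1 F2 _ F4 F5 _ _ \<eta>(1,2) conjunct1[OF \<eta>(3)], folded Au_def]
    have Fm: "F \<in> borel_measurable borel" "F' \<in> borel_measurable borel" "\<And>t. F t \<ge> 0"
      by (simp_all add: F_def[abs_def] F'_def[abs_def])
    have Ti: "integrable lebesgue T" "(LINT x|lebesgue. h x * (F (u x) * \<eta> x)) \<le> (LINT x|lebesgue. T x)"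
      unfolding T_def[abs_def] using test(1,3) Fm by blast+
    \<comment> \<open>Of the source term in the first test only the sign is kept; the mass of
      \<open>h\<close> is estimated by the second test.\<close>
    have "0 \<le> (LINT x|lebesgue. h x * (F (u x) * \<eta> x))"
      by (rule integral_nonneg_AE) (use h0 in eventually_elim, use Fm(3) \<eta>(3) in simp)
    also note Ti(2)
    also have "(LINT x|lebesgue. T x) \<le>
        (LINT x|lebesgue. - l * Z x + l powr (1 - p) * (?c * m powr (p * (- \<alpha>)) * Y x))"
    proof (rule integral_mono_AE[OF Ti(1)])
      show "integrable lebesgue (\<lambda>x. - l * Z x + l powr (1 - p) * (?c * m powr (p * (- \<alpha>)) * Y x))"
        by (intro Bochner_Integration.integrable_add integrable_mult_right Zi Yi)
      show "AE x in lebesgue. T x \<le> - l * Z x + l powr (1 - p) * (?c * m powr (p * (- \<alpha>)) * Y x)"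
        using u0
      proof eventually_elim
        case (elim x)
        \<comment> \<open>\<open>F\<close> is decreasing, so the coercivity bound from below becomes
          a bound from above.\<close>
        have "F' (u x) * \<eta> x * (Au x \<bullet> weak_grad_L X u x) \<le> F' (u x) * \<eta> x * (k * norm (Au x) powr q)"
          using k(2)[of x "u x" "weak_grad_L X u x"] \<alpha>(1) \<eta>(3)[of x]
          by (intro mult_left_mono_neg) (auto simp: F'_def Au_def q_def mult_nonpos_nonneg)
        also have "\<dots> = - (2 * l) * Z x"
          by (simp add: F'_def Z_def l_def)
        finally have 1: "F' (u x) * \<eta> x * (Au x \<bullet> weak_grad_L X u x) \<le> - (2 * l) * Z x" .
        have "F (u x) * (Au x \<bullet> grad_L X \<eta> x) \<le> F (u x) * (norm (Au x) * norm (grad_L X \<eta> x))"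
          using norm_cauchy_schwarz Fm(3) by (intro mult_left_mono) auto
        also have "\<dots> = norm (Au x) * norm (grad_L X \<eta> x) * (u x + m) powr (- \<alpha>)"
          by (simp add: F_def)
        also have "\<dots> \<le> l * Z x + l powr (1 - p) * (?c * m powr (p * (- \<alpha>)) * Y x)"
          using young[OF elim l, of "- \<alpha>"] \<alpha>(1) by simp
        finally show ?case
          using 1 by (simp add: T_def)
      qed
    qed
    also have "\<dots> = - l * (LINT x|lebesgue. Z x) + l powr (1 - p) * (?c * m powr (p * (- \<alpha>)) * I)"
      using Zi Yi by simp
    finally have "l * (LINT x|lebesgue. Z x) \<le> l powr (1 - p) * (?c * m powr (p * (- \<alpha>)) * I)"
      by simp
    then have "(LINT x|lebesgue. Z x) \<le> l powr (1 - p) * (?c * m powr (p * (- \<alpha>)) * I) / l"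
      using l by (simp only: pos_le_divide_eq mult.commute[of _ l])
    then have IZ: "(LINT x|lebesgue. Z x) \<le> C1 * R powr (- p) * m powr (p * (- \<alpha>)) * I"
      by (simp add: C1_def mult_ac)
    \<comment> \<open>This choice balances the two terms: r m^(-p\<alpha>) and r^(1-p) are both
      m^(p-1-\<sigma>).\<close>
    define r where "r = m powr \<alpha>"
    have r: "r > 0" using m by (simp add: r_def)
    have "AE x in lebesgue. \<bar>Au x \<bullet> grad_L X \<eta> x\<bar> \<le> r * Z x + r powr (1 - p) * (?c * Y x)"
      using u0
    proof eventually_elim
      case (elim x)
      have "\<bar>Au x \<bullet> grad_L X \<eta> x\<bar> \<le> norm (Au x) * norm (grad_L X \<eta> x) * (u x + m) powr 0"
        using Cauchy_Schwarz_ineq2[of "Au x" "grad_L X \<eta> x"] elim m by simp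
      also have "\<dots> \<le> r * Z x + r powr (1 - p) * (?c * Y x)"
        using young[OF elim r, of 0] m by simp
      finally show ?case .
    qed
    note b = this
    have bi: "integrable lebesgue (\<lambda>x. r * Z x + r powr (1 - p) * (?c * Y x))"
      by (intro Bochner_Integration.integrable_add integrable_mult_right Zi Yi)
    have Agi: "integrable lebesgue (\<lambda>x. Au x \<bullet> grad_L X \<eta> x)"
    proof (rule Bochner_Integration.integrable_bound[OF bi])
      show "AE x in lebesgue. norm (Au x \<bullet> grad_L X \<eta> x) \<le> norm (r * Z x + r powr (1 - p) * (?c * Y x))"
        using b by eventually_elim simp
    qed measurable
    note test1
    also have "(LINT x|lebesgue. Au x \<bullet> grad_L X \<eta> x) \<le> (LINT x|lebesgue. r * Z x + r powr (1 - p) * (?c * Y x))"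
      by (rule integral_mono_AE[OF Agi bi]) (use b in eventually_elim, simp)
    also have "\<dots> = r * (LINT x|lebesgue. Z x) + r powr (1 - p) * (?c * I)"
      using Zi Yi by simp
    also have "\<dots> \<le> r * (C1 * R powr (- p) * m powr (p * (- \<alpha>)) * I) + r powr (1 - p) * (?c * I)"
      using IZ r by (intro add_right_mono mult_left_mono) auto
    also have "\<dots> = C * R powr (- p) * m powr (p - 1 - \<sigma>) * I"
    proof -
      have e: "\<alpha> + p * (- \<alpha>) = p - 1 - \<sigma>" "\<alpha> * (1 - p) = p - 1 - \<sigma>"
        unfolding \<alpha>(2)[symmetric] by (simp_all add: algebra_simps)
      have "r * m powr (p * (- \<alpha>)) = m powr (\<alpha> + p * (- \<alpha>))"
        by (simp only: r_def powr_add)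
      then have 1: "r * m powr (p * (- \<alpha>)) = m powr (p - 1 - \<sigma>)"
        by (simp only: e)
      have 2: "r powr (1 - p) = m powr (p - 1 - \<sigma>)"
        by (simp only: r_def powr_powr e)
      have "r * (C1 * R powr (- p) * m powr (p * (- \<alpha>)) * I) = C1 * R powr (- p) * (r * m powr (p * (- \<alpha>))) * I"
        by (simp only: mult_ac)
      then show ?thesis
        unfolding 1 2 by (simp add: C_def algebra_simps)
    qed
    finally show "(LINT x|lebesgue. h x * \<eta> x) \<le> C * R powr (- p) * m powr (p - 1 - \<sigma>) *
        (LINT x|lebesgue. indicator B x * (u x + m) powr \<sigma>)"
      by (simp add: I_def)
  qed
qed

section \<open>Cutoff functions adapted to the dilations\<close>

context
  fixes S :: "real ^ 'n \<Rightarrow> real"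
  assumes S: "homogeneous_norm ginv wt S"
begin

lemma bounded_subset_hball:
  assumes "bounded B"
  obtains R where "R > 0" "B \<subseteq> hball S R"
proof -
  obtain b where b: "\<And>x. x \<in> B \<Longrightarrow> norm x \<le> b"
    using assms unfolding bounded_iff by blast
  have "compact (S ` cball 0 b)"
    by (intro compact_continuous_image compact_cball continuous_on_subset[OF S_continuous[OF S]]) simp
  from compact_imp_bounded[OF this] obtain c where c: "\<forall>y\<in>S ` cball 0 b. norm y \<le> c"
    unfolding bounded_iff by (elim exE)
  have "B \<subseteq> hball S (\<bar>c\<bar> + 1)"
  proof
    fix x assume "x \<in> B"
    then have "norm (S x) \<le> c" using c b by simp
    then show "x \<in> hball S (\<bar>c\<bar> + 1)" by (simp add: hball_def)
  qed
  then show thesis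
    using that[of "\<bar>c\<bar> + 1"] by simp
qed

text \<open>\<eta> is the N-th power of a bump function composed with the dilation by 1/R.
  Homogeneity of the fields gives the factor 1/R, and N >= p gives N - 1 >= N/p', so a factor
  \<eta>^(1/p') remains after differentiation. A bump is not constant near the origin, hence the
  lower bound \<open>c0\<close> in place of the value 1.\<close>

lemma cutoff:
  assumes p: "p > 1"
  obtains \<kappa> c0 c1 where "\<kappa> \<ge> 1" "c0 > 0" "c1 > 0"
    "\<forall>R>0. \<exists>\<eta>. Ck 1 \<eta> \<and> compactly_supported \<eta> \<and> (\<forall>x. 0 \<le> \<eta> x \<and> \<eta> x \<le> 1) \<and>
      (\<forall>x\<in>hball S R. c0 \<le> \<eta> x) \<and> (\<forall>x. x \<notin> hball S (2 * \<kappa> * R) \<longrightarrow> \<eta> x = 0) \<and>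
      (\<forall>x. norm (grad_L X \<eta> x) \<le> c1 / R * \<eta> x powr (1 / conj_exponent p))"
proof -
  obtain b0 where b0: "\<And>x. x \<in> hball S 1 \<Longrightarrow> norm x \<le> b0"
    using bounded_hball[OF S, of 1] unfolding bounded_iff by blast
  define b where "b = \<bar>b0\<bar> + 1"
  have b: "b > 0" "\<And>x. x \<in> hball S 1 \<Longrightarrow> norm x < b"
    using b0 by (fastforce simp: b_def)+
  define \<psi> where "\<psi> = (bump b :: real ^ 'n \<Rightarrow> real)"
  have \<psi>: "smooth \<psi>" "\<And>x. 0 \<le> \<psi> x" "\<And>x. \<psi> x \<le> 1" "\<And>x. norm x \<ge> b \<Longrightarrow> \<psi> x = 0"
    using b(1) by (simp_all add: \<psi>_def smooth_bump bump_nonneg bump_le_1 bump_eq_0)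
  define N where "N = nat \<lceil>p\<rceil> + 1"
  have N: "real N \<ge> p" "N > 1"
    using p by (auto simp: N_def) linarith+
  have \<psi>c: "continuous_on UNIV \<psi>"
    by (rule smooth_continuous[OF \<psi>(1)])
  have "\<exists>c>0. \<forall>x\<in>hball S 1. c \<le> \<psi> x"
  proof -
    have "\<exists>x\<in>cball 0 \<bar>b0\<bar>. \<forall>y\<in>cball 0 \<bar>b0\<bar>. \<psi> x \<le> \<psi> y"
      by (intro continuous_attains_inf continuous_on_subset[OF \<psi>c]) auto
    then obtain x where x: "x \<in> cball 0 \<bar>b0\<bar>" "\<And>y. y \<in> cball 0 \<bar>b0\<bar> \<Longrightarrow> \<psi> x \<le> \<psi> y"
      by blast
    have "norm x < b" using x(1) by (simp add: b_def)
    then have "\<psi> x > 0"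
      using bump_pos_iff[OF b(1), of x] by (simp add: \<psi>_def)
    moreover have "\<psi> x \<le> \<psi> y" if "y \<in> hball S 1" for y
      using b0[OF that] by (intro x(2)) simp
    ultimately show ?thesis by blast
  qed
  then obtain c where c: "c > 0" "\<And>x. x \<in> hball S 1 \<Longrightarrow> c \<le> \<psi> x"
    by blast
  obtain \<kappa>' where \<kappa>': "\<kappa>' > 0" "cball 0 b \<subseteq> hball S \<kappa>'"
    using bounded_subset_hball[OF bounded_cball] .
  \<comment> \<open>The support already lies in the ball of radius \<kappa> R; it is recorded in
    radius 2 \<kappa> R, so that half of this radius is still at least R when Harnack is
    applied.\<close>
  define \<kappa> where "\<kappa> = max 1 \<kappa>'"
  have \<psi>1: "Ck 1 \<psi>" using \<psi>(1) by (simp add: smooth_def)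
  have g0: "grad_L X \<psi> x = 0" if "x \<notin> cball 0 b" for x
  proof (rule grad_L_eq_0)
    have "closure {x. \<psi> x \<noteq> 0} \<subseteq> cball 0 b"
      by (rule closure_minimal) (use \<psi>(4) in \<open>force simp: not_le\<close>, simp)
    then show "x \<notin> closure {x. \<psi> x \<noteq> 0}" using that by blast
  qed
  have "compact (grad_L X \<psi> ` cball 0 b)"
    by (intro compact_continuous_image compact_cball continuous_on_subset[OF continuous_grad_L[OF \<psi>1]]) simp
  from compact_imp_bounded[OF this] obtain c2 where c2: "\<forall>y\<in>grad_L X \<psi> ` cball 0 b. norm y \<le> c2"
    unfolding bounded_iff by (elim exE)
  have g: "norm (grad_L X \<psi> x) \<le> \<bar>c2\<bar>" for x
  proof (cases "x \<in> cball 0 b")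
    case True
    then have "norm (grad_L X \<psi> x) \<le> c2" using c2 by blast
    then show ?thesis by linarith
  qed (simp add: g0)
  define c1 where "c1 = real N * \<bar>c2\<bar> + 1"
  show thesis
  proof (rule that[of \<kappa> "c ^ N" c1]; (intro allI impI)?)
    fix R :: real assume R: "R > 0"
    let ?\<delta> = "dilation wt (1 / R)"
    have R': "1 / R > 0" using R by simp
    define \<eta> where "\<eta> x = \<psi> (?\<delta> x) ^ N" for x
    have sm: "smooth (\<lambda>x. \<psi> (?\<delta> x))"
      by (rule smooth_compose[OF \<psi>(1) smooth_bounded_linear[OF bounded_linear_dilation]])
    have bound: "0 \<le> \<eta> x \<and> \<eta> x \<le> 1" for x
      using \<psi>(2,3) by (simp add: \<eta>_def power_le_one)
    have vim: "?\<delta> x \<in> hball S t \<longleftrightarrow> x \<in> hball S (t * R)" for x t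
      using R by (simp add: hball_def S_dilation[OF S R'] pos_divide_less_eq)
    have supp: "\<eta> x = 0" if x: "x \<notin> hball S (2 * \<kappa> * R)" for x
    proof -
      have "\<kappa>' * R \<le> 2 * \<kappa> * R" using \<kappa>'(1) R by (intro mult_right_mono) (auto simp: \<kappa>_def)
      then have "x \<notin> hball S (\<kappa>' * R)" using x by (auto simp: hball_def)
      then have "?\<delta> x \<notin> cball 0 b" using \<kappa>'(2) vim by blast
      then show ?thesis using N(2) by (simp add: \<eta>_def \<psi>(4))
    qed
    have "{x. \<eta> x \<noteq> 0} \<subseteq> hball S (2 * \<kappa> * R)"
      using supp by blast
    then have "bounded {x. \<eta> x \<noteq> 0}"
      by (rule bounded_subset[OF bounded_hball[OF S]])
    then have cs: "compactly_supported \<eta>"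
      by (simp add: compactly_supported_def compact_closure)
    have grad: "norm (grad_L X \<eta> x) \<le> c1 / R * \<eta> x powr (1 / conj_exponent p)" for x
    proof -
      let ?D = "frechet_derivative \<psi> (at (?\<delta> x))"
      have D: "(\<psi> has_derivative ?D) (at (?\<delta> x))"
        by (rule smooth_has_derivative[OF \<psi>(1)])
      have "((\<lambda>x. \<psi> (?\<delta> x)) has_derivative (\<lambda>v. ?D (?\<delta> v))) (at x)"
        by (rule has_derivative_compose[OF bounded_linear_imp_has_derivative[OF bounded_linear_dilation] D])
      from has_derivative_power[OF this, of N]
      have "(\<eta> has_derivative (\<lambda>v. real N * ?D (?\<delta> v) * \<psi> (?\<delta> x) ^ (N - 1))) (at x)"
        by (simp add: \<eta>_def[abs_def] mult_ac)
      from frechet_derivative_at[OF this, symmetric]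
      have 1: "grad_L X \<eta> x $ i = real N * ?D (?\<delta> (X i x)) * \<psi> (?\<delta> x) ^ (N - 1)" for i
        by (simp add: grad_L_def)
      have 2: "?D (?\<delta> (X i x)) = ?D (X i (?\<delta> x)) / R" for i
        unfolding X_dilation[OF R'] linear_cmul[OF has_derivative_linear[OF D]] by simp
      have "grad_L X \<eta> x = (real N * \<psi> (?\<delta> x) ^ (N - 1) / R) *\<^sub>R grad_L X \<psi> (?\<delta> x)"
        unfolding vec_eq_iff 1 2 by (simp add: grad_L_def)
      then have "norm (grad_L X \<eta> x) = real N * \<psi> (?\<delta> x) ^ (N - 1) / R * norm (grad_L X \<psi> (?\<delta> x))"
        using R \<psi>(2) by simp
      also have "\<dots> \<le> real N * \<psi> (?\<delta> x) ^ (N - 1) / R * \<bar>c2\<bar>"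
        using g R \<psi>(2) by (intro mult_left_mono) auto
      also have "\<dots> \<le> c1 / R * \<psi> (?\<delta> x) ^ (N - 1)"
        using R \<psi>(2)[of "?\<delta> x"] by (simp add: c1_def field_simps)
      also have "c1 / R * \<psi> (?\<delta> x) ^ (N - 1) \<le> c1 / R * \<eta> x powr (1 / conj_exponent p)"
      proof (rule mult_left_mono, cases "\<psi> (?\<delta> x) = 0")
        case False
        then have pos: "\<psi> (?\<delta> x) > 0" using \<psi>(2)[of "?\<delta> x"] by linarith
        have e: "real N * (1 / conj_exponent p) \<le> real (N - 1)"
        proof -
          have "real N * (1 / conj_exponent p) = real N - real N / p"
            using p by (simp add: conj_exponent_def field_simps)
          moreover have "real N / p \<ge> 1" using N(1) p by simp
          ultimately show ?thesis using N(2) by simp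
        qed
        have "\<psi> (?\<delta> x) ^ (N - 1) = \<psi> (?\<delta> x) powr real (N - 1)"
          using pos by (simp add: powr_realpow)
        also have "\<dots> \<le> \<psi> (?\<delta> x) powr (real N * (1 / conj_exponent p))"
          by (rule powr_mono'[OF e]) (use \<psi>(2,3) in auto)
        also have "\<dots> = \<eta> x powr (1 / conj_exponent p)"
          using pos by (simp add: \<eta>_def powr_realpow[symmetric] powr_powr)
        finally show "\<psi> (?\<delta> x) ^ (N - 1) \<le> \<eta> x powr (1 / conj_exponent p)" .
      qed (use N(2) R in \<open>simp_all add: power_0_left c1_def\<close>)
      finally show ?thesis .
    qed
    show "\<exists>\<eta>. Ck 1 \<eta> \<and> compactly_supported \<eta> \<and> (\<forall>x. 0 \<le> \<eta> x \<and> \<eta> x \<le> 1) \<and>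
      (\<forall>x\<in>hball S R. c ^ N \<le> \<eta> x) \<and> (\<forall>x. x \<notin> hball S (2 * \<kappa> * R) \<longrightarrow> \<eta> x = 0) \<and>
      (\<forall>x. norm (grad_L X \<eta> x) \<le> c1 / R * \<eta> x powr (1 / conj_exponent p))"
    proof (intro exI[of _ \<eta>] conjI ballI allI impI)
      show "Ck 1 \<eta>"
        using smooth_power[OF sm, of N] by (simp add: smooth_def \<eta>_def[abs_def])
      show "c ^ N \<le> \<eta> x" if "x \<in> hball S R" for x
        unfolding \<eta>_def using c vim[of x 1] that by (intro power_mono) auto
    qed (use bound cs supp grad in simp_all)
  qed (use c(1) in \<open>simp_all add: \<kappa>_def c1_def add_nonneg_pos\<close>)
qed

end

end

section \<open>Profile of a supersolution on large balls, and lower bounds for its source\<close>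

lemma Lp_loc_integrable_indicator_bounded:
  fixes h :: "real ^ 'n::finite \<Rightarrow> real"
  assumes "Lp_loc 1 h" "bounded B" "B \<in> sets lebesgue"
  shows "integrable lebesgue (\<lambda>x. indicator B x * h x)"
proof -
  have "set_integrable lebesgue (closure B) h"
    by (rule Lp_loc_1_set_integrable[OF assms(1)]) (simp add: assms(2))
  then have "set_integrable lebesgue B h"
    by (rule set_integrable_subset) (use assms(3) closure_subset in auto)
  then show ?thesis by (simp add: set_integrable_def)
qed

context homogeneous_carnot_group
begin

context
  fixes S :: "real ^ 'n \<Rightarrow> real"
  assumes S: "homogeneous_norm ginv wt S"
begin

lemma hball_sets: "hball S R \<in> sets lebesgue"
  by (rule fmeasurableD[OF hball_lmeasurable[OF S]])

lemma integrable_indicator_hball: "integrable lebesgue (indicator (hball S R) :: _ \<Rightarrow> real)"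
  using hball_lmeasurable[OF S] by (simp add: lmeasurable_iff_integrable)

lemma integral_indicator_hball:
  assumes "R > 0"
  shows "(LINT x|lebesgue. indicator (hball S R) x) =
    R powr real (homogeneous_dim wt r) * measure lebesgue (hball S 1)"
  using measure_hball[OF S assms] by simp

text \<open>Condenses a supersolution into one positive function \<open>M\<close> of the radius, so
  that the growth argument is free of PDE. It is applied to \<open>u\<close> with source f(v) and to
  \<open>v\<close> with source g(u); the Harnack inequality supplies both the positivity of
  \<open>M\<close> and the moment bound.\<close>

lemma supersolution_profile:
  fixes A :: "('n, 'l) operator"
  assumes p: "p > 1" and A: "caratheodory A" "weakly_coercive p A" "weak_harnack X S p A"
    and sol: "weak_supersolution X p A h u" and u0: "AE x in lebesgue. u x > 0"
    and h0: "AE x in lebesgue. h x \<ge> 0"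
  defines "Q \<equiv> real (homogeneous_dim wt r)"
  obtains M C \<sigma> where "C > 0" "\<sigma> > 0" "\<forall>R>0. M R > 0"
    "\<forall>R>0. AE x in lebesgue. x \<in> hball S R \<longrightarrow> M R \<le> u x"
    "\<forall>R>0. integrable lebesgue (\<lambda>x. indicator (hball S R) x * u x powr \<sigma>)"
    "\<forall>R>0. (LINT x|lebesgue. indicator (hball S R) x * u x powr \<sigma>) \<le> C * R powr Q * M R powr \<sigma>"
    "\<forall>R>0. (LINT x|lebesgue. indicator (hball S R) x * h x) \<le> C * R powr (Q - p) * M R powr (p - 1)"
    "ess_inf UNIV u = 0 \<longrightarrow> (\<forall>\<delta>>0. \<exists>R0>0. \<forall>R\<ge>R0. M R < \<delta>)"
proof -
  have u0': "AE x in lebesgue. u x \<ge> 0"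
    using u0 by eventually_elim simp
  have h1: "Lp_loc 1 h" and um [measurable]: "u \<in> borel_measurable lebesgue"
    using sol by (auto simp: weak_supersolution_def W1p_loc_def Lp_loc_def)
  obtain k where k: "k > 0" "\<And>x t \<xi>. A x t \<xi> \<bullet> \<xi> \<ge> k * norm (A x t \<xi>) powr conj_exponent p"
    using A(2) unfolding weakly_coercive_def by blast
  \<comment> \<open>The source is nonnegative, so \<open>u\<close> also solves the homogeneous
    inequality, for which the weak Harnack inequality is stated.\<close>
  have sol0: "weak_supersolution X p A (\<lambda>x. 0) u"
    unfolding weak_supersolution_def
  proof (intro conjI allI impI)
    show "Lp_loc 1 (\<lambda>x::real ^ 'n. 0::real)"
      by (simp add: Lp_loc_def set_integrable_def)
    fix \<phi> :: "real ^ 'n \<Rightarrow> real" assume \<phi>: "Ck 1 \<phi> \<and> compactly_supported \<phi> \<and> (\<forall>x. 0 \<le> \<phi> x)"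
    have "0 \<le> (LINT x|lebesgue. h x * \<phi> x)"
      by (rule integral_nonneg_AE) (use h0 in eventually_elim, use \<phi> in simp)
    also have "\<dots> \<le> (LINT x|lebesgue. A x (u x) (weak_grad_L X u x) \<bullet> grad_L X \<phi> x)"
      using sol \<phi> by (simp add: weak_supersolution_def)
    finally show "(LINT x|lebesgue. 0 * \<phi> x) \<le> (LINT x|lebesgue. A x (u x) (weak_grad_L X u x) \<bullet> grad_L X \<phi> x)"
      by simp
  qed (use sol in \<open>auto simp: weak_supersolution_def\<close>)
  obtain \<sigma> cH where \<sigma>: "\<sigma> > p - 1" and cH: "cH > 0"
    and H: "\<And>R. R > 0 \<Longrightarrow> set_integrable lebesgue (hball S R) (\<lambda>x. u x powr \<sigma>)"
      "\<And>R. R > 0 \<Longrightarrow> ereal ((1 / measure lebesgue (hball S R) * (LINT x:hball S R|lebesgue. u x powr \<sigma>)) powr (1 / \<sigma>))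
        \<le> ereal cH * ess_inf (hball S (R / 2)) u"
    using A(3)[unfolded weak_harnack_def] sol0 u0' by blast
  have \<sigma>0: "\<sigma> > 0" using \<sigma> p by simp
  obtain \<kappa> c0 c1 where \<kappa>: "\<kappa> \<ge> 1" and c: "c0 > 0" "c1 > 0"
    and cut: "\<forall>R>0. \<exists>\<eta>. Ck 1 \<eta> \<and> compactly_supported \<eta> \<and> (\<forall>x. 0 \<le> \<eta> x \<and> \<eta> x \<le> 1) \<and>
      (\<forall>x\<in>hball S R. c0 \<le> \<eta> x) \<and> (\<forall>x. x \<notin> hball S (2 * \<kappa> * R) \<longrightarrow> \<eta> x = 0) \<and>
      (\<forall>x. norm (grad_L X \<eta> x) \<le> c1 / R * \<eta> x powr (1 / conj_exponent p))"
    by (rule cutoff[OF S p])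
  obtain C0 where C0: "C0 > 0"
    and est: "\<forall>h u \<eta> R m B. weak_supersolution X p A h u \<longrightarrow> (AE x in lebesgue. u x \<ge> 0) \<longrightarrow>
      (AE x in lebesgue. h x \<ge> 0) \<longrightarrow>
      Ck 1 \<eta> \<longrightarrow> compactly_supported \<eta> \<longrightarrow> (\<forall>x. 0 \<le> \<eta> x \<and> \<eta> x \<le> 1) \<longrightarrow> (\<forall>x. x \<notin> B \<longrightarrow> \<eta> x = 0) \<longrightarrow>
      R > 0 \<longrightarrow> (\<forall>x. norm (grad_L X \<eta> x) \<le> c1 / R * \<eta> x powr (1 / conj_exponent p)) \<longrightarrow>
      m > 0 \<longrightarrow> B \<in> sets lebesgue \<longrightarrow> integrable lebesgue (\<lambda>x. indicator B x * (u x + m) powr \<sigma>) \<longrightarrow>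
      (LINT x|lebesgue. h x * \<eta> x) \<le>
        C0 * R powr (- p) * m powr (p - 1 - \<sigma>) * (LINT x|lebesgue. indicator B x * (u x + m) powr \<sigma>)"
    by (rule supersolution_mass_le[OF p A(1) k \<sigma> c(2)])
  \<comment> \<open>The radius is half that of the ball \<open>?B R\<close> carrying the cutoff, so
    Harnack on \<open>?B R\<close> compares exactly with \<open>e R\<close>.\<close>
  define e where "e R = ess_inf (hball S (\<kappa> * R)) u" for R
  define M where "M R = real_of_ereal (e R)" for R
  let ?B = "\<lambda>R. hball S (2 * \<kappa> * R)"
  define V where "V = measure lebesgue (hball S 1)"
  have V: "V > 0" unfolding V_def by (rule measure_hball_pos[OF S]) simp
  have pos: "2 * \<kappa> * R > 0" "\<kappa> * R > 0" if "R > 0" for R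
    using that \<kappa> by auto
  have mB: "measure lebesgue (?B R) = (2 * \<kappa>) powr Q * R powr Q * V" if "R > 0" for R
    using measure_hball[OF S pos(1)[OF that]] \<kappa> that by (simp add: V_def Q_def powr_mult)
  have mBpos: "measure lebesgue (?B R) > 0" if "R > 0" for R
    by (rule measure_hball_pos[OF S pos(1)[OF that]])
  let ?J = "\<lambda>R. LINT x|lebesgue. indicator (?B R) x * u x powr \<sigma>"
  have Ji: "integrable lebesgue (\<lambda>x. indicator (?B R) x * u x powr \<sigma>)" if "R > 0" for R
    using H(1)[OF pos(1)[OF that]] by (simp add: set_integrable_def)
  have Jpos: "?J R > 0" if R: "R > 0" for R
  proof -
    have "\<not> (AE x in lebesgue. indicator (?B R) x * u x powr \<sigma> = 0)"
    proof
      assume "AE x in lebesgue. indicator (?B R) x * u x powr \<sigma> = 0"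
      then have "AE x in lebesgue. x \<notin> ?B R"
        using u0 by eventually_elim (auto simp: indicator_def)
      then have "?B R \<in> null_sets lebesgue"
        using AE_iff_null_sets[OF hball_sets[of "2 * \<kappa> * R"]] by simp
      then show False
        using mBpos[OF R] measure_eq_0_null_sets by force
    qed
    then have "?J R \<noteq> 0"
      using integral_nonneg_eq_0_iff_AE[OF Ji[OF R]] by simp
    moreover have "?J R \<ge> 0"
      by (intro Bochner_Integration.integral_nonneg) simp
    ultimately show ?thesis by linarith
  qed
  \<comment> \<open>The mean of u^\<sigma> is positive because u > 0 almost everywhere; Harnack
    turns this into a positive lower bound on the smaller ball. Finiteness of the infimum comes from
    the positive measure of that ball.\<close>
  have e_eq: "e R = ereal (M R)" and Mpos: "M R > 0"
    and Jle: "?J R \<le> measure lebesgue (?B R) * (cH powr \<sigma> * M R powr \<sigma>)" if R: "R > 0" for R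
  proof -
    let ?mean = "1 / measure lebesgue (?B R) * ?J R"
    have mean: "?mean > 0"
      using Jpos[OF R] mBpos[OF R] by simp
    have h: "ereal (?mean powr (1 / \<sigma>)) \<le> ereal cH * e R"
      using H(2)[OF pos(1)[OF R]] by (simp add: e_def set_lebesgue_integral_def mult.assoc)
    have "e R < \<infinity>"
      unfolding e_def using measure_hball_pos[OF S pos(2)[OF R]]
      by (intro ess_inf_less_top hball_sets) (auto simp: measure_def)
    moreover have "e R > 0"
    proof (rule ccontr)
      assume "\<not> e R > 0"
      then have "ereal cH * e R \<le> 0"
        using cH by (simp add: ereal_mult_le_0_iff)
      then have "ereal (?mean powr (1 / \<sigma>)) \<le> 0"
        using h order_trans by blast
      then have "?mean powr (1 / \<sigma>) \<le> 0"
        unfolding zero_ereal_def by (simp only: ereal_less_eq)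
      moreover have "?mean \<noteq> 0" using mean by linarith
      then have "?mean powr (1 / \<sigma>) > 0" by (rule iffD2[OF powr_gt_zero])
      ultimately show False by linarith
    qed
    ultimately show *: "e R = ereal (M R)" "M R > 0"
      unfolding M_def by (cases "e R"; simp)+
    have "?mean powr (1 / \<sigma>) \<le> cH * M R"
      using h by (simp add: *)
    then have "(?mean powr (1 / \<sigma>)) powr \<sigma> \<le> (cH * M R) powr \<sigma>"
      using \<sigma>0 by (intro powr_mono2) auto
    then have "?mean \<le> cH powr \<sigma> * M R powr \<sigma>"
      using mean \<sigma>0 by (simp add: powr_powr powr_mult)
    then show "?J R \<le> measure lebesgue (?B R) * (cH powr \<sigma> * M R powr \<sigma>)"
      using mBpos[OF R] by (simp add: field_simps)
  qed
  have AEM: "AE x in lebesgue. x \<in> hball S (\<kappa> * R) \<longrightarrow> M R \<le> u x" if "R > 0" for R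
    by (rule AE_ge_ess_inf[OF hball_sets]) (use e_eq[OF that] in \<open>simp add: e_def\<close>)
  have sub: "hball S R \<subseteq> hball S (\<kappa> * R)" "hball S R \<subseteq> ?B R" if "R > 0" for R
    using \<kappa> that by (intro hball_mono[OF S]; simp)+
  \<comment> \<open>From (u + m)^\<sigma> <= 2^\<sigma> (u^\<sigma> + m^\<sigma>) on
    \<open>?B R\<close>: Harnack bounds the first integral by \<open>cH powr \<sigma>\<close> times
    the second, and the volume gives the remaining factors.\<close>
  define D where "D = 2 powr \<sigma> * ((2 * \<kappa>) powr Q * V * (cH powr \<sigma> + 1))"
  define C where "C = max ((2 * \<kappa>) powr Q * V * cH powr \<sigma>) (C0 * D / c0)"
  have D: "D > 0" using V \<kappa> by (simp add: D_def add_nonneg_pos)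
  have C: "C > 0" using C0 D c by (simp add: C_def less_max_iff_disj)
  show thesis
  proof (rule that[of C \<sigma> M]; (intro allI impI)?)
    fix R :: real assume R: "R > 0"
    show "AE x in lebesgue. x \<in> hball S R \<longrightarrow> M R \<le> u x"
      using AEM[OF R] by eventually_elim (use sub(1)[OF R] in blast)
    show i: "integrable lebesgue (\<lambda>x. indicator (hball S R) x * u x powr \<sigma>)"
      using H(1)[OF R] by (simp add: set_integrable_def)
    have "(LINT x|lebesgue. indicator (hball S R) x * u x powr \<sigma>) \<le> ?J R"
      by (rule integral_mono[OF i Ji[OF R]]) (use sub(2)[OF R] in \<open>auto simp: indicator_def\<close>)
    also have "\<dots> \<le> (2 * \<kappa>) powr Q * V * cH powr \<sigma> * R powr Q * M R powr \<sigma>"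
      using Jle[OF R] mB[OF R] by (simp add: mult_ac)
    also have "\<dots> \<le> C * R powr Q * M R powr \<sigma>"
      unfolding C_def by (intro mult_right_mono) auto
    finally show "(LINT x|lebesgue. indicator (hball S R) x * u x powr \<sigma>) \<le> C * R powr Q * M R powr \<sigma>" .
    show "(LINT x|lebesgue. indicator (hball S R) x * h x) \<le> C * R powr (Q - p) * M R powr (p - 1)"
    proof -
      let ?m = "M R"
      have m: "?m > 0" by (rule Mpos[OF R])
      obtain \<eta> where \<eta>: "Ck 1 \<eta>" "compactly_supported \<eta>" "\<And>x. 0 \<le> \<eta> x \<and> \<eta> x \<le> 1"
        "\<And>x. x \<in> hball S R \<Longrightarrow> c0 \<le> \<eta> x" "\<And>x. x \<notin> ?B R \<Longrightarrow> \<eta> x = 0"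
        "\<And>x. norm (grad_L X \<eta> x) \<le> c1 / R * \<eta> x powr (1 / conj_exponent p)"
        using cut[rule_format, OF R] by blast
      have bd: "integrable lebesgue (\<lambda>x. 2 powr \<sigma> * (indicator (?B R) x * u x powr \<sigma> + ?m powr \<sigma> * indicator (?B R) x))"
        by (intro integrable_mult_right Bochner_Integration.integrable_add Ji[OF R] integrable_indicator_hball)
      have le: "AE x in lebesgue. indicator (?B R) x * (u x + ?m) powr \<sigma> \<le>
          2 powr \<sigma> * (indicator (?B R) x * u x powr \<sigma> + ?m powr \<sigma> * indicator (?B R) x)"
        using u0
      proof eventually_elim
        case (elim x)
        then show ?case
          using powr_add_le[of "u x" ?m \<sigma>] m \<sigma>0 by (simp add: indicator_def)
      qed
      have ji: "integrable lebesgue (\<lambda>x. indicator (?B R) x * (u x + ?m) powr \<sigma>)"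
      proof (rule Bochner_Integration.integrable_bound[OF bd])
        have [measurable]: "?B R \<in> sets lebesgue" by (rule hball_sets)
        show "(\<lambda>x. indicator (?B R) x * (u x + ?m) powr \<sigma>) \<in> borel_measurable lebesgue"
          by measurable
        show "AE x in lebesgue. norm (indicator (?B R) x * (u x + ?m) powr \<sigma>) \<le>
            norm (2 powr \<sigma> * (indicator (?B R) x * u x powr \<sigma> + ?m powr \<sigma> * indicator (?B R) x))"
          using le by eventually_elim simp
      qed
      have "(LINT x|lebesgue. indicator (?B R) x * (u x + ?m) powr \<sigma>) \<le>
          (LINT x|lebesgue. 2 powr \<sigma> * (indicator (?B R) x * u x powr \<sigma> + ?m powr \<sigma> * indicator (?B R) x))"
        by (rule integral_mono_AE[OF ji bd le])
      also have "\<dots> = 2 powr \<sigma> * (?J R + ?m powr \<sigma> * measure lebesgue (?B R))"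
        using Ji[OF R] integrable_indicator_hball[of "2 * \<kappa> * R"] by simp
      also have "\<dots> \<le> 2 powr \<sigma> * (measure lebesgue (?B R) * (cH powr \<sigma> * ?m powr \<sigma>) + ?m powr \<sigma> * measure lebesgue (?B R))"
        using Jle[OF R] by simp
      also have "\<dots> = D * R powr Q * ?m powr \<sigma>"
        unfolding mB[OF R] D_def by (simp add: algebra_simps)
      finally have I: "(LINT x|lebesgue. indicator (?B R) x * (u x + ?m) powr \<sigma>) \<le> D * R powr Q * ?m powr \<sigma>" .
      have hi: "integrable lebesgue (\<lambda>x. \<eta> x * h x)"
        by (rule integrable_continuous_mult[OF h1 Ck_continuous[OF \<eta>(1)], of "closure {x. \<eta> x \<noteq> 0}"])
          (use \<eta>(2) in \<open>auto simp: compactly_supported_def intro: compactly_supported_eq_0\<close>)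
      have "(LINT x|lebesgue. indicator (hball S R) x * h x) \<le> (LINT x|lebesgue. \<eta> x * h x / c0)"
      proof (rule integral_mono_AE)
        show "integrable lebesgue (\<lambda>x. indicator (hball S R) x * h x)"
          by (rule Lp_loc_integrable_indicator_bounded[OF h1 bounded_hball[OF S] hball_sets])
        show "integrable lebesgue (\<lambda>x. \<eta> x * h x / c0)"
          using hi by simp
        show "AE x in lebesgue. indicator (hball S R) x * h x \<le> \<eta> x * h x / c0"
          using h0
        proof eventually_elim
          case (elim x)
          show ?case
          proof (cases "x \<in> hball S R")
            case True
            have "c0 * h x \<le> \<eta> x * h x"
              using \<eta>(4)[OF True] elim by (intro mult_right_mono)
            then show ?thesis using True c(1) by (simp add: pos_le_divide_eq mult.commute)
          qed (use elim \<eta>(3)[of x] c(1) in simp)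
        qed
      qed
      also have "\<dots> = (LINT x|lebesgue. h x * \<eta> x) / c0"
        by (simp add: mult.commute)
      also have "\<dots> \<le> (C0 * R powr (- p) * ?m powr (p - 1 - \<sigma>) * (D * R powr Q * ?m powr \<sigma>)) / c0"
      proof (rule divide_right_mono)
        have "(LINT x|lebesgue. h x * \<eta> x) \<le> C0 * R powr (- p) * ?m powr (p - 1 - \<sigma>) *
            (LINT x|lebesgue. indicator (?B R) x * (u x + ?m) powr \<sigma>)"
          by (rule est[rule_format, OF sol u0' h0 \<eta>(1,2,3,5) R \<eta>(6) m hball_sets ji])
        also have "\<dots> \<le> C0 * R powr (- p) * ?m powr (p - 1 - \<sigma>) * (D * R powr Q * ?m powr \<sigma>)"
          using I C0 by (intro mult_left_mono) auto
        finally show "(LINT x|lebesgue. h x * \<eta> x) \<le>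
            C0 * R powr (- p) * ?m powr (p - 1 - \<sigma>) * (D * R powr Q * ?m powr \<sigma>)" .
      qed (use c in simp)
      also have "\<dots> = C0 * D / c0 * R powr (Q - p) * ?m powr (p - 1)"
      proof -
        have "R powr (- p) * R powr Q = R powr (Q - p)" "?m powr (p - 1 - \<sigma>) * ?m powr \<sigma> = ?m powr (p - 1)"
          by (simp_all add: powr_add[symmetric])
        then show ?thesis
          by (metis (no_types, lifting) mult.assoc mult.left_commute times_divide_eq_left)
      qed
      also have "\<dots> \<le> C * R powr (Q - p) * ?m powr (p - 1)"
        unfolding C_def by (intro mult_right_mono) auto
      finally show ?thesis .
    qed
  next
    fix \<delta> :: real assume inf: "ess_inf UNIV u = 0" and \<delta>: "\<delta> > 0"
    have anti: "M R' \<ge> M R" if "R \<ge> R'" "R' > 0" for R R'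
    proof -
      have R: "R > 0" using that by linarith
      have "hball S (\<kappa> * R') \<subseteq> hball S (\<kappa> * R)"
        using that \<kappa> by (intro hball_mono[OF S]) simp
      then have "ereal (M R) \<le> e R'"
        unfolding e_def by (intro ess_inf_ge hball_sets) (use AEM[OF R] in eventually_elim, blast)
      then show ?thesis using e_eq[OF that(2)] by simp
    qed
    show "\<exists>R0>0. \<forall>R\<ge>R0. M R < \<delta>"
    proof (rule ccontr)
      assume contra: "\<not> (\<exists>R0>0. \<forall>R\<ge>R0. M R < \<delta>)"
      \<comment> \<open>\<open>M\<close> is nonincreasing, so if it exceeds \<delta> at arbitrarily
        large radii it does so at all; the balls exhaust the space, and the essential infimum of u
        would be at least \<delta>.\<close>
      have Mge: "M R \<ge> \<delta>" if "R > 0" for R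
      proof -
        from contra that obtain R' where "R' \<ge> R" "\<not> M R' < \<delta>" by blast
        then show ?thesis using anti[of R R'] that by linarith
      qed
      have *: "AE x in lebesgue. x \<in> hball S (\<kappa> * real (Suc n)) \<longrightarrow> \<delta> \<le> u x" for n
        using AEM[of "real (Suc n)", OF of_nat_0_less_iff[THEN iffD2, OF zero_less_Suc]]
        by eventually_elim (use Mge[of "real (Suc n)"] in fastforce)
      have "AE x in lebesgue. \<forall>n. x \<in> hball S (\<kappa> * real (Suc n)) \<longrightarrow> \<delta> \<le> u x"
        by (subst AE_all_countable) (intro allI *)
      then have "AE x in lebesgue. x \<in> UNIV \<longrightarrow> \<delta> \<le> u x"
      proof eventually_elim
        case (elim x)
        obtain n where "S x < real n" using reals_Archimedean2 by blast
        also have "real n \<le> 1 * real (Suc n)" by simp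
        also have "\<dots> \<le> \<kappa> * real (Suc n)" using \<kappa> by (intro mult_right_mono) auto
        finally show ?case using elim by (auto simp: hball_def)
      qed
      then have "ereal \<delta> \<le> ess_inf UNIV u"
        by (intro ess_inf_ge) auto
      then show False using inf \<delta> by simp
    qed
  qed (use C \<sigma>0 Mpos in auto)
qed

text \<open>Since \<open>v \<ge> M R\<close> on the ball and \<open>(v/t\<^sub>0)\<^sup>\<sigma> \<ge> 1\<close> where \<open>v \<ge> t\<^sub>0\<close>, the lower bound on \<open>f(v)\<close>
  near zero yields a bound of its mass in which the set \<open>{v \<ge> t\<^sub>0}\<close> is negligible for large balls.\<close>

lemma mass_lower_bound:
  fixes v :: "real ^ 'n \<Rightarrow> real" and f :: "real \<Rightarrow> real"
  defines "Q \<equiv> real (homogeneous_dim wt r)"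
  assumes Q: "Q > 0" and v0: "AE x in lebesgue. v x > 0"
    and f0: "\<And>t. t > 0 \<Longrightarrow> f t \<ge> 0" and fv: "Lp_loc 1 (\<lambda>x. f (v x))"
    and low: "t0 > 0" "c > 0" "a > 0" "\<And>t. 0 < t \<Longrightarrow> t < t0 \<Longrightarrow> c * t powr a \<le> f t"
    and C: "C > 0" "\<sigma> > 0" and Mpos: "\<And>R. R > 0 \<Longrightarrow> M R > 0"
    and Mle: "\<And>R. R > 0 \<Longrightarrow> AE x in lebesgue. x \<in> hball S R \<longrightarrow> M R \<le> v x"
    and vi: "\<And>R. R > 0 \<Longrightarrow> integrable lebesgue (\<lambda>x. indicator (hball S R) x * v x powr \<sigma>)"
    and vle: "\<And>R. R > 0 \<Longrightarrow> (LINT x|lebesgue. indicator (hball S R) x * v x powr \<sigma>) \<le> C * R powr Q * M R powr \<sigma>"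
    and M0: "\<And>\<delta>. \<delta> > 0 \<Longrightarrow> \<exists>R0>0. \<forall>R\<ge>R0. M R < \<delta>"
  shows "\<exists>c'>0. \<forall>R0\<ge>0. \<exists>R1>0. \<forall>R\<ge>R1. c' * R powr Q * M R powr a \<le>
    (LINT x|lebesgue. indicator (hball S R) x * f (v x)) - (LINT x|lebesgue. indicator (hball S R0) x * f (v x))"
proof -
  define V where "V = measure lebesgue (hball S 1)"
  have V: "V > 0" unfolding V_def by (rule measure_hball_pos[OF S]) simp
  \<comment> \<open>The case R = 0 is included since R0 = 0 is used later: the ball is empty and
    \<open>0 powr Q = 0\<close>.\<close>
  have IB: "(LINT x|lebesgue. indicator (hball S R) x) = R powr Q * V" if "R \<ge> 0" for R
  proof (cases "R = 0")
    case True
    have "hball S 0 = {}"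
      using S_nonneg[OF S] by (auto simp: hball_def not_less)
    then show ?thesis using True Q by simp
  next
    case False
    then show ?thesis using that integral_indicator_hball[of R] by (simp add: V_def Q_def)
  qed
  have fi: "integrable lebesgue (\<lambda>x. indicator (hball S R) x * f (v x))" for R
    by (rule Lp_loc_integrable_indicator_bounded[OF fv bounded_hball[OF S] hball_sets])
  \<comment> \<open>The constant keeps half the volume of the ball: one quarter is lost to the ball
    of radius \<open>R0\<close>, another to the set where \<open>v\<close> is at least
    \<open>t0\<close>.\<close>
  show ?thesis
  proof (rule exI[of _ "c * V / 2"], intro conjI allI impI)
    show "c * V / 2 > 0" using low V by simp
    fix R0 :: real assume R0: "R0 \<ge> 0"
    \<comment> \<open>Solves (\<delta>/t0)^\<sigma> C = V/4, which is the quarter allotted to large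
      values of v.\<close>
    define \<delta> where "\<delta> = t0 * (V / (4 * C)) powr (1 / \<sigma>)"
    have \<delta>: "\<delta> > 0" using low V C by (simp add: \<delta>_def)
    obtain R2 where R2: "R2 > 0" "\<And>R. R \<ge> R2 \<Longrightarrow> M R < \<delta>"
      using M0[OF \<delta>] by blast
    \<comment> \<open>From 4^(1/Q) R0 on, the ball of radius \<open>R0\<close> has at most a quarter
      of the volume.\<close>
    define R1 where "R1 = max R2 (4 powr (1 / Q) * R0)"
    show "\<exists>R1>0. \<forall>R\<ge>R1. c * V / 2 * R powr Q * M R powr a \<le>
        (LINT x|lebesgue. indicator (hball S R) x * f (v x)) - (LINT x|lebesgue. indicator (hball S R0) x * f (v x))"
    proof (intro exI[of _ R1] conjI allI impI)
      show "R1 > 0" using R2 by (simp add: R1_def less_max_iff_disj)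
      fix R assume R1: "R \<ge> R1"
      have R: "R > 0" "M R < \<delta>" "4 powr (1 / Q) * R0 \<le> R"
        using R1 R2 by (auto simp: R1_def intro: less_le_trans)
      have "(4 powr (1 / Q) * R0) powr Q \<le> R powr Q"
        using R R0 Q by (intro powr_mono2) auto
      then have R0R: "R0 powr Q \<le> R powr Q / 4"
        using R0 Q by (simp add: powr_mult powr_powr)
      have "R0 \<le> R"
      proof -
        have "1 \<le> (4::real) powr (1 / Q)" using Q by (intro ge_one_powr_ge_zero) auto
        then have "1 * R0 \<le> 4 powr (1 / Q) * R0" using R0 by (intro mult_right_mono)
        then show ?thesis using R(3) by linarith
      qed
      then have sub: "hball S R0 \<subseteq> hball S R" by (rule hball_mono[OF S])
      have small: "(1 / t0) powr \<sigma> * (C * M R powr \<sigma>) \<le> V / 4"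
      proof -
        have "M R powr \<sigma> \<le> \<delta> powr \<sigma>"
          using R(2) Mpos[OF R(1)] C by (intro powr_mono2) auto
        also have "\<dots> = t0 powr \<sigma> * (V / (4 * C))"
          using low V C by (simp add: \<delta>_def powr_mult powr_powr)
        finally have "(1 / t0) powr \<sigma> * (C * M R powr \<sigma>) \<le> (1 / t0) powr \<sigma> * (C * (t0 powr \<sigma> * (V / (4 * C))))"
          using C by (intro mult_left_mono) auto
        also have "\<dots> = ((1 / t0) * t0) powr \<sigma> * (C * (V / (4 * C)))"
          using low by (subst powr_mult) (auto simp: mult_ac)
        also have "\<dots> = V / 4"
          using low C by simp
        finally show ?thesis .
      qed
      \<comment> \<open>A pointwise minorant of the mass density outside the ball of radius
        \<open>R0\<close>: at most c M^a where M <= v < t0, and nonpositive where v >= t0. No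
        measure of a level set has to be estimated separately.\<close>
      let ?l = "\<lambda>x. c * M R powr a * (indicator (hball S R) x - indicator (hball S R0) x
          - (1 / t0) powr \<sigma> * (indicator (hball S R) x * v x powr \<sigma>))"
      have li: "integrable lebesgue ?l"
        by (intro integrable_mult_right Bochner_Integration.integrable_diff integrable_indicator_hball vi[OF R(1)])
      have "c * V / 2 * R powr Q * M R powr a = c * M R powr a * (R powr Q * V - R powr Q / 4 * V - R powr Q * (V / 4))"
        by (simp add: field_simps)
      also have "\<dots> \<le> c * M R powr a * (R powr Q * V - R0 powr Q * V
          - (1 / t0) powr \<sigma> * (LINT x|lebesgue. indicator (hball S R) x * v x powr \<sigma>))"
      proof (intro mult_left_mono diff_mono order_refl)
        show "R0 powr Q * V \<le> R powr Q / 4 * V"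
          using R0R V by (intro mult_right_mono) auto
        have "(1 / t0) powr \<sigma> * (LINT x|lebesgue. indicator (hball S R) x * v x powr \<sigma>) \<le>
            (1 / t0) powr \<sigma> * (C * R powr Q * M R powr \<sigma>)"
          by (intro mult_left_mono vle R(1)) auto
        also have "\<dots> = R powr Q * ((1 / t0) powr \<sigma> * (C * M R powr \<sigma>))"
          by (simp only: mult_ac)
        also have "\<dots> \<le> R powr Q * (V / 4)"
          using small by (intro mult_left_mono) auto
        finally show "(1 / t0) powr \<sigma> * (LINT x|lebesgue. indicator (hball S R) x * v x powr \<sigma>) \<le> R powr Q * (V / 4)" .
      qed (simp_all add: zero_le_mult_iff less_imp_le[OF low(2)])
      also have "\<dots> = (LINT x|lebesgue. ?l x)"
      proof -
        have I: "(LINT x|lebesgue. ?l x) = c * M R powr a * ((LINT x|lebesgue. indicator (hball S R) x)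
            - (LINT x|lebesgue. indicator (hball S R0) x)
            - (1 / t0) powr \<sigma> * (LINT x|lebesgue. indicator (hball S R) x * v x powr \<sigma>))"
          using vi[OF R(1)] integrable_indicator_hball[of R] integrable_indicator_hball[of R0] by simp
        show ?thesis
          by (simp only: I IB[OF less_imp_le[OF R(1)]] IB[OF R0])
      qed
      also have "\<dots> \<le> (LINT x|lebesgue. indicator (hball S R) x * f (v x) - indicator (hball S R0) x * f (v x))"
      proof (rule integral_mono_AE[OF li])
        show "integrable lebesgue (\<lambda>x. indicator (hball S R) x * f (v x) - indicator (hball S R0) x * f (v x))"
          by (intro Bochner_Integration.integrable_diff fi)
        show "AE x in lebesgue. ?l x \<le> indicator (hball S R) x * f (v x) - indicator (hball S R0) x * f (v x)"
          using Mle[OF R(1)] v0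
        proof eventually_elim
          case (elim x)
          have cM: "c * M R powr a \<ge> 0" using low by simp
          have tv: "(1 / t0) powr \<sigma> * v x powr \<sigma> = (v x / t0) powr \<sigma>"
            using elim(2) low by (simp add: powr_mult[symmetric])
          consider "x \<notin> hball S R" | "x \<in> hball S R0" | "x \<in> hball S R" "x \<notin> hball S R0" by blast
          then show ?case
          proof cases
            case 1
            then have "x \<notin> hball S R0" using sub by blast
            with 1 show ?thesis by simp
          next
            case 2
            then have "x \<in> hball S R" using sub by blast
            with 2 show ?thesis using cM by (simp add: mult_nonneg_nonneg)
          next
            case 3
            show ?thesis
            proof (cases "v x < t0")
              case True
              have "c * M R powr a * (1 - (v x / t0) powr \<sigma>) \<le> c * M R powr a * 1"
                using cM by (intro mult_left_mono) auto
              also have "\<dots> \<le> c * v x powr a"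
                using elim 3 low Mpos[OF R(1)] by (auto intro!: mult_left_mono powr_mono2)
              also have "\<dots> \<le> f (v x)"
                by (rule low(4)[OF elim(2) True])
              finally show ?thesis using 3 tv by simp
            next
              case False
              have "1 powr \<sigma> \<le> (v x / t0) powr \<sigma>"
                using False low C by (intro powr_mono2) auto
              then have "c * M R powr a * (1 - (v x / t0) powr \<sigma>) \<le> 0"
                using cM by (intro mult_nonneg_nonpos) auto
              also have "0 \<le> f (v x)" by (rule f0[OF elim(2)])
              finally show ?thesis using 3 tv by simp
            qed
          qed
        qed
      qed
      also have "\<dots> = (LINT x|lebesgue. indicator (hball S R) x * f (v x)) - (LINT x|lebesgue. indicator (hball S R0) x * f (v x))"
        using fi by simp
      finally show "c * V / 2 * R powr Q * M R powr a \<le>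
          (LINT x|lebesgue. indicator (hball S R) x * f (v x)) - (LINT x|lebesgue. indicator (hball S R0) x * f (v x))" .
    qed
  qed
qed

end

end

section \<open>The Liouville argument\<close>

text \<open>The profiles are eliminated in a cycle. \<open>up1\<close> bounds Mu^b below by a power
  of R times Mv^(ab/(p1-1)), \<open>up2\<close> bounds Mv below through I, and \<open>low\<close>
  then bounds the increment of I below by a power of R times I^\<theta>, at radii where I is
  positive. \<open>cond\<close> says that this power of R is nonnegative.\<close>

lemma Liouville_growth:
  fixes Mu Mv I :: "real \<Rightarrow> real" and p\<^sub>1 p\<^sub>2 a b Q C\<^sub>1 C\<^sub>2 c :: real
  assumes p: "p\<^sub>1 > 1" "p\<^sub>2 > 1" and ab: "a > 0" "b > 0" and C: "C\<^sub>1 > 0" "C\<^sub>2 > 0" "c > 0"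
    and cond: "Q - p\<^sub>2 - (p\<^sub>2 - 1) * p\<^sub>1 / a \<le> Q * ((p\<^sub>1 - 1) * (p\<^sub>2 - 1) / (a * b))"
    and M: "\<And>R. R > 0 \<Longrightarrow> Mu R > 0" "\<And>R. R > 0 \<Longrightarrow> Mv R > 0"
    and up1: "\<exists>R1>0. \<forall>R\<ge>R1. R powr p\<^sub>1 * Mv R powr a \<le> C\<^sub>1 * Mu R powr (p\<^sub>1 - 1)"
    and up2: "\<And>R. R > 0 \<Longrightarrow> I R \<le> C\<^sub>2 * R powr (Q - p\<^sub>2) * Mv R powr (p\<^sub>2 - 1)"
    and I: "I 0 = 0" "\<And>R R'. 0 \<le> R \<Longrightarrow> R \<le> R' \<Longrightarrow> I R \<le> I R'"
    and low: "\<forall>R0\<ge>0. \<exists>R1>0. \<forall>R\<ge>R1. c * R powr Q * Mu R powr b \<le> I R - I R0"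
    and small: "\<exists>R0>0. \<forall>R\<ge>R0. Mv R < 1"
  shows False
proof -
  define d1 where "d1 = p\<^sub>1 - 1"
  define d2 where "d2 = p\<^sub>2 - 1"
  define \<theta> where "\<theta> = a * b / (d1 * d2)"
  have d: "d1 > 0" "d2 > 0" using p by (simp_all add: d1_def d2_def)
  have \<theta>: "\<theta> > 0" "d2 * \<theta> = a * b / d1" using d ab by (simp_all add: \<theta>_def)
  obtain R1 where R1: "R1 > 0" "\<And>R. R \<ge> R1 \<Longrightarrow> R powr p\<^sub>1 * Mv R powr a \<le> C\<^sub>1 * Mu R powr d1"
    using up1 unfolding d1_def by blast
  define k1 where "k1 = C\<^sub>1 powr (- b / d1)"
  have k1: "k1 > 0" using C by (simp add: k1_def)
  have Mu_low: "k1 * R powr (p\<^sub>1 * b / d1) * Mv R powr (a * b / d1) \<le> Mu R powr b" if R: "R \<ge> R1" for R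
  proof -
    have R0: "R > 0" using R R1 by linarith
    have "(R powr p\<^sub>1 * Mv R powr a) powr (b / d1) \<le> (C\<^sub>1 * Mu R powr d1) powr (b / d1)"
      using R1(2)[OF R] ab d by (intro powr_mono2) auto
    then have "R powr (p\<^sub>1 * b / d1) * Mv R powr (a * b / d1) \<le> C\<^sub>1 powr (b / d1) * Mu R powr b"
      using d by (simp add: powr_mult powr_powr)
    then have "k1 * (R powr (p\<^sub>1 * b / d1) * Mv R powr (a * b / d1)) \<le> k1 * (C\<^sub>1 powr (b / d1) * Mu R powr b)"
      using k1 by (intro mult_left_mono) auto
    also have "k1 * (C\<^sub>1 powr (b / d1) * Mu R powr b) = Mu R powr b"
    proof -
      have "k1 * C\<^sub>1 powr (b / d1) = 1"
        using C by (simp add: k1_def powr_add[symmetric])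
      then show ?thesis by (simp add: mult.assoc[symmetric])
    qed
    finally show ?thesis by (simp add: mult.assoc)
  qed
  obtain R2 where R2: "R2 > 0" "\<And>R. R \<ge> R2 \<Longrightarrow> c * R powr Q * Mu R powr b \<le> I R"
    using low[rule_format, of 0] I(1) by auto
  obtain R3 where R3: "R3 > 0" "\<And>R. R \<ge> R3 \<Longrightarrow> Mv R < 1"
    using small by blast
  show False
  proof (cases "\<theta> \<le> 1")
    case True
    \<comment> \<open>For \<theta> <= 1 one has ab/d1 <= d2, and Mv < 1 makes Mv^d2 the smaller
      power. Mv then cancels between the lower and the upper bound for I, and R^s stays bounded with
      s > 0.\<close>
    define s where "s = p\<^sub>1 * b / d1 + p\<^sub>2"
    have s: "s > 0" using p ab d by (simp add: s_def add_pos_pos)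
    have ex: "a * b / d1 \<le> d2"
      using True d by (simp add: \<theta>_def field_simps)
    have bound: "R powr s \<le> C\<^sub>2 / (c * k1)" if R: "R \<ge> max R1 (max R2 R3)" for R
    proof -
      have R0: "R > 0" "R \<ge> R1" "R \<ge> R2" "R \<ge> R3" using R R1 by auto
      let ?m = "Mv R powr (a * b / d1)"
      have m: "?m > 0" using M(2)[OF R0(1)] by simp
      have "c * R powr Q * (k1 * R powr (p\<^sub>1 * b / d1) * ?m) \<le> c * R powr Q * Mu R powr b"
        using Mu_low[OF R0(2)] C by (intro mult_left_mono) auto
      also have "\<dots> \<le> C\<^sub>2 * R powr (Q - p\<^sub>2) * Mv R powr d2"
        using R2(2)[OF R0(3)] up2[OF R0(1)] by (simp add: d2_def)
      also have "\<dots> \<le> C\<^sub>2 * R powr (Q - p\<^sub>2) * ?m"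
        using R3(2)[OF R0(4)] M(2)[OF R0(1)] C ex by (intro mult_left_mono powr_mono') auto
      finally have "c * R powr Q * (k1 * R powr (p\<^sub>1 * b / d1)) \<le> C\<^sub>2 * R powr (Q - p\<^sub>2)"
        using m by (simp only: mult.assoc[symmetric] mult_le_cancel_right_pos)
      then have "(c * k1) * (R powr Q * R powr (p\<^sub>1 * b / d1)) \<le> C\<^sub>2 * R powr (Q - p\<^sub>2)"
        by (simp add: mult_ac)
      moreover have "R powr Q * R powr (p\<^sub>1 * b / d1) = R powr s * R powr (Q - p\<^sub>2)"
        by (simp add: powr_add[symmetric] s_def add.commute)
      ultimately have "(c * k1 * R powr s) * R powr (Q - p\<^sub>2) \<le> C\<^sub>2 * R powr (Q - p\<^sub>2)"
        by (simp add: mult_ac)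
      then have "c * k1 * R powr s \<le> C\<^sub>2"
        using R0(1) by simp
      then show ?thesis
        using C k1 by (simp add: pos_le_divide_eq mult_ac)
    qed
    define R where "R = max (max R1 (max R2 R3)) ((C\<^sub>2 / (c * k1) + 1) powr (1 / s))"
    have X: "C\<^sub>2 / (c * k1) + 1 > 0" using C k1 by (simp add: add_pos_pos)
    have "C\<^sub>2 / (c * k1) + 1 = ((C\<^sub>2 / (c * k1) + 1) powr (1 / s)) powr s"
      using s X by (simp add: powr_powr)
    also have "\<dots> \<le> R powr s"
      using s by (intro powr_mono2) (auto simp: R_def)
    also have "\<dots> \<le> C\<^sub>2 / (c * k1)"
      by (rule bound) (simp add: R_def)
    finally show False by simp
  next
    case False
    then have \<theta>1: "\<theta> > 1" by simp
    \<comment> \<open>\<open>cond\<close> multiplied by \<theta>.\<close>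
    have e: "Q + p\<^sub>1 * b / d1 + (p\<^sub>2 - Q) * \<theta> \<ge> 0"
    proof -
      have "(Q - p\<^sub>2 - d2 * p\<^sub>1 / a) * \<theta> \<le> (Q * (d1 * d2 / (a * b))) * \<theta>"
        using cond \<theta> by (intro mult_right_mono) (auto simp: d1_def d2_def)
      moreover have "(Q * (d1 * d2 / (a * b))) * \<theta> = Q"
        using d ab by (simp add: \<theta>_def)
      moreover have "(d2 * p\<^sub>1 / a) * \<theta> = p\<^sub>1 * b / d1"
        using d ab by (simp add: \<theta>_def)
      ultimately show ?thesis by (simp add: algebra_simps)
    qed
    define k2 where "k2 = c * k1 * C\<^sub>2 powr (- \<theta>)"
    have k2: "k2 > 0" using C k1 by (simp add: k2_def)
    have key: "k2 * I R powr \<theta> \<le> c * R powr Q * Mu R powr b" if R: "R \<ge> max 1 R1" and IR: "I R > 0" for R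
    proof -
      have R0: "R > 0" "R \<ge> 1" "R \<ge> R1" using R by auto
      have "I R powr \<theta> \<le> (C\<^sub>2 * R powr (Q - p\<^sub>2) * Mv R powr d2) powr \<theta>"
        using up2[OF R0(1)] IR \<theta> by (intro powr_mono2) (auto simp: d2_def)
      also have "\<dots> = C\<^sub>2 powr \<theta> * R powr ((Q - p\<^sub>2) * \<theta>) * Mv R powr (a * b / d1)"
        by (simp add: powr_mult powr_powr \<theta>(2))
      finally have "k2 * I R powr \<theta> \<le> k2 * (C\<^sub>2 powr \<theta> * R powr ((Q - p\<^sub>2) * \<theta>) * Mv R powr (a * b / d1))"
        using k2 by (intro mult_left_mono) auto
      also have "\<dots> = (c * k1) * (R powr ((Q - p\<^sub>2) * \<theta>) * Mv R powr (a * b / d1))"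
      proof -
        have "k2 * C\<^sub>2 powr \<theta> = c * k1"
          using C by (simp add: k2_def powr_minus)
        then show ?thesis by (simp add: mult.assoc[symmetric])
      qed
      also have "\<dots> \<le> (c * k1) * (R powr (Q + p\<^sub>1 * b / d1) * Mv R powr (a * b / d1))"
      proof -
        have "(Q - p\<^sub>2) * \<theta> \<le> Q + p\<^sub>1 * b / d1"
          using e by (simp add: algebra_simps)
        then have "R powr ((Q - p\<^sub>2) * \<theta>) \<le> R powr (Q + p\<^sub>1 * b / d1)"
          using R0 by (intro powr_mono) auto
        then show ?thesis
          using C k1 by (intro mult_left_mono mult_right_mono) auto
      qed
      also have "\<dots> = c * R powr Q * (k1 * R powr (p\<^sub>1 * b / d1) * Mv R powr (a * b / d1))"
        by (simp add: powr_add mult_ac)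
      also have "\<dots> \<le> c * R powr Q * Mu R powr b"
        using Mu_low[OF R0(3)] C by (intro mult_left_mono) auto
      finally show ?thesis .
    qed
    define Rs where "Rs = max (max 1 R1) R2"
    have Rs: "Rs > 0" "Rs \<ge> max 1 R1" "Rs \<ge> R2" by (auto simp: Rs_def)
    have Ipos: "I R > 0" if "R \<ge> Rs" for R
    proof -
      have "R > 0" "R \<ge> R2" using that Rs by linarith+
      then have "0 < c * R powr Q * Mu R powr b"
        using C M(1)[of R] by simp
      then show ?thesis using R2(2)[OF \<open>R \<ge> R2\<close>] by linarith
    qed
    define D where "D = k2 * I Rs powr \<theta>"
    have D: "D > 0" using k2 Ipos[of Rs] by (simp add: D_def)
    \<comment> \<open>Because I is monotone, I^\<theta> never falls below its value at
      \<open>Rs\<close>; so from any \<open>R0\<close> a further increment of at least the fixed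
      amount \<open>D\<close> is available.\<close>
    have unbounded: "\<exists>R\<ge>Rs. I R \<ge> real n * D" for n
    proof (induction n)
      case 0
      show ?case using Ipos[of Rs] by (intro exI[of _ Rs]) simp
    next
      case (Suc n)
      then obtain R0 where R0: "R0 \<ge> Rs" "I R0 \<ge> real n * D" by blast
      then have "R0 \<ge> 0" using Rs by linarith
      with low obtain R' where R': "R' > 0" "\<And>R. R \<ge> R' \<Longrightarrow> c * R powr Q * Mu R powr b \<le> I R - I R0"
        by blast
      let ?R = "max R' Rs"
      have "D \<le> k2 * I ?R powr \<theta>"
        unfolding D_def using k2 \<theta> Ipos[of Rs] I(2)[of Rs ?R] Rs(1)
        by (intro mult_left_mono powr_mono2) auto
      also have "\<dots> \<le> c * ?R powr Q * Mu ?R powr b"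
        using Rs(2) Ipos[of ?R] by (intro key) auto
      also have "\<dots> \<le> I ?R - I R0"
        by (rule R'(2)) simp
      finally have "I ?R \<ge> real (Suc n) * D"
        using R0(2) by (simp add: algebra_simps)
      then show ?case by (intro exI[of _ ?R]) simp
    qed
    \<comment> \<open>The same inequality with R0 = 0 reads k2 I^\<theta> <= I, and \<theta> > 1
      turns it into this upper bound.\<close>
    define L where "L = (1 / k2) powr (1 / (\<theta> - 1))"
    have bounded: "I R \<le> L" if R: "R \<ge> Rs" for R
    proof -
      have IR: "I R > 0" by (rule Ipos[OF R])
      have "k2 * I R powr \<theta> \<le> c * R powr Q * Mu R powr b"
        using R Rs(2) by (intro key IR) linarith
      also have "\<dots> \<le> I R"
        using R Rs(3) by (intro R2(2)) linarith
      finally have 1: "k2 * I R powr \<theta> \<le> I R" .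
      have "I R powr \<theta> = I R powr (\<theta> - 1) * I R"
        using IR powr_add[of "I R" "\<theta> - 1" 1] by simp
      then have "(k2 * I R powr (\<theta> - 1)) * I R \<le> 1 * I R"
        using 1 by (simp add: mult.assoc)
      then have "k2 * I R powr (\<theta> - 1) \<le> 1"
        using IR mult_le_cancel_right_pos by blast
      then have "I R powr (\<theta> - 1) \<le> 1 / k2"
        using k2 by (simp add: pos_le_divide_eq mult.commute)
      then have "(I R powr (\<theta> - 1)) powr (1 / (\<theta> - 1)) \<le> L"
        unfolding L_def using \<theta>1 by (intro powr_mono2) auto
      then show ?thesis
        using \<theta>1 IR by (simp add: powr_powr)
    qed
    obtain n where "L / D < real n"
      using reals_Archimedean2 by blast
    then have "L < real n * D"
      using D by (simp add: pos_divide_less_eq)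
    moreover obtain R where "R \<ge> Rs" "I R \<ge> real n * D"
      using unbounded by blast
    ultimately show False
      using bounded[of R] by linarith
  qed
qed

section \<open>Assembly of the estimates for the system\<close>

lemma power_lower_bound_near_0:
  assumes "Liminf (at_right 0) (\<lambda>t. ereal (f t / t powr a)) > 0"
  obtains t0 c :: real where "t0 > 0" "c > 0" "\<And>t. 0 < t \<Longrightarrow> t < t0 \<Longrightarrow> c * t powr a \<le> f t"
proof -
  from ereal_dense2[OF assms] obtain c where c: "0 < ereal c" "ereal c < Liminf (at_right 0) (\<lambda>t. ereal (f t / t powr a))"
    by (elim exE conjE)
  from less_LiminfD[OF c(2)] have "\<forall>\<^sub>F t in at_right 0. c < f t / t powr a"
    by simp
  then obtain t0 where t0: "t0 > 0" "\<And>t. 0 < t \<Longrightarrow> t < t0 \<Longrightarrow> c < f t / t powr a"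
    unfolding eventually_at_right_field by blast
  show thesis
  proof (rule that[of t0 c])
    fix t :: real assume t: "0 < t" "t < t0"
    then have "c * t powr a < f t"
      using t0(2)[OF t] by (simp add: pos_less_divide_eq)
    then show "c * t powr a \<le> f t" by simp
  qed (use c t0 in auto)
qed

context homogeneous_carnot_group
begin

context
  fixes S :: "real ^ 'n \<Rightarrow> real"
  assumes S: "homogeneous_norm ginv wt S"
begin

text \<open>Covers the alternative in which the second entry of the minimum satisfies the bound. The
  system is symmetric under interchanging the equations, so the other alternative is a second
  instance.\<close>

lemma no_solution:
  fixes A\<^sub>1 A\<^sub>2 :: "('n, 'l) operator" and f g :: "real \<Rightarrow> real"
  defines "Q \<equiv> real (homogeneous_dim wt r)"
  assumes p: "1 < p\<^sub>1" "1 < p\<^sub>2" and Q: "Q > 0"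
    and A\<^sub>1: "caratheodory A\<^sub>1" "weakly_coercive p\<^sub>1 A\<^sub>1" "weak_harnack X S p\<^sub>1 A\<^sub>1"
    and A\<^sub>2: "caratheodory A\<^sub>2" "weakly_coercive p\<^sub>2 A\<^sub>2" "weak_harnack X S p\<^sub>2 A\<^sub>2"
    and f0: "\<And>t. t > 0 \<Longrightarrow> f t \<ge> 0" and g0: "\<And>t. t > 0 \<Longrightarrow> g t \<ge> 0"
    and ab: "a > 0" "b > 0"
    and f: "Liminf (at_right 0) (\<lambda>t. ereal (f t / t powr a)) > 0"
    and g: "Liminf (at_right 0) (\<lambda>t. ereal (g t / t powr b)) > 0"
    and cond: "Q - p\<^sub>2 - (p\<^sub>2 - 1) * p\<^sub>1 / a \<le> Q * ((p\<^sub>1 - 1) * (p\<^sub>2 - 1) / (a * b))"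
    and uv: "AE x in lebesgue. u x > 0" "AE x in lebesgue. v x > 0"
    and solu: "weak_supersolution X p\<^sub>1 A\<^sub>1 (\<lambda>x. f (v x)) u"
    and solv: "weak_supersolution X p\<^sub>2 A\<^sub>2 (\<lambda>x. g (u x)) v"
    and inf: "ess_inf UNIV u = 0" "ess_inf UNIV v = 0"
  shows False
proof -
  have fv0: "AE x in lebesgue. f (v x) \<ge> 0" and gu0: "AE x in lebesgue. g (u x) \<ge> 0"
    using uv(2) uv(1) by (eventually_elim, simp add: f0 g0)+
  have fv1: "Lp_loc 1 (\<lambda>x. f (v x))" and gu1: "Lp_loc 1 (\<lambda>x. g (u x))"
    using solu solv by (simp_all add: weak_supersolution_def)
  obtain Mu Cu \<sigma>u where u': "Cu > 0" "\<sigma>u > 0" "\<forall>R>0. Mu R > 0"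
    "\<forall>R>0. AE x in lebesgue. x \<in> hball S R \<longrightarrow> Mu R \<le> u x"
    "\<forall>R>0. integrable lebesgue (\<lambda>x. indicator (hball S R) x * u x powr \<sigma>u)"
    "\<forall>R>0. (LINT x|lebesgue. indicator (hball S R) x * u x powr \<sigma>u) \<le> Cu * R powr Q * Mu R powr \<sigma>u"
    "\<forall>R>0. (LINT x|lebesgue. indicator (hball S R) x * f (v x)) \<le> Cu * R powr (Q - p\<^sub>1) * Mu R powr (p\<^sub>1 - 1)"
    "ess_inf UNIV u = 0 \<longrightarrow> (\<forall>\<delta>>0. \<exists>R0>0. \<forall>R\<ge>R0. Mu R < \<delta>)"
    by (rule supersolution_profile[OF S p(1) A\<^sub>1 solu uv(1) fv0, folded Q_def])
  note u = u'(1,2) u'(3-7)[rule_format] u'(8)[rule_format, OF inf(1)]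
  obtain Mv Cv \<sigma>v where v': "Cv > 0" "\<sigma>v > 0" "\<forall>R>0. Mv R > 0"
    "\<forall>R>0. AE x in lebesgue. x \<in> hball S R \<longrightarrow> Mv R \<le> v x"
    "\<forall>R>0. integrable lebesgue (\<lambda>x. indicator (hball S R) x * v x powr \<sigma>v)"
    "\<forall>R>0. (LINT x|lebesgue. indicator (hball S R) x * v x powr \<sigma>v) \<le> Cv * R powr Q * Mv R powr \<sigma>v"
    "\<forall>R>0. (LINT x|lebesgue. indicator (hball S R) x * g (u x)) \<le> Cv * R powr (Q - p\<^sub>2) * Mv R powr (p\<^sub>2 - 1)"
    "ess_inf UNIV v = 0 \<longrightarrow> (\<forall>\<delta>>0. \<exists>R0>0. \<forall>R\<ge>R0. Mv R < \<delta>)"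
    by (rule supersolution_profile[OF S p(2) A\<^sub>2 solv uv(2) gu0, folded Q_def])
  note v = v'(1,2) v'(3-7)[rule_format] v'(8)[rule_format, OF inf(2)]
  obtain tf cf where tf: "tf > 0" "cf > 0" "\<And>t. 0 < t \<Longrightarrow> t < tf \<Longrightarrow> cf * t powr a \<le> f t"
    by (rule power_lower_bound_near_0[OF f]) blast
  obtain tg cg where tg: "tg > 0" "cg > 0" "\<And>t. 0 < t \<Longrightarrow> t < tg \<Longrightarrow> cg * t powr b \<le> g t"
    by (rule power_lower_bound_near_0[OF g]) blast
  define J where "J R = (LINT x|lebesgue. indicator (hball S R) x * f (v x))" for R
  define I where "I R = (LINT x|lebesgue. indicator (hball S R) x * g (u x))" for R
  have empty: "hball S 0 = {}"
    using S_nonneg[OF S] by (auto simp: hball_def not_less)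
  have "\<exists>c1>0. \<forall>R0\<ge>0. \<exists>R1>0. \<forall>R\<ge>R1. c1 * R powr Q * Mv R powr a \<le> J R - J R0"
    unfolding Q_def J_def
    by (rule mass_lower_bound[OF S Q[unfolded Q_def] uv(2) f0 fv1 tf(1,2) ab(1) tf(3) v(1-5) v(6)[unfolded Q_def] v(8)])
  then obtain c1 where c1: "c1 > 0" "\<forall>R0\<ge>0. \<exists>R1>0. \<forall>R\<ge>R1. c1 * R powr Q * Mv R powr a \<le> J R - J R0"
    by (elim exE conjE)
  have "\<exists>c2>0. \<forall>R0\<ge>0. \<exists>R1>0. \<forall>R\<ge>R1. c2 * R powr Q * Mu R powr b \<le> I R - I R0"
    unfolding Q_def I_def
    by (rule mass_lower_bound[OF S Q[unfolded Q_def] uv(1) g0 gu1 tg(1,2) ab(2) tg(3) u(1-5) u(6)[unfolded Q_def] u(8)])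
  then obtain c2 where c2: "c2 > 0" "\<forall>R0\<ge>0. \<exists>R1>0. \<forall>R\<ge>R1. c2 * R powr Q * Mu R powr b \<le> I R - I R0"
    by (elim exE conjE)
  \<comment> \<open>The mass of f(v) is bounded below by \<open>c1\<close> (with R0 = 0) and above
    by the profile of u; the common factor R^(Q-p1) cancels.\<close>
  have up1: "\<exists>R1>0. \<forall>R\<ge>R1. R powr p\<^sub>1 * Mv R powr a \<le> (Cu / c1) * Mu R powr (p\<^sub>1 - 1)"
  proof -
    obtain R1 where R1: "R1 > 0" "\<And>R. R \<ge> R1 \<Longrightarrow> c1 * R powr Q * Mv R powr a \<le> J R"
      using c1(2)[rule_format, of 0] by (auto simp: J_def empty)
    have "R powr p\<^sub>1 * Mv R powr a \<le> (Cu / c1) * Mu R powr (p\<^sub>1 - 1)" if R: "R \<ge> R1" for R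
    proof -
      have R0: "R > 0" using R R1 by linarith
      have "c1 * R powr Q * Mv R powr a \<le> Cu * R powr (Q - p\<^sub>1) * Mu R powr (p\<^sub>1 - 1)"
        using R1(2)[OF R] u(7)[OF R0] by (simp add: J_def)
      moreover have "R powr Q = R powr p\<^sub>1 * R powr (Q - p\<^sub>1)"
        by (simp add: powr_add[symmetric])
      ultimately have "(c1 * (R powr p\<^sub>1 * Mv R powr a)) * R powr (Q - p\<^sub>1) \<le> (Cu * Mu R powr (p\<^sub>1 - 1)) * R powr (Q - p\<^sub>1)"
        by (simp add: mult_ac)
      then have "c1 * (R powr p\<^sub>1 * Mv R powr a) \<le> Cu * Mu R powr (p\<^sub>1 - 1)"
        using R0 by simp
      then show ?thesis
        using c1(1) by (simp add: pos_le_divide_eq mult_ac)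
    qed
    then show ?thesis using R1(1) by blast
  qed
  show False
  proof (rule Liouville_growth[OF p ab _ v(1) c2(1) cond u(3) v(3) up1])
    show "Cu / c1 > 0" using u(1) c1(1) by simp
    show "I R \<le> Cv * R powr (Q - p\<^sub>2) * Mv R powr (p\<^sub>2 - 1)" if "R > 0" for R
      using v(7)[OF that] by (simp add: I_def)
    show "I 0 = 0" by (simp add: I_def empty)
    show "I R \<le> I R'" if "R \<le> R'" for R R'
      unfolding I_def
    proof (rule integral_mono_AE)
      show "integrable lebesgue (\<lambda>x. indicator (hball S R) x * g (u x))" for R
        by (rule Lp_loc_integrable_indicator_bounded[OF gu1 bounded_hball[OF S] hball_sets[OF S]])
      then show "integrable lebesgue (\<lambda>x. indicator (hball S R') x * g (u x))" .
      show "AE x in lebesgue. indicator (hball S R) x * g (u x) \<le> indicator (hball S R') x * g (u x)"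
        using gu0 by eventually_elim (use hball_mono[OF S that] in \<open>auto simp: indicator_def\<close>)
    qed
    show "\<forall>R0\<ge>0. \<exists>R1>0. \<forall>R\<ge>R1. c2 * R powr Q * Mu R powr b \<le> I R - I R0"
      by (rule c2(2))
    show "\<exists>R0>0. \<forall>R\<ge>R0. Mv R < 1"
      by (rule v(8)) simp
  qed
qed

end

end

theorem theorem5p6:
  fixes gmult :: "real ^ 'n::finite \<Rightarrow> real ^ 'n \<Rightarrow> real ^ 'n"
    and ginv :: "real ^ 'n \<Rightarrow> real ^ 'n"
    and wt :: "'n \<Rightarrow> nat" and r :: nat
    and \<iota> :: "'l::finite \<Rightarrow> 'n"
    and X :: "'l \<Rightarrow> 'n vfield"
    and S :: "real ^ 'n \<Rightarrow> real"
    and Q p\<^sub>1 p\<^sub>2 a b :: real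
    and A\<^sub>1 A\<^sub>2 :: "('n, 'l) operator"
    and f g :: "real \<Rightarrow> real"
  assumes "homogeneous_carnot_group gmult ginv wt r \<iota> X"
    and "homogeneous_norm ginv wt S"
    and "Q = real (homogeneous_dim wt r)"
    and "1 < p\<^sub>1" "p\<^sub>1 < Q" "1 < p\<^sub>2" "p\<^sub>2 < Q"
    and "caratheodory A\<^sub>1" "caratheodory A\<^sub>2"
    and "weakly_coercive p\<^sub>1 A\<^sub>1" "weakly_coercive p\<^sub>2 A\<^sub>2"
    and "weak_harnack X S p\<^sub>1 A\<^sub>1" "weak_harnack X S p\<^sub>2 A\<^sub>2"
    and "continuous_on {0<..} f" "\<And>t. t > 0 \<Longrightarrow> f t \<ge> 0"
    and "continuous_on {0<..} g" "\<And>t. t > 0 \<Longrightarrow> g t \<ge> 0"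
    and "a > 0" "b > 0"
    and "Liminf (at_right 0) (\<lambda>t. ereal (f t / t powr a)) > 0"
    and "Liminf (at_right 0) (\<lambda>t. ereal (g t / t powr b)) > 0"
    and "min (Q - p\<^sub>1 - (p\<^sub>1 - 1) * p\<^sub>2 / b) (Q - p\<^sub>2 - (p\<^sub>2 - 1) * p\<^sub>1 / a)
           \<le> Q * ((p\<^sub>1 - 1) * (p\<^sub>2 - 1) / (a * b))"
  shows "\<not> (\<exists>u v. system_weak_solution X p\<^sub>1 p\<^sub>2 A\<^sub>1 A\<^sub>2 f g u v \<and>
           ess_inf UNIV u = 0 \<and> ess_inf UNIV v = 0)"
proof
  interpret homogeneous_carnot_group gmult ginv wt r \<iota> X
    by (rule assms(1))
  assume "\<exists>u v. system_weak_solution X p\<^sub>1 p\<^sub>2 A\<^sub>1 A\<^sub>2 f g u v \<and> ess_inf UNIV u = 0 \<and> ess_inf UNIV v = 0"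
  then obtain u v where sol: "system_weak_solution X p\<^sub>1 p\<^sub>2 A\<^sub>1 A\<^sub>2 f g u v"
    and inf: "ess_inf UNIV u = 0" "ess_inf UNIV v = 0"
    by (elim exE conjE)
  have uv: "AE x in lebesgue. u x > 0" "AE x in lebesgue. v x > 0"
    "weak_supersolution X p\<^sub>1 A\<^sub>1 (\<lambda>x. f (v x)) u" "weak_supersolution X p\<^sub>2 A\<^sub>2 (\<lambda>x. g (u x)) v"
    using sol by (simp_all add: system_weak_solution_def)
  have Q: "real (homogeneous_dim wt r) > 0"
    using assms(3-5) by linarith
  \<comment> \<open>The second alternative is written with \<open>p\<^sub>1\<close>,
    \<open>a\<close> and \<open>p\<^sub>2\<close>, \<open>b\<close> exchanged, so that it is
    literally the condition of \<open>no_solution\<close> for the pair (v, u) with g in the role of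
    f.\<close>
  from assms(22) consider
    "Q - p\<^sub>2 - (p\<^sub>2 - 1) * p\<^sub>1 / a \<le> Q * ((p\<^sub>1 - 1) * (p\<^sub>2 - 1) / (a * b))"
    | "Q - p\<^sub>1 - (p\<^sub>1 - 1) * p\<^sub>2 / b \<le> Q * ((p\<^sub>2 - 1) * (p\<^sub>1 - 1) / (b * a))"
    by (auto simp: min_le_iff_disj mult.commute)
  then show False
  proof cases
    case 1
    show False
      by (rule no_solution[OF assms(2,4,6) Q assms(8,10,12,9,11,13,15,17,18,19,20,21)
            1[unfolded assms(3)] uv inf])
  next
    case 2
    show False
      by (rule no_solution[OF assms(2,6,4) Q assms(9,11,13,8,10,12,17,15,19,18,21,20)
            2[unfolded assms(3)] uv(2,1,4,3) inf(2,1)])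
  qed
qed

end
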